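(* Let $K$ be a field, let $v_1,\ldots,v_m\in\mathbb{N}^s$, and let $\mathcal{P}=\mathrm{conv}(v_1,\ldots,v_m)\subset\mathbb{R}^s$. Let $w_i\colon\mathbb{R}^s\to\mathbb{R}$, $i=1,\ldots,p$, be linear functions such that $w_i(e_j)\in\mathbb{N}$ for all $i,j$, let $w=(w_1,\ldots,w_p)\colon\mathbb{R}^s\to\mathbb{R}^p$, and let $B$ be the matrix whose columns are the vectors $(w(v_i),1)\in\mathbb{N}^{p+1}$, $i=1,\ldots,m$. Let $A^w(\mathcal{P})$ be the $K$-subalgebra $$A^w(\mathcal{P}):=K[\{y^{w(a)}z^n\mid n\in\mathbb{N},\ a\in n\mathcal{P}\cap\mathbb{Z}^s\}]\subset K[y_1,\ldots,y_p,z].$$ Then the following hold. (a) $A^w(\mathcal{P})=\bigoplus_{n=0}^{\infty}A^w(\mathcal{P})_n$ is a graded $K$-algebra whose $n$-th graded component is $$A^w(\mathcal{P})_n:=\sum_{a\in n\mathcal{P}\cap\mathbb{Z}^s}K\,y^{w(a)}z^n\quad\text{for all } n\ge 0.$$ (b) The Hilbert function of $A^w(\mathcal{P})$ is given by $$H_{A^w(\mathcal{P})}(n):=\dim_K(A^w(\mathcal{P})_n)=|w(n\mathcal{P}\cap\mathbb{Z}^s)|\quad\text{for all } n\ge 0.$$ (c) There are monomials $t^{c_1}z^{d_1},\ldots,t^{c_r}z^{d_r}\in A(\mathcal{P})$ such that $$A(\mathcal{P})=K[\{t^{c_i}z^{d_i}\mid i=1,\ldots,r\}]\quad\text{and}\quad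 A^w(\mathcal{P})=K[\{y^{w(c_i)}z^{d_i}\mid i=1,\ldots,r\}].$$ (d) Let $L:=K[\{y^{w(v_i)}z\mid i=1,\ldots,m\}]$. Then $L\subset A^w(\mathcal{P})$ is a finite integral extension. (e) $\overline{L}\subset\overline{A^w(\mathcal{P})}\subset A(w(\mathcal{P}))$, with equality everywhere if and only if the greatest common divisor of all non-zero $k\times k$ minors of the matrix $B$ is equal to $1$, where $k=\mathrm{rank}(B)$. (f) The Hilbert function $H_{A^w(\mathcal{P})}$ is a polynomial function of degree $\dim(A^w(\mathcal{P}))-1$, and the Hilbert series $F_{A^w(\mathcal{P})}(x)=\sum_{n=0}^\infty H_{A^w(\mathcal{P})}(n)x^n$ has the form $$F_{A^w(\mathcal{P})}(x)=\frac{h(x)}{(1-x)^{\dim(A^w(\mathcal{P}))}},$$ where $h(x)\in\mathbb{Z}[x]$ and $h(1)\neq 0$.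
   Context: $\mathbb{N}=\{0,1,2,\ldots\}$; $e_j$ is the $j$-th standard basis vector of $\mathbb{R}^s$. For $a\in\mathbb{N}^s$, $t^a:=t_1^{a_1}\cdots t_s^{a_s}$ and $y^{w(a)}:=y_1^{w_1(a)}\cdots y_p^{w_p(a)}$. Here $K[t_1,\ldots,t_s,z]$ and $K[y_1,\ldots,y_p,z]$ are polynomial rings over $K$, and $K[M]$, for a set $M$ of monomials, denotes the $K$-subalgebra generated by $M$. For a lattice polytope $\mathcal{P}\subset\mathbb{R}^s$ with vertices in $\mathbb{N}^s$, its Ehrhart ring is $A(\mathcal{P}):=K[\{t^az^n\mid n\in\mathbb{N},\ a\in n\mathcal{P}\cap\mathbb{Z}^s\}]\subset K[t_1,\ldots,t_s,z]$. Likewise, for the lattice polytope $w(\mathcal{P})=\mathrm{conv}(w(v_1),\ldots,w(v_m))\subset\mathbb{R}^p$, one has $A(w(\mathcal{P}))=K[\{y^bz^n\mid n\in\mathbb{N},\ b\in n\,w(\mathcal{P})\cap\mathbb{Z}^p\}]\subset K[y_1,\ldots,y_p,z]$. For an integral domain $R$, $\overline{R}$ denotes the integral closure of $R$ in its field of fractions, and $\dim(R)$ is the Krull dimension. A function $E\colon\mathbb{N}\to\mathbb{N}$ is a polynomial function if there is a polynomial $g$ (with rational coefficients) such that $E(n)=g(n)$ for all $n\gg 0$; its degree is the degree of $g$. *)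

theory Defs
  imports
    "HOL-Analysis.Analysis"
    "HOL-Library.Poly_Mapping"
    "HOL-Library.Extended_Nat"
    "HOL-Computational_Algebra.Computational_Algebra"
    "HOL-Algebra.Ideal"
    "Jordan_Normal_Form.DL_Rank_Submatrix"
begin

no_notation Matrix.vec_index (infixl \<open>$\<close> 100)

section \<open>Lattice points\<close>

definition natural_vectors :: "(real ^ 'n) set" where
  "natural_vectors = {a. \<forall>j. a $ j \<in> \<nat>}"

definition lattice_points :: "(real ^ 'n) set \<Rightarrow> (real ^ 'n) set" where
  "lattice_points S = {a \<in> S. \<forall>j. a $ j \<in> \<int>}"

definition dilation :: "nat \<Rightarrow> (real ^ 'n) set \<Rightarrow> (real ^ 'n) set" where
  "dilation n S = (\<lambda>x. real n *\<^sub>R x) ` S"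


section \<open>The polynomial rings and their subalgebras\<close>

text \<open>
  For a finite index type \<open>'i\<close>, the polynomial ring in the variables \<open>x\<^sub>i\<close> (\<open>i :: 'i\<close>) and \<open>z\<close> over
  the field \<open>'k\<close> is represented as \<open>K[x][z]\<close>, where \<open>K[x]\<close> is the monoid algebra of the
  exponent monoid \<open>'i \<Rightarrow>\<^sub>0 nat\<close>.
\<close>

type_synonym ('i, 'k) polyz = "(('i \<Rightarrow>\<^sub>0 nat) \<Rightarrow>\<^sub>0 'k) poly"

text \<open>Only meaningful on \<^const>\<open>natural_vectors\<close>; elsewhere the coordinates are rounded.\<close>

definition exponent :: "real ^ 'i \<Rightarrow> ('i::finite \<Rightarrow>\<^sub>0 nat)" where
  "exponent a = Abs_poly_mapping (\<lambda>i. nat \<lfloor>a $ i\<rfloor>)"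

lemma lookup_exponent: "Poly_Mapping.lookup (exponent a) i = nat \<lfloor>a $ i\<rfloor>"
  by (simp add: exponent_def)

text \<open>The monomial \<open>x\<^sup>a z\<^sup>n\<close>.\<close>

definition xz_monom :: "real ^ 'i \<Rightarrow> nat \<Rightarrow> ('i::finite, 'k::field) polyz" where
  "xz_monom a n = Polynomial.monom (Poly_Mapping.single (exponent a) 1) n"

definition kconst :: "'k::field \<Rightarrow> ('i, 'k) polyz" where
  "kconst c = [:Poly_Mapping.single 0 c:]"

definition kscale :: "'k::field \<Rightarrow> ('i, 'k) polyz \<Rightarrow> ('i, 'k) polyz" where
  "kscale c f = kconst c * f"

abbreviation kspan :: "('i, 'k::field) polyz set \<Rightarrow> ('i, 'k) polyz set" where
  "kspan \<equiv> Modules.module.span kscale"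

abbreviation ksubspace :: "('i, 'k::field) polyz set \<Rightarrow> bool" where
  "ksubspace \<equiv> Modules.module.subspace kscale"

abbreviation kdim :: "('i, 'k::field) polyz set \<Rightarrow> nat" where
  "kdim \<equiv> Vector_Spaces.vector_space.dim kscale"

lemma vector_space_kscale: "Vector_Spaces.vector_space (kscale :: 'k::field \<Rightarrow> ('i, 'k) polyz \<Rightarrow> _)"
  by unfold_locales
    (simp_all add: kscale_def kconst_def single_add mult_single smult_add_right smult_add_left mult.commute)

definition ksubalgebra :: "('i, 'k::field) polyz set \<Rightarrow> bool" where
  "ksubalgebra A \<longleftrightarrow> range kconst \<subseteq> A \<and> (\<forall>f\<in>A. \<forall>g\<in>A. f + g \<in> A \<and> f * g \<in> A)"

definition kalgebra :: "('i, 'k::field) polyz set \<Rightarrow> ('i, 'k) polyz set" where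
  "kalgebra M = ksubalgebra hull M"

text \<open>\<open>A = \<Oplus>\<^sub>n G n\<close> as an \<open>\<nat>\<close>-graded algebra over the field.\<close>

definition graded_kalgebra :: "('i, 'k::field) polyz set \<Rightarrow> (nat \<Rightarrow> ('i, 'k) polyz set) \<Rightarrow> bool" where
  "graded_kalgebra A G \<longleftrightarrow>
     ksubalgebra A \<and>
     (\<forall>n. ksubspace (G n) \<and> G n \<subseteq> A) \<and>
     (\<forall>i j. \<forall>f\<in>G i. \<forall>g\<in>G j. f * g \<in> G (i + j)) \<and>
     (\<forall>f\<in>A. \<exists>!g. (\<forall>n. g n \<in> G n) \<and> finite {n. g n \<noteq> 0} \<and> f = (\<Sum>n | g n \<noteq> 0. g n))"

definition hilbert_function :: "(nat \<Rightarrow> ('i, 'k::field) polyz set) \<Rightarrow> nat \<Rightarrow> nat" where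
  "hilbert_function G n = kdim (G n)"


section \<open>Ehrhart rings\<close>

definition ehrhart_ring :: "(real ^ 'i) set \<Rightarrow> ('i::finite, 'k::field) polyz set" where
  "ehrhart_ring Q = kalgebra {xz_monom a n | a n. a \<in> lattice_points (dilation n Q)}"

definition weighted_ehrhart_ring ::
    "(real ^ 's \<Rightarrow> real ^ 'p) \<Rightarrow> (real ^ 's) set \<Rightarrow> ('p::finite, 'k::field) polyz set" where
  "weighted_ehrhart_ring W Q = kalgebra {xz_monom (W a) n | a n. a \<in> lattice_points (dilation n Q)}"

definition weighted_ehrhart_component ::
    "(real ^ 's \<Rightarrow> real ^ 'p) \<Rightarrow> (real ^ 's) set \<Rightarrow> nat \<Rightarrow> ('p::finite, 'k::field) polyz set" where
  "weighted_ehrhart_component W Q n = kspan {xz_monom (W a) n | a. a \<in> lattice_points (dilation n Q)}"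


section \<open>Integral extensions and integral closure\<close>

definition integral_over :: "'a::comm_ring_1 set \<Rightarrow> 'a \<Rightarrow> bool" where
  "integral_over R x \<longleftrightarrow>
     (\<exists>q. Polynomial.lead_coeff q = 1 \<and> (\<forall>i. Polynomial.coeff q i \<in> R) \<and> poly q x = 0)"

definition integral_extension :: "'a::comm_ring_1 set \<Rightarrow> 'a set \<Rightarrow> bool" where
  "integral_extension R S \<longleftrightarrow> R \<subseteq> S \<and> (\<forall>x\<in>S. integral_over R x)"

text \<open>\<open>S\<close> is finitely generated as an \<open>R\<close>-module.\<close>

definition finite_extension :: "'a::comm_ring_1 set \<Rightarrow> 'a set \<Rightarrow> bool" where
  "finite_extension R S \<longleftrightarrow> R \<subseteq> S \<and>
     (\<exists>F. finite F \<and> F \<subseteq> S \<and> (\<forall>x\<in>S. \<exists>c. (\<forall>f\<in>F. c f \<in> R) \<and> x = (\<Sum>f\<in>F. c f * f)))"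

text \<open>
  The field of fractions of a subring \<open>R\<close> of an integral domain is taken inside the field of fractions
  of the whole domain, so that the integral closures of different subrings can be compared as sets.
\<close>

definition to_frac :: "'a::idom \<Rightarrow> 'a fract" where
  "to_frac a = Fraction_Field.Fract a 1"

definition fraction_field_of :: "'a::idom set \<Rightarrow> 'a fract set" where
  "fraction_field_of R = {Fraction_Field.Fract a b | a b. a \<in> R \<and> b \<in> R \<and> b \<noteq> 0}"

definition integral_closure :: "'a::idom set \<Rightarrow> 'a fract set" where
  "integral_closure R = {x \<in> fraction_field_of R. integral_over (to_frac ` R) x}"


section \<open>Krull dimension\<close>

definition ring_of :: "'a::comm_ring_1 set \<Rightarrow> 'a ring" where
  "ring_of R = \<lparr>carrier = R, monoid.mult = (*), one = 1, zero = 0, add = (+)\<rparr>"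

definition krull_dim :: "'a::comm_ring_1 set \<Rightarrow> enat" where
  "krull_dim R = Sup {enat n | n. \<exists>\<pp>. (\<forall>i\<le>n. primeideal (\<pp> i) (ring_of R)) \<and> (\<forall>i<n. \<pp> i \<subset> \<pp> (Suc i))}"


section \<open>Polynomial functions\<close>

definition polynomial_function_of_degree :: "(nat \<Rightarrow> nat) \<Rightarrow> nat \<Rightarrow> bool" where
  "polynomial_function_of_degree E d \<longleftrightarrow>
     (\<exists>g :: rat poly. g \<noteq> 0 \<and> Polynomial.degree g = d \<and>
        eventually (\<lambda>n. of_nat (E n) = poly g (of_nat n)) sequentially)"


section \<open>The matrix B and its minors\<close>

text \<open>
  The columns are \<open>(W (v i), 1)\<close> for \<open>i = 1, \<dots>, m\<close>. Matrix indices start at 0, and the coordinates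
  of \<open>real ^ 'p\<close> are enumerated in increasing order of \<open>'p\<close>.
\<close>

definition weight_matrix ::
    "(real ^ 's \<Rightarrow> real ^ 'p::{finite,linorder}) \<Rightarrow> (nat \<Rightarrow> real ^ 's) \<Rightarrow> nat \<Rightarrow> int Matrix.mat" where
  "weight_matrix W v m = Matrix.mat (CARD('p) + 1) m
     (\<lambda>(i, j). if i < CARD('p) then \<lfloor>W (v (Suc j)) $ (sorted_list_of_set (UNIV :: 'p set) ! i)\<rfloor> else 1)"

definition int_mat_rank :: "int Matrix.mat \<Rightarrow> nat" where
  "int_mat_rank B = vec_space.rank (dim_row B) (map_mat rat_of_int B)"

definition minors :: "nat \<Rightarrow> int Matrix.mat \<Rightarrow> int set" where
  "minors k B = {Determinant.det (submatrix B I J) | I J.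
     I \<subseteq> {..<dim_row B} \<and> J \<subseteq> {..<dim_col B} \<and> card I = k \<and> card J = k}"

end

theory Submission
  imports
    Defs
    "HOL-Real_Asymp.Real_Asymp"
    "Jordan_Normal_Form.Char_Poly"
begin

text \<open>
  All rings in the theorem are spanned by monomials \<open>y\<^sup>b z\<^sup>n\<close>, so everything is read off the monoids
  \<open>S\<close> of the exponents of \<open>A\<^sup>w(P)\<close> and \<open>G\<close> of the exponents of \<open>L\<close>. Rounding down the coefficients of a
  point of \<open>n P\<close> writes \<open>S\<close> as finitely many translates of \<open>G\<close>; this gives the generators in (c) and
  the finiteness in (d).

  For (e), the lowest monomial of a fraction that is almost integral over \<open>A(w(P))\<close> lies in the closed
  cone over \<open>w(P)\<close>, so such a fraction can be expanded monomial by monomial, and \<open>A(w(P))\<close> is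
  integrally closed. Equality of the three rings means that the lattice generated by the columns of
  \<open>B\<close> contains every integral vector of its real span, which is what the gcd of the minors detects.

  For (f), choosing for every element of \<open>S\<close> its least representation turns \<open>S\<close> into a disjoint union of
  down-sets of \<open>\<nat>\<^sup>m\<close>, whose generating functions are rational by Dickson's lemma. The number of
  elements of degree \<open>n\<close> grows like \<open>n\<^sup>k\<close> with \<open>k = dim w(P)\<close>, which determines the order of the
  pole at 1. The same growth forces algebraic relations that bound the length of chains of primes by
  \<open>k + 1\<close>, and a maximal chain of faces of \<open>w(P)\<close> provides a chain of primes of this length.
\<close>

section \<open>Monomials and supports\<close>

text \<open>The rings in (d) and (e) come from one construction: \<open>A(w(P))\<close> is the ring
  of the same kind for the points \<open>w(v_i)\<close> and the identity map, with the same
  submonoid \<open>G\<close>. So the finiteness proved for (d) also makes \<open>A(w(P))\<close>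
  finite over \<open>L\<close>, and equality in (e) becomes equality of fraction fields, which is a
  question about lattices.

  Integrality is traded for almost integrality: \<open>c f^n \<in> g^n R\<close> for all
  \<open>n\<close>, with one fixed \<open>c \<noteq> 0\<close>. This condition passes to lowest
  monomials, and it survives subtracting \<open>g t\<close> from \<open>f\<close> with the same
  \<open>c\<close>, so monomials can be split off one at a time.

  An element of \<open>S\<close> has many representations by a generator and a vector in N^m. An
  order that is invariant under translation is what makes the least ones a down-set.

  The dimension exceeds \<open>dim w(P)\<close> by one for two reasons that match. On the upper
  side, the elements of degree at most \<open>D\<close> are counted, and the summation over degrees
  raises the growth exponent by one. On the lower side, the chain of faces starts at the empty
  face.\<close>

type_synonym 'i expo = "('i \<Rightarrow>\<^sub>0 nat) \<times> nat"

definition mon :: "'i expo \<Rightarrow> ('i, 'k::field) polyz" where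
  "mon s = monom (Poly_Mapping.single (fst s) 1) (snd s)"

definition mcoeff :: "('i, 'k::field) polyz \<Rightarrow> 'i expo \<Rightarrow> 'k" where
  "mcoeff f s = Poly_Mapping.lookup (coeff f (snd s)) (fst s)"

definition msupp :: "('i, 'k::field) polyz \<Rightarrow> 'i expo set" where
  "msupp f = {s. mcoeff f s \<noteq> 0}"

definition kmon :: "'i expo set \<Rightarrow> ('i, 'k::field) polyz set" where
  "kmon S = {f. msupp f \<subseteq> S}"

inductive_set monoid_gen :: "'a::comm_monoid_add set \<Rightarrow> 'a set" for M where
  zero: "0 \<in> monoid_gen M"
| add: "s \<in> M \<Longrightarrow> t \<in> monoid_gen M \<Longrightarrow> s + t \<in> monoid_gen M"

definition add_closed :: "'a::comm_monoid_add set \<Rightarrow> bool" where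
  "add_closed S \<longleftrightarrow> 0 \<in> S \<and> (\<forall>s\<in>S. \<forall>t\<in>S. s + t \<in> S)"

lemma add_closedD: "add_closed S \<Longrightarrow> s \<in> S \<Longrightarrow> t \<in> S \<Longrightarrow> s + t \<in> S"
  by (simp add: add_closed_def)

interpretation ks: Vector_Spaces.vector_space "kscale :: 'k::field \<Rightarrow> ('i, 'k) polyz \<Rightarrow> _"
  by (rule vector_space_kscale)

lemma mcoeff_0 [simp]: "mcoeff 0 s = 0"
  by (simp add: mcoeff_def)

lemma mcoeff_add [simp]: "mcoeff (f + g) s = mcoeff f s + mcoeff g s"
  by (simp add: mcoeff_def lookup_add)

lemma mcoeff_diff [simp]: "mcoeff (f - g) s = mcoeff f s - mcoeff g s"
  by (simp add: mcoeff_def lookup_minus)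

lemma mcoeff_sum [simp]: "mcoeff (sum f X) s = (\<Sum>x\<in>X. mcoeff (f x) s)"
  by (induction X rule: infinite_finite_induct) auto

lemma mcoeff_kscale [simp]: "mcoeff (kscale c f) s = c * mcoeff f s"
  by (simp add: mcoeff_def kscale_def kconst_def mult_map_scale_conv_mult[symmetric] Poly_Mapping.map.rep_eq when_def)

lemma mcoeff_eqI: "(\<And>s. mcoeff f s = mcoeff g s) \<Longrightarrow> f = g"
  by (intro poly_eqI poly_mapping_eqI) (metis fst_conv snd_conv mcoeff_def)

lemma mcoeff_mon: "mcoeff (mon s) t = (if s = t then 1 else 0)"
  by (auto simp: mcoeff_def mon_def lookup_single when_def prod_eq_iff)

lemma mon_neq_0 [simp]: "mon s \<noteq> 0"
  by (metis mcoeff_0 mcoeff_mon zero_neq_one)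

lemma mon_eq_iff [simp]: "(mon s :: ('i, 'k::field) polyz) = mon t \<longleftrightarrow> s = t"
proof
  assume "(mon s :: ('i, 'k::field) polyz) = mon t"
  then have "mcoeff (mon s :: ('i, 'k) polyz) t = mcoeff (mon t) t" by simp
  then show "s = t" by (simp add: mcoeff_mon split: if_splits)
qed auto

lemma inj_mon: "inj mon"
  by (rule injI) simp

lemma mon_mult: "mon s * mon t = mon (s + t)"
  by (simp add: mon_def mult_monom mult_single)

lemma mon_0: "mon 0 = 1"
  by (simp add: mon_def)

lemma finite_msupp [simp]: "finite (msupp f)"
proof (rule finite_subset)
  show "msupp f \<subseteq> (\<Union>n\<le>degree f. (\<lambda>a. (a, n)) ` Poly_Mapping.keys (coeff f n))"
  proof
    fix s assume s: "s \<in> msupp f"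
    then have "coeff f (snd s) \<noteq> 0" by (auto simp: msupp_def mcoeff_def)
    then have "snd s \<le> degree f" by (rule le_degree)
    with s show "s \<in> (\<Union>n\<le>degree f. (\<lambda>a. (a, n)) ` Poly_Mapping.keys (coeff f n))"
      by (cases s) (force simp: msupp_def mcoeff_def in_keys_iff)
  qed
qed auto

lemma msupp_eq_empty_iff [simp]: "msupp f = {} \<longleftrightarrow> f = 0"
proof
  assume "msupp f = {}"
  then have "mcoeff f s = mcoeff 0 s" for s by (cases s) (auto simp: msupp_def)
  then show "f = 0" by (rule mcoeff_eqI)
qed (simp add: msupp_def)

lemma msupp_0 [simp]: "msupp 0 = {}"
  by simp

lemma msupp_mon [simp]: "msupp (mon s) = {s}"
  by (auto simp: msupp_def mcoeff_mon)

lemma polyz_expand: "f = (\<Sum>s\<in>msupp f. kscale (mcoeff f s) (mon s))"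
proof (rule mcoeff_eqI)
  fix s
  have "(\<Sum>t\<in>msupp f. mcoeff f t * (if t = s then 1 else 0)) = (\<Sum>t\<in>msupp f. if s = t then mcoeff f t else 0)"
    by (rule sum.cong) auto
  then show "mcoeff f s = mcoeff (\<Sum>s\<in>msupp f. kscale (mcoeff f s) (mon s)) s"
    by (simp add: mcoeff_mon) (auto simp: msupp_def)
qed

lemma kscale_mult: "kscale c f * kscale d g = kscale (c * d) (f * g)"
proof -
  have "kconst (c * d) = (kconst c * kconst d :: ('a, 'b) polyz)"
    by (simp add: kconst_def mult_single mult.commute[of d c])
  then show ?thesis
    unfolding kscale_def by (simp only: mult_ac)
qed

lemma kscale_mult_left: "kscale c f * g = kscale c (f * g)"
  by (simp add: kscale_def mult.assoc)

lemma kconst_eq: "kconst c = kscale c 1"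
  by (simp add: kscale_def)

lemma msupp_add: "msupp (f + g) \<subseteq> msupp f \<union> msupp g"
  by (auto simp: msupp_def)

lemma msupp_diff: "msupp (f - g) \<subseteq> msupp f \<union> msupp g"
  by (auto simp: msupp_def)

lemma msupp_kscale: "msupp (kscale c f) \<subseteq> msupp f"
  by (auto simp: msupp_def)

lemma mult_expand:
  "f * g = (\<Sum>s\<in>msupp f. \<Sum>t\<in>msupp g. kscale (mcoeff f s * mcoeff g t) (mon (s + t)))"
proof -
  have "f * g = (\<Sum>s\<in>msupp f. kscale (mcoeff f s) (mon s)) * (\<Sum>s\<in>msupp g. kscale (mcoeff g s) (mon s))"
    by (rule arg_cong2[where f = times, OF polyz_expand polyz_expand])
  then show ?thesis by (simp add: sum_product kscale_mult mon_mult)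
qed

lemma mcoeff_mult:
  "mcoeff (f * g) r = (\<Sum>s\<in>msupp f. \<Sum>t\<in>msupp g. mcoeff f s * mcoeff g t * (if s + t = r then 1 else 0))"
  by (subst mult_expand) (simp add: mcoeff_mon)

lemma msupp_mult: "msupp (f * g) \<subseteq> {s + t | s t. s \<in> msupp f \<and> t \<in> msupp g}"
proof
  fix r assume "r \<in> msupp (f * g)"
  then have *: "mcoeff (f * g) r \<noteq> 0" by (simp add: msupp_def)
  show "r \<in> {s + t | s t. s \<in> msupp f \<and> t \<in> msupp g}"
  proof (rule ccontr)
    assume "r \<notin> {s + t | s t. s \<in> msupp f \<and> t \<in> msupp g}"
    then have "mcoeff (f * g) r = 0" unfolding mcoeff_mult by (intro sum.neutral ballI) auto
    with * show False by simp
  qed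
qed

lemma mcoeff_mon_mult: "mcoeff (mon s * f) (s + t) = mcoeff f t"
proof -
  have "mcoeff (mon s * f) (s + t) = (\<Sum>u\<in>msupp f. mcoeff f u * (if u = t then 1 else 0))"
    unfolding mcoeff_mult by (simp add: mcoeff_mon)
  also have "\<dots> = (\<Sum>u\<in>msupp f. if t = u then mcoeff f u else 0)"
    by (intro sum.cong) auto
  also have "\<dots> = mcoeff f t" using finite_msupp[of f] by (auto simp: msupp_def)
  finally show ?thesis .
qed

lemma msupp_mon_mult: "msupp (mon s * f) = (+) s ` msupp f"
proof
  show "msupp (mon s * f) \<subseteq> (+) s ` msupp f"
  proof
    fix r assume "r \<in> msupp (mon s * f)"
    then obtain t where "t \<in> msupp f" "r = s + t" using msupp_mult[of "mon s" f] by force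
    then show "r \<in> (+) s ` msupp f" by blast
  qed
  show "(+) s ` msupp f \<subseteq> msupp (mon s * f)"
    by (auto simp: msupp_def mcoeff_mon_mult)
qed

section \<open>Monomial algebras\<close>

lemma kmon_iff: "f \<in> kmon S \<longleftrightarrow> msupp f \<subseteq> S"
  by (simp add: kmon_def)

lemma mon_in_kmon [simp]: "mon s \<in> kmon S \<longleftrightarrow> s \<in> S"
  by (simp add: kmon_def)

lemma kmon_mono: "S \<subseteq> T \<Longrightarrow> kmon S \<subseteq> kmon T"
  by (auto simp: kmon_def)

lemma kmon_0 [simp]: "0 \<in> kmon S"
  by (simp add: kmon_iff)

lemma kmon_add: "f \<in> kmon S \<Longrightarrow> g \<in> kmon S \<Longrightarrow> f + g \<in> kmon S"
  using msupp_add[of f g] by (auto simp: kmon_iff)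

lemma kmon_diff: "f \<in> kmon S \<Longrightarrow> g \<in> kmon S \<Longrightarrow> f - g \<in> kmon S"
  using msupp_diff[of f g] by (auto simp: kmon_iff)

lemma kmon_uminus: "f \<in> kmon S \<Longrightarrow> - f \<in> kmon S"
  using kmon_diff[of 0 S f] by simp

lemma kmon_sum: "(\<And>x. x \<in> X \<Longrightarrow> f x \<in> kmon S) \<Longrightarrow> sum f X \<in> kmon S"
  by (induction X rule: infinite_finite_induct) (auto intro: kmon_add)

lemma kmon_kscale: "f \<in> kmon S \<Longrightarrow> kscale c f \<in> kmon S"
  using msupp_kscale[of c f] by (auto simp: kmon_iff)

lemma kmon_mult:
  assumes "add_closed S" "f \<in> kmon S" "g \<in> kmon S"
  shows "f * g \<in> kmon S"
  unfolding kmon_iff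
proof
  fix r assume "r \<in> msupp (f * g)"
  then obtain s t where "r = s + t" "s \<in> msupp f" "t \<in> msupp g"
    using msupp_mult[of f g] by blast
  then show "r \<in> S" using assms add_closedD[of S s t] by (auto simp: kmon_iff)
qed

lemma kmon_1: "add_closed S \<Longrightarrow> 1 \<in> kmon S"
  using mon_in_kmon[of 0 S] by (simp add: mon_0 add_closed_def)

lemma kmon_kconst: "add_closed S \<Longrightarrow> kconst c \<in> kmon S"
  by (simp add: kconst_eq kmon_kscale kmon_1)

lemma kmon_power: "add_closed S \<Longrightarrow> f \<in> kmon S \<Longrightarrow> f ^ n \<in> kmon S"
  by (induction n) (auto intro: kmon_1 kmon_mult)

lemma kmon_prod: "add_closed S \<Longrightarrow> (\<And>x. x \<in> X \<Longrightarrow> f x \<in> kmon S) \<Longrightarrow> prod f X \<in> kmon S"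
  by (induction X rule: infinite_finite_induct) (auto intro: kmon_1 kmon_mult)

lemma ksubalgebra_kmon: "add_closed S \<Longrightarrow> ksubalgebra (kmon S)"
  by (auto simp: ksubalgebra_def intro: kmon_kconst kmon_add kmon_mult)

section \<open>Generated monoids and the subalgebras that they span\<close>

lemma monoid_gen_base: "s \<in> M \<Longrightarrow> s \<in> monoid_gen M"
  using monoid_gen.add[OF _ monoid_gen.zero, of s M] by simp

lemma monoid_gen_plus: "s \<in> monoid_gen M \<Longrightarrow> t \<in> monoid_gen M \<Longrightarrow> s + t \<in> monoid_gen M"
  by (induction s rule: monoid_gen.induct) (auto simp: add.assoc intro: monoid_gen.add)

lemma add_closed_monoid_gen: "add_closed (monoid_gen M)"
  by (auto simp: add_closed_def intro: monoid_gen.zero monoid_gen_plus)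

lemma monoid_gen_minimal: "add_closed S \<Longrightarrow> M \<subseteq> S \<Longrightarrow> monoid_gen M \<subseteq> S"
proof
  fix x assume "add_closed S" "M \<subseteq> S" "x \<in> monoid_gen M"
  from this(3,1,2) show "x \<in> S"
    by (induction rule: monoid_gen.induct) (auto simp: add_closed_def)
qed

lemma ksubalgebra_contains_kmon:
  fixes A :: "('i, 'k::field) polyz set"
  assumes A: "ksubalgebra A" and M: "mon ` M \<subseteq> A"
  shows "kmon (monoid_gen M) \<subseteq> A"
proof
  have mult: "f * g \<in> A" if "f \<in> A" "g \<in> A" for f g
    using A that by (simp add: ksubalgebra_def)
  have const: "kconst c \<in> A" for c
    using A by (auto simp: ksubalgebra_def)
  have 1: "mon s \<in> A" if "s \<in> monoid_gen M" for s
    using that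
  proof induction
    case zero
    then show ?case using const[of 1] by (simp add: mon_0 kconst_def one_pCons)
  next
    case (add s t)
    then show ?case using M mult[of "mon s" "mon t"] by (auto simp: mon_mult)
  qed
  fix f :: "('i, 'k) polyz" assume f: "f \<in> kmon (monoid_gen M)"
  have "(\<Sum>s\<in>X. kscale (mcoeff f s) (mon s)) \<in> A" if "finite X" "X \<subseteq> monoid_gen M" for X
    using that
  proof (induction X)
    case empty
    then show ?case using const[of 0] by (simp add: kconst_def)
  next
    case (insert x X)
    then have "kscale (mcoeff f x) (mon x) \<in> A" by (simp add: kscale_def mult const 1)
    then show ?case using insert A by (simp add: ksubalgebra_def)
  qed
  from this[OF finite_msupp, of f] f show "f \<in> A" by (simp add: kmon_iff flip: polyz_expand)
qed

lemma kalgebra_mon: "kalgebra (mon ` M) = kmon (monoid_gen M)"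
  unfolding kalgebra_def
proof (rule hull_unique)
  show "mon ` M \<subseteq> kmon (monoid_gen M)" by (auto intro: monoid_gen_base)
  show "ksubalgebra (kmon (monoid_gen M))" by (intro ksubalgebra_kmon add_closed_monoid_gen)
qed (rule ksubalgebra_contains_kmon)

lemma monoid_gen_add_closed: "add_closed S \<Longrightarrow> monoid_gen S = S"
  by (intro subset_antisym monoid_gen_minimal subsetI monoid_gen_base) simp_all

lemma kspan_mon: "kspan (mon ` S) = (kmon S :: ('i, 'k::field) polyz set)"
proof
  show "kspan (mon ` S) \<subseteq> (kmon S :: ('i, 'k) polyz set)"
    by (rule ks.span_minimal) (auto simp: ks.subspace_def intro: kmon_add kmon_kscale)
  show "(kmon S :: ('i, 'k) polyz set) \<subseteq> kspan (mon ` S)"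
  proof
    fix f :: "('i, 'k) polyz" assume "f \<in> kmon S"
    then have "(\<Sum>s\<in>msupp f. kscale (mcoeff f s) (mon s)) \<in> kspan (mon ` S)"
      by (intro ks.span_sum ks.span_scale ks.span_base) (auto simp: kmon_iff)
    then show "f \<in> kspan (mon ` S)" by (simp flip: polyz_expand)
  qed
qed

text \<open>The span of the other monomials is again a \<open>kmon\<close>, of an exponent set that
  omits \<open>s\<close>.\<close>

lemma independent_mon: "ks.independent (mon ` S :: ('i, 'k::field) polyz set)"
proof (rule ccontr)
  assume "\<not> ks.independent (mon ` S :: ('i, 'k::field) polyz set)"
  then obtain x :: "('i, 'k) polyz" where x: "x \<in> mon ` S" "x \<in> kspan (mon ` S - {x})"
    unfolding ks.dependent_def by blast
  then obtain s where s: "x = mon s" by auto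
  have "mon ` S - {x} = (mon ` (S - {s}) :: ('i, 'k) polyz set)" by (auto simp: s)
  then have "(mon s :: ('i, 'k) polyz) \<in> kmon (S - {s})" using x(2) s kspan_mon by metis
  then show False by simp
qed

lemma kdim_kmon: "kdim (kmon S :: ('i, 'k::field) polyz set) = card S"
proof -
  have "kdim (kmon S :: ('i, 'k) polyz set) = card (mon ` S :: ('i, 'k) polyz set)"
    using ks.dim_span_eq_card_independent[OF independent_mon, of S] unfolding kspan_mon .
  then show ?thesis by (simp add: card_image inj_on_subset[OF inj_mon])
qed

lemma graded_kmon:
  assumes S: "add_closed S"
  shows "graded_kalgebra (kmon S) (\<lambda>n. kmon {s \<in> S. snd s = n})"
  unfolding graded_kalgebra_def
proof (intro conjI allI ballI)
  show "ksubalgebra (kmon S)" by (rule ksubalgebra_kmon[OF S])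
  show "ksubspace (kmon {s \<in> S. snd s = n})" for n
    by (auto simp: ks.subspace_def intro: kmon_add kmon_kscale)
  show "kmon {s \<in> S. snd s = n} \<subseteq> kmon S" for n by (rule kmon_mono) auto
  show "f * g \<in> kmon {s \<in> S. snd s = i + j}"
    if "f \<in> kmon {s \<in> S. snd s = i}" "g \<in> kmon {s \<in> S. snd s = j}" for i j f g
    unfolding kmon_iff
  proof
    fix r assume "r \<in> msupp (f * g)"
    then obtain s t where st: "r = s + t" "s \<in> msupp f" "t \<in> msupp g"
      using msupp_mult[of f g] by blast
    then have "s \<in> {s \<in> S. snd s = i}" "t \<in> {s \<in> S. snd s = j}"
      using that unfolding kmon_iff by blast+
    then show "r \<in> {s \<in> S. snd s = i + j}"
      using add_closedD[OF S, of s t] st(1) by simp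
  qed
  fix f :: "('a, 'b) polyz" assume f: "f \<in> kmon S"
  \<comment> \<open>The grading is by z-degree, so the homogeneous parts are the terms of
    \<open>f\<close> as a polynomial in \<open>z\<close>.\<close>
  define g where "g n = monom (coeff f n) n" for n
  have mg: "mcoeff (g n) s = (if snd s = n then mcoeff f s else 0)" for n s
    by (auto simp: g_def mcoeff_def)
  have supp_g: "{n. g n \<noteq> 0} \<subseteq> {..degree f}"
    by (auto simp: g_def intro: le_degree)
  have sum_g: "f = (\<Sum>n | g n \<noteq> 0. g n)"
  proof -
    have "(\<Sum>n | g n \<noteq> 0. g n) = (\<Sum>n\<le>degree f. g n)"
      using supp_g by (intro sum.mono_neutral_left) auto
    then show ?thesis unfolding g_def by (simp add: poly_as_sum_of_monoms)
  qed
  show "\<exists>!g. (\<forall>n. g n \<in> kmon {s \<in> S. snd s = n}) \<and> finite {n. g n \<noteq> 0} \<and> f = (\<Sum>n | g n \<noteq> 0. g n)"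
  proof (rule ex1I[of _ g])
    show "(\<forall>n. g n \<in> kmon {s \<in> S. snd s = n}) \<and> finite {n. g n \<noteq> 0} \<and> f = (\<Sum>n | g n \<noteq> 0. g n)"
    proof (intro conjI allI)
      show "g n \<in> kmon {s \<in> S. snd s = n}" for n
        using f by (auto simp: kmon_iff msupp_def mg)
    qed (use finite_subset[OF supp_g] sum_g in \<open>simp_all only: finite_atMost\<close>)
    fix g' assume g': "(\<forall>n. g' n \<in> kmon {s \<in> S. snd s = n}) \<and> finite {n. g' n \<noteq> 0} \<and> f = (\<Sum>n | g' n \<noteq> 0. g' n)"
    show "g' = g"
    proof (intro ext mcoeff_eqI)
      fix n s
      \<comment> \<open>Uniqueness: the coefficient at \<open>s\<close> can come only from the
        component with index \<open>snd s\<close>.\<close>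
      have 0: "mcoeff (g' k) s = 0" if "k \<noteq> snd s" for k
        using g' that by (force simp: kmon_iff msupp_def)
      have "mcoeff f s = (\<Sum>k | g' k \<noteq> 0. mcoeff (g' k) s)"
        using arg_cong[OF conjunct2[OF conjunct2[OF g']], of "\<lambda>f. mcoeff f s"] by (simp only: mcoeff_sum)
      also have "\<dots> = (\<Sum>k | g' k \<noteq> 0. if snd s = k then mcoeff (g' k) s else 0)"
        using 0 by (intro sum.cong) auto
      also have "\<dots> = mcoeff (g' (snd s)) s"
        using g' by simp
      finally show "mcoeff (g' n) s = mcoeff (g n) s"
        using 0[of n] by (auto simp: mg)
    qed
  qed
qed

section \<open>Hilbert series of finitely generated monomial modules\<close>

text \<open>There is always a monotone subsequence; a decreasing one in the naturals is constant
  once it reaches its minimum, hence from there on also increasing.\<close>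

lemma nat_mono_subseq: "\<exists>r::nat \<Rightarrow> nat. strict_mono r \<and> incseq (\<lambda>i. (s::nat \<Rightarrow> nat) (r i))"
proof -
  obtain f where f: "strict_mono f" "monoseq (\<lambda>n. s (f n))"
    using seq_monosub[of s] by blast
  show ?thesis
  proof (cases "incseq (\<lambda>n. s (f n))")
    case True
    then show ?thesis using f(1) by blast
  next
    case False
    then have dec: "decseq (\<lambda>n. s (f n))" using f(2) by (simp add: monoseq_iff)
    obtain N where N: "\<And>n. s (f N) \<le> s (f n)"
      using ex_has_least_nat[of "\<lambda>_. True" 0 "\<lambda>n. s (f n)"] by auto
    have const: "s (f (N + i)) = s (f N)" for i
      using decseqD[OF dec, of N "N + i"] N[of "N + i"] by simp
    have "strict_mono (\<lambda>i. f (N + i))"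
      using f(1) by (auto simp: strict_mono_def)
    moreover have "incseq (\<lambda>i. s (f (N + i)))"
      by (auto simp: incseq_def const)
    ultimately show ?thesis by blast
  qed
qed

text \<open>Dickson's lemma in the form for sequences: make the heads increase along a subsequence,
  then refine it by induction on the tails.\<close>

lemma dickson_lists:
  fixes f :: "nat \<Rightarrow> nat list"
  assumes "\<And>i. length (f i) = m"
  shows "\<exists>r::nat \<Rightarrow> nat. strict_mono r \<and> (\<forall>i j. i \<le> j \<longrightarrow> list_all2 (\<le>) (f (r i)) (f (r j)))"
  using assms
proof (induction m arbitrary: f)
  case 0
  then show ?case by (intro exI[of _ id]) (auto simp: strict_mono_def)
next
  case (Suc m)
  obtain r where r: "strict_mono r" "incseq (\<lambda>i. hd (f (r i)))"
    using nat_mono_subseq[of "\<lambda>i. hd (f i)"] by blast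
  have "length (tl (f (r i))) = m" for i using Suc.prems by simp
  from Suc.IH[of "\<lambda>i. tl (f (r i))", OF this] obtain q :: "nat \<Rightarrow> nat" where
    q: "strict_mono q" "\<And>i j. i \<le> j \<Longrightarrow> list_all2 (\<le>) (tl (f (r (q i)))) (tl (f (r (q j))))" by blast
  have ne: "f i = hd (f i) # tl (f i)" for i
    using Suc.prems[of i] by (cases "f i") auto
  have "list_all2 (\<le>) (f (r (q i))) (f (r (q j)))" if "i \<le> j" for i j
  proof -
    have "q i \<le> q j" using q(1) that by (simp add: strict_mono_less_eq)
    then have "hd (f (r (q i))) \<le> hd (f (r (q j)))" using r(2) by (auto simp: incseq_def)
    then have "list_all2 (\<le>) (hd (f (r (q i))) # tl (f (r (q i)))) (hd (f (r (q j))) # tl (f (r (q j))))"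
      using q(2)[OF that] by simp
    then show ?thesis by (simp only: ne[symmetric])
  qed
  moreover have "strict_mono (r \<circ> q)" using r(1) q(1) by (rule strict_mono_o)
  ultimately show ?case by (intro exI[of _ "r \<circ> q"]) (simp add: o_def)
qed

text \<open>Order ideals of N^m, that is, the exponents of the monomials outside a monomial
  ideal.\<close>

definition down_closed :: "nat \<Rightarrow> nat list set \<Rightarrow> bool" where
  "down_closed m V \<longleftrightarrow>
     (\<forall>ys\<in>V. length ys = m \<and> (\<forall>xs. list_all2 (\<le>) xs ys \<longrightarrow> xs \<in> V))"

text \<open>In a chain that never stabilises, points can be chosen that leave it one after the
  other. By Dickson's lemma an earlier point lies below a later one, and then down-closure keeps the
  earlier point in a set that it has already left.\<close>

lemma down_closed_dcc:
  assumes V: "\<And>i. down_closed m (V i)" and dec: "\<And>i. V (Suc i) \<subseteq> V i"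
  shows "\<exists>N. \<forall>i\<ge>N. V i = V N"
proof (rule ccontr)
  assume "\<not> (\<exists>N. \<forall>i\<ge>N. V i = V N)"
  then have neq: "\<exists>i\<ge>N. V i \<noteq> V N" for N by blast
  have mono: "V j \<subseteq> V i" if "i \<le> j" for i j
    using lift_Suc_antimono_le[of V i j] dec that by blast
  have "\<exists>i x. i > N \<and> x \<in> V N - V i" for N
  proof -
    obtain i where "i \<ge> N" "V i \<noteq> V N" using neq by blast
    then have "i > N" "\<not> V N \<subseteq> V i" using mono[of N i] by (auto simp: nat_less_le)
    then show ?thesis by blast
  qed
  then obtain nx x where nx: "\<And>N. nx N > N" "\<And>N. x N \<in> V N - V (nx N)" by metis
  \<comment> \<open>Along the iterates of \<open>nx\<close>, the point \<open>x (n k)\<close> is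
    missing from stage \<open>n (Suc k)\<close> on.\<close>
  define n where "n k = (nx ^^ k) 0" for k
  have n_Suc: "n (Suc k) = nx (n k)" for k by (simp add: n_def)
  have "strict_mono n" by (rule strict_monoI_Suc) (simp add: n_Suc nx)
  have "length (x (n k)) = m" for k using nx(2) V by (auto simp: down_closed_def)
  from dickson_lists[of "\<lambda>k. x (n k)", OF this] obtain r :: "nat \<Rightarrow> nat" where
    r: "strict_mono r" "\<And>i j. i \<le> j \<Longrightarrow> list_all2 (\<le>) (x (n (r i))) (x (n (r j)))" by blast
  have "r 0 < r 1" using r(1) by (simp add: strict_mono_def)
  then have "n (Suc (r 0)) \<le> n (r 1)"
    using \<open>strict_mono n\<close> by (simp add: strict_mono_less_eq)
  then have "x (n (r 1)) \<in> V (n (Suc (r 0)))" using nx(2) mono by blast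
  then have "x (n (r 0)) \<in> V (n (Suc (r 0)))" using r(2)[of 0 1] V by (auto simp: down_closed_def)
  then show False using nx(2)[of "n (r 0)"] by (simp add: n_Suc)
qed

section \<open>Generating functions of down-sets\<close>

definition list_series :: "nat list set \<Rightarrow> int fps" where
  "list_series V = Abs_fps (\<lambda>n. of_nat (card {xs \<in> V. sum_list xs = n}))"

lemma finite_lists_sum_eq: "finite {xs::nat list. length xs = m \<and> sum_list xs = n}"
proof (rule finite_subset)
  show "{xs. length xs = m \<and> sum_list xs = n} \<subseteq> {xs. set xs \<subseteq> {..n} \<and> length xs = m}"
    using member_le_sum_list by force
  show "finite {xs. set xs \<subseteq> {..n} \<and> length xs = m}" by (rule finite_lists_length_eq) simp
qed

lemma finite_down_closed_slice: "down_closed m V \<Longrightarrow> finite {xs \<in> V. sum_list xs = n}"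
  by (rule finite_subset[OF _ finite_lists_sum_eq[of m n]]) (auto simp: down_closed_def)

text \<open>The slices by the first coordinate are down-sets of one dimension less. They shrink, and
  by the descending chain condition they are constant from some \<open>N\<close> on. So
  multiplication by \<open>1 - fps_X\<close> leaves a finite telescoping sum of slice series, to
  which the induction hypothesis applies.\<close>

lemma list_series_down_closed:
  assumes "down_closed m V"
  shows "\<exists>h :: int poly. list_series V * (1 - fps_X) ^ m = fps_of_poly h"
  using assms
proof (induction m arbitrary: V)
  case 0
  then have "V = {} \<or> V = {[]}" by (auto simp: down_closed_def)
  then consider "V = {}" | "V = {[]}" by blast
  then show ?case
  proof cases
    case 1
    then show ?thesis by (intro exI[of _ 0]) (auto simp: list_series_def fps_eq_iff)
  next
    case 2
    have "{xs. xs = [] \<and> sum_list xs = n} = (if n = 0 then {[]} else {})" for n :: nat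
      by auto
    then show ?thesis by (intro exI[of _ 1]) (auto simp: list_series_def fps_eq_iff 2)
  qed
next
  case (Suc m)
  define sl where "sl i = {xs. i # xs \<in> V}" for i
  have sl: "down_closed m (sl i)" for i
    using Suc.prems by (auto simp: down_closed_def sl_def)
  have dec: "sl (Suc i) \<subseteq> sl i" for i
  proof
    fix xs assume "xs \<in> sl (Suc i)"
    moreover have "list_all2 (\<le>) (i # xs) (Suc i # xs)" by (auto simp: list.rel_refl)
    ultimately show "xs \<in> sl i" using Suc.prems by (auto simp: down_closed_def sl_def)
  qed
  obtain N where N: "\<And>i. i \<ge> N \<Longrightarrow> sl i = sl N" using down_closed_dcc[of m sl, OF sl dec] by blast
  obtain h where h: "\<And>i. list_series (sl i) * (1 - fps_X) ^ m = fps_of_poly (h i)"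
    using Suc.IH[OF sl] by metis
  define a where "a i = list_series (sl i)" for i
  have a_const: "a (Suc i) = a i" if "i \<ge> N" for i
    using N[OF that] N[of "Suc i"] that by (simp add: a_def)
  have nth: "list_series V $ n = (\<Sum>i\<le>n. a i $ (n - i))" for n
  proof -
    have "{xs \<in> V. sum_list xs = n} = (\<Union>i\<le>n. (#) i ` {xs \<in> sl i. sum_list xs = n - i})" (is "?L = ?R")
    proof
      show "?L \<subseteq> ?R"
      proof
        fix xs assume xs: "xs \<in> ?L"
        then obtain i ys where "xs = i # ys" using Suc.prems by (cases xs) (auto simp: down_closed_def)
        with xs show "xs \<in> ?R" by (auto simp: sl_def intro!: bexI[of _ i])
      qed
    qed (auto simp: sl_def)
    also have "card \<dots> = (\<Sum>i\<le>n. card ((#) i ` {xs \<in> sl i. sum_list xs = n - i}))"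
      using finite_down_closed_slice[OF sl] by (intro card_UN_disjoint) auto
    also have "\<dots> = (\<Sum>i\<le>n. card {xs \<in> sl i. sum_list xs = n - i})"
      by (intro sum.cong card_image) auto
    finally show ?thesis by (simp add: list_series_def a_def)
  qed
  have "list_series V * (1 - fps_X) = a 0 + (\<Sum>i<N. fps_X ^ Suc i * (a (Suc i) - a i))"
  proof (rule fps_ext)
    fix n
    \<comment> \<open>The sum may run to \<open>n\<close> instead of \<open>N\<close>: the
      differences vanish for \<open>i \<ge> N\<close>, and the powers of \<open>fps_X\<close> with
      \<open>i \<ge> n\<close> do not reach the coefficient \<open>n\<close>.\<close>
    have R: "(a 0 + (\<Sum>i<N. fps_X ^ Suc i * (a (Suc i) - a i))) $ n =
        a 0 $ n + (\<Sum>i<n. (a (Suc i) - a i) $ (n - Suc i))"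
    proof -
      have "(\<Sum>i<N. fps_X ^ Suc i * (a (Suc i) - a i)) $ n =
          (\<Sum>i<N. if i < n then (a (Suc i) - a i) $ (n - Suc i) else 0)"
        unfolding fps_sum_nth fps_X_power_mult_nth by (intro sum.cong) auto
      also have "\<dots> = (\<Sum>i<N + n. if i < n then (a (Suc i) - a i) $ (n - Suc i) else 0)"
        by (rule sum.mono_neutral_left) (auto simp: a_const)
      also have "\<dots> = (\<Sum>i<n. (a (Suc i) - a i) $ (n - Suc i))"
        by (rule sum.mono_neutral_cong_right) auto
      finally show ?thesis by simp
    qed
    show "(list_series V * (1 - fps_X)) $ n = (a 0 + (\<Sum>i<N. fps_X ^ Suc i * (a (Suc i) - a i))) $ n"
    proof (cases n)
      case 0
      then show ?thesis unfolding R by (simp add: nth)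
    next
      case (Suc k)
      have "(list_series V * (1 - fps_X)) $ n = list_series V $ n - list_series V $ k"
        by (simp add: ring_distribs Suc)
      also have "\<dots> = a 0 $ n + (\<Sum>i\<le>k. a (Suc i) $ (k - i)) - (\<Sum>i\<le>k. a i $ (k - i))"
        unfolding nth Suc by (subst sum.atMost_Suc_shift) simp
      also have "\<dots> = a 0 $ n + (\<Sum>i<n. (a (Suc i) - a i) $ (n - Suc i))"
        by (simp add: Suc sum_subtractf lessThan_Suc_atMost)
      finally show ?thesis unfolding R .
    qed
  qed
  then have "list_series V * (1 - fps_X) ^ Suc m =
      (a 0 + (\<Sum>i<N. fps_X ^ Suc i * (a (Suc i) - a i))) * (1 - fps_X) ^ m"
    by (simp add: mult.assoc[symmetric])
  also have "\<dots> = fps_of_poly (h 0 + (\<Sum>i<N. monom 1 (Suc i) * (h (Suc i) - h i)))"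
    unfolding fps_of_poly_add fps_of_poly_sum fps_of_poly_mult fps_of_poly_diff fps_of_poly_monom' h[symmetric] a_def
    by (simp add: ring_distribs sum_distrib_right mult.assoc)
  finally show ?case by blast
qed

section \<open>Least representations\<close>

lemma lex_total: "length xs = length ys \<Longrightarrow> xs \<noteq> ys \<Longrightarrow> (xs, ys) \<in> lex less_than \<or> (ys, xs) \<in> lex less_than"
  by (induction xs ys rule: list_induct2) auto

text \<open>Translation invariance is what makes the least exponent vectors a down-set.\<close>

lemma lex_translate:
  "length xs = length ys \<Longrightarrow> length zs = length ys \<Longrightarrow> (xs, ys) \<in> lex less_than \<Longrightarrow>
    (map2 (+) xs zs, map2 (+) ys zs) \<in> lex less_than"
proof (induction xs ys arbitrary: zs rule: list_induct2)
  case (Cons x xs y ys)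
  then show ?case by (cases zs) auto
qed simp

lemma list_all2_le_obtain_add:
  assumes "list_all2 (\<le>) xs (ys :: nat list)"
  obtains zs where "length zs = length xs" "ys = map2 (+) xs zs"
proof
  show "length (map2 (-) ys xs) = length xs" using list_all2_lengthD[OF assms] by simp
  show "ys = map2 (+) xs (map2 (-) ys xs)"
    using assms by (induction rule: list_all2_induct) auto
qed

text \<open>Each element is written with its lexicographically least pair of a generator and an exponent
  vector; for a fixed generator, the exponent vectors that occur form a down-closed set.\<close>

lemma hilbert_series_fg_module:
  fixes e :: "nat \<Rightarrow> nat list \<Rightarrow> 'a" and deg :: "'a \<Rightarrow> nat"
  assumes S: "S = (\<Union>j<q. e j ` {xs. length xs = m})"
    and trans: "\<And>i j xs ys zs. length xs = m \<Longrightarrow> length ys = m \<Longrightarrow> length zs = m \<Longrightarrow> i < q \<Longrightarrow> j < q \<Longrightarrow> e i xs = e j ys \<Longrightarrow>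
        e i (map2 (+) xs zs) = e j (map2 (+) ys zs)"
    and deg: "\<And>j xs. length xs = m \<Longrightarrow> j < q \<Longrightarrow> deg (e j xs) = d j + sum_list xs"
  shows "\<exists>h :: int poly. Abs_fps (\<lambda>n. of_nat (card {s \<in> S. deg s = n})) * (1 - fps_X) ^ m = fps_of_poly h"
proof -
  \<comment> \<open>The generator is compared first. It is unaffected when a vector is added to both
    lists, so the whole order is translation invariant.\<close>
  define R where "R = less_than <*lex*> lex less_than"
  have wf: "wf R" unfolding R_def by (intro wf_lex_prod wf_lex wf_less_than)
  have total: "(i, xs) = (j, ys) \<or> ((i, xs), (j, ys)) \<in> R \<or> ((j, ys), (i, xs)) \<in> R"
    if "length xs = m" "length ys = m" for i j xs ys
    using lex_total[of xs ys] that by (auto simp: R_def)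
  define I where "I = {(j, xs). j < q \<and> length xs = m}"
  define V where "V j = {xs. length xs = m \<and> (\<forall>i ys. i < q \<and> length ys = m \<and> e i ys = e j xs \<longrightarrow> ((i, ys), (j, xs)) \<notin> R)}" for j
  have down: "down_closed m (V j)" if j: "j < q" for j
    unfolding down_closed_def
  proof (intro ballI conjI allI impI)
    fix ys assume ys: "ys \<in> V j"
    then show len: "length ys = m" by (simp add: V_def)
    fix xs assume le: "list_all2 (\<le>) xs ys"
    then have lx: "length xs = m" using len list_all2_lengthD by metis
    obtain zs where zs: "length zs = m" "ys = map2 (+) xs zs"
      using list_all2_le_obtain_add[OF le] lx by metis
    show "xs \<in> V j" unfolding V_def
    proof (intro CollectI conjI allI impI lx notI)
      fix i us assume us: "i < q \<and> length us = m \<and> e i us = e j xs" and less: "((i, us), (j, xs)) \<in> R"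
      \<comment> \<open>A smaller representation of \<open>e j xs\<close>, shifted by
        \<open>zs\<close>, would be a smaller representation of \<open>e j ys\<close>.\<close>
      have "e i (map2 (+) us zs) = e j ys"
        unfolding zs(2) using us lx zs j by (intro trans) auto
      moreover have "((i, map2 (+) us zs), (j, ys)) \<in> R"
        using less lex_translate[of us xs zs] us lx zs by (auto simp: R_def)
      ultimately show False using ys us zs by (auto simp: V_def)
    qed
  qed
  have inj: "(i, xs) = (j, ys)" if "i < q" "j < q" "xs \<in> V i" "ys \<in> V j" "e i xs = e j ys" for i j xs ys
    using total[of xs ys i j] that unfolding V_def by fastforce
  have cover: "\<exists>j<q. \<exists>xs\<in>V j. s = e j xs" if s: "s \<in> S" for s
  proof -
    define Q where "Q = {p. fst p < q \<and> length (snd p) = m \<and> e (fst p) (snd p) = s}"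
    have "\<exists>p. p \<in> Q" using s S by (force simp: Q_def)
    then obtain p where p: "p \<in> Q" "\<And>y. (y, p) \<in> R \<Longrightarrow> y \<notin> Q"
      using wfE_min[OF wf] by metis
    then have "snd p \<in> V (fst p)" unfolding V_def Q_def by fastforce
    then show ?thesis using p(1) by (auto simp: Q_def)
  qed
  have VS: "e j xs \<in> S" if "j < q" "xs \<in> V j" for j xs using that S by (auto simp: V_def)
  define F where "F n j = {xs \<in> V j. d j + sum_list xs = n}" for n j
  have finF: "finite (F n j)" for n j
    by (rule finite_subset[OF _ finite_lists_sum_eq[of m "n - d j"]]) (auto simp: F_def V_def)
  have card: "card {s \<in> S. deg s = n} = (\<Sum>j<q. card (F n j))" for n
  proof -
    have "{s \<in> S. deg s = n} = (\<Union>j<q. e j ` F n j)"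
    proof
      show "{s \<in> S. deg s = n} \<subseteq> (\<Union>j<q. e j ` F n j)"
      proof
        fix s assume s: "s \<in> {s \<in> S. deg s = n}"
        then obtain j xs where "j < q" "xs \<in> V j" "s = e j xs" using cover by blast
        moreover from this have "d j + sum_list xs = n" using s deg by (auto simp: V_def)
        ultimately show "s \<in> (\<Union>j<q. e j ` F n j)" by (auto simp: F_def)
      qed
      show "(\<Union>j<q. e j ` F n j) \<subseteq> {s \<in> S. deg s = n}"
        using VS deg by (auto simp: F_def V_def)
    qed
    also have "card \<dots> = (\<Sum>j<q. card (e j ` F n j))"
      using finF inj by (intro card_UN_disjoint) (fastforce simp: F_def)+
    also have "\<dots> = (\<Sum>j<q. card (F n j))"
      using inj by (intro sum.cong card_image inj_onI) (fastforce simp: F_def)+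
    finally show ?thesis .
  qed
  have series: "Abs_fps (\<lambda>n. of_nat (card {s \<in> S. deg s = n})) = (\<Sum>j<q. fps_X ^ d j * list_series (V j))"
  proof (rule fps_ext)
    fix n
    have "(fps_X ^ d j * list_series (V j)) $ n = int (card (F n j))" for j
    proof (cases "n < d j")
      case True
      then have "F n j = {}" by (auto simp: F_def)
      then show ?thesis using True by (simp add: fps_X_power_mult_nth)
    next
      case False
      then have "F n j = {xs \<in> V j. sum_list xs = n - d j}" by (auto simp: F_def)
      then show ?thesis using False by (simp add: fps_X_power_mult_nth list_series_def)
    qed
    then show "Abs_fps (\<lambda>n. of_nat (card {s \<in> S. deg s = n})) $ n = (\<Sum>j<q. fps_X ^ d j * list_series (V j)) $ n"
      by (simp add: card fps_sum_nth)
  qed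
  have "\<exists>h. j < q \<longrightarrow> list_series (V j) * (1 - fps_X) ^ m = fps_of_poly h" for j
    using list_series_down_closed[OF down] by blast
  then obtain h where h: "\<And>j. j < q \<Longrightarrow> list_series (V j) * (1 - fps_X) ^ m = fps_of_poly (h j)" by metis
  have "Abs_fps (\<lambda>n. of_nat (card {s \<in> S. deg s = n})) * (1 - fps_X) ^ m =
      (\<Sum>j<q. fps_X ^ d j * (list_series (V j) * (1 - fps_X) ^ m))"
    unfolding series by (simp add: sum_distrib_right mult.assoc)
  also have "\<dots> = (\<Sum>j<q. fps_X ^ d j * fps_of_poly (h j))"
    using h by (intro sum.cong) auto
  also have "\<dots> = fps_of_poly (\<Sum>j<q. monom 1 (d j) * h j)"
    by (simp add: fps_of_poly_sum fps_of_poly_mult fps_of_poly_monom')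
  finally show ?thesis by blast
qed

section \<open>From the pole at 1 to the Hilbert polynomial\<close>

text \<open>As long as 1 is a root of the numerator, a factor \<open>1 - fps_X\<close> cancels. This
  stops before exponent 0, where \<open>f\<close> would be a polynomial and its coefficients would
  eventually vanish.\<close>

lemma fps_of_poly_cancel_pole:
  fixes f :: "'a::idom fps"
  assumes f: "f * (1 - fps_X) ^ m = fps_of_poly h" and inf: "\<And>N. \<exists>n\<ge>N. f $ n \<noteq> 0"
  shows "\<exists>d\<ge>1. \<exists>h'. poly h' 1 \<noteq> 0 \<and> f * (1 - fps_X) ^ d = fps_of_poly h'"
  using f
proof (induction m arbitrary: h)
  case 0
  obtain n where "n \<ge> Suc (degree h)" "f $ n \<noteq> 0" using inf by blast
  then show ?case using 0 by (simp add: coeff_eq_0)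
next
  case (Suc m)
  show ?case
  proof (cases "poly h 1 = 0")
    case False
    then show ?thesis using Suc.prems by (intro exI[of _ "Suc m"]) auto
  next
    case True
    then obtain g where g: "h = [:-1, 1:] * g" by (metis dvdE poly_eq_0_iff_dvd)
    have "fps_of_poly [:1, - 1 :: 'a:] = 1 - fps_X"
      by (rule fps_ext) (auto simp: coeff_pCons fps_X_def split: nat.split)
    then have "fps_of_poly h = (1 - fps_X) * fps_of_poly (- g)"
      unfolding g fps_of_poly_mult by (metis (no_types) fps_of_poly_mult minus_mult_commute minus_pCons neg_equal_iff_equal add.inverse_inverse neg_0_equal_iff_equal)
    then have "(1 - fps_X) * (f * (1 - fps_X) ^ m) = (1 - fps_X) * fps_of_poly (- g)"
      using Suc.prems by (simp add: mult_ac)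
    moreover have "(1 - fps_X :: 'a fps) \<noteq> 0"
      by (metis fps_X_neq_one right_minus_eq)
    ultimately have "f * (1 - fps_X) ^ m = fps_of_poly (- g)" by simp
    then show ?thesis by (rule Suc.IH)
  qed
qed

text \<open>\<open>1 / (1 - x)^(e + 1)\<close> has the coefficients \<open>(n + e) choose e\<close>,
  a polynomial in \<open>n\<close> with leading coefficient \<open>1 / fact e\<close>. Convolution
  with \<open>h\<close> adds up shifted copies of it, with leading coefficient
  \<open>poly h 1 / fact e\<close>; so \<open>h\<close> must not vanish at 1 for the degree to be
  \<open>e\<close>.\<close>

lemma fps_pole_polynomial:
  fixes f :: "'a::field_char_0 fps"
  assumes f: "f * (1 - fps_X) ^ Suc e = fps_of_poly h" and h: "poly h 1 \<noteq> 0"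
  shows "\<exists>g. g \<noteq> 0 \<and> degree g = e \<and> (\<forall>n\<ge>degree h. f $ n = poly g (of_nat n))"
proof -
  define b :: "'a poly" where "b = Polynomial.smult (1 / fact e) (\<Prod>i<e. [:of_nat (Suc i), 1:])"
  define D where "D = degree h"
  have deg_prod: "degree (\<Prod>i<e. [:of_nat (Suc i), 1 :: 'a:]) = e"
    by (subst degree_prod_eq_sum_degree) auto
  have lead_prod: "lead_coeff (\<Prod>i<e. [:of_nat (Suc i), 1 :: 'a:]) = 1"
    by (subst lead_coeff_prod) simp
  have deg_b: "degree b = e" using deg_prod by (simp add: b_def)
  have lead_b: "lead_coeff b = 1 / fact e" using lead_prod by (simp add: b_def)
  have poly_b: "poly b (of_nat n) = of_nat ((n + e) choose e)" for n
  proof -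
    have "poly b (of_nat n) = (\<Prod>i<e. of_nat (Suc i) + of_nat n) / fact e"
      by (simp add: b_def poly_prod)
    also have "(\<Prod>i<e. of_nat (Suc i) + of_nat n :: 'a) = pochhammer (of_nat n + 1) e"
      unfolding pochhammer_prod by (intro prod.cong) (auto simp: lessThan_atLeast0)
    also have "\<dots> / fact e = of_nat (n + e) gchoose e"
      unfolding gbinomial_pochhammer' by simp
    finally show ?thesis by (simp add: binomial_gbinomial)
  qed
  define B where "B = Abs_fps (\<lambda>n. of_nat ((n + e) choose e) :: 'a)"
  have B: "B * (1 - fps_X) ^ Suc e = 1"
  proof -
    have "inverse ((1 - fps_X) ^ Suc e) = B"
    proof (rule fps_ext)
      fix n
      have "inverse ((1 - fps_X) ^ Suc e) $ n = (of_nat ((e + n) choose n) :: 'a)"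
        using one_minus_const_fps_X_neg_power'[of "Suc e" "1::'a"] by simp
      also have "(e + n) choose n = (n + e) choose e"
        using binomial_symmetric[of n "e + n"] by (simp add: add.commute)
      finally show "inverse ((1 - fps_X) ^ Suc e) $ n = B $ n" by (simp add: B_def)
    qed
    then show ?thesis using inverse_mult_eq_1[of "(1 - fps_X :: 'a fps) ^ Suc e"] by simp
  qed
  have "f = f * ((1 - fps_X) ^ Suc e * B)" using B by (simp add: mult.commute)
  then have fB: "f = fps_of_poly h * B" using f by (metis mult.assoc)
  \<comment> \<open>The shift by \<open>j\<close> agrees with the natural number
    \<open>n - j\<close> only for \<open>j \<le> n\<close>; hence the values are correct from
    \<open>degree h\<close> on.\<close>
  define g where "g = (\<Sum>j\<le>D. Polynomial.smult (coeff h j) (pcompose b [:- of_nat j, 1:]))"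
  have coeff_g: "coeff g e = poly h 1 / fact e"
  proof -
    have "coeff (pcompose b [:- of_nat j, 1:]) e = 1 / fact e" for j
      using lead_coeff_comp[of "[:- of_nat j, 1:]" b] by (simp add: degree_pcompose deg_b lead_b[unfolded deg_b])
    then show ?thesis
      by (simp add: g_def coeff_sum D_def poly_altdef sum_divide_distrib)
  qed
  have "degree g \<le> e"
    unfolding g_def by (intro degree_sum_le degree_smult_le[THEN order_trans]) (auto simp: degree_pcompose deg_b)
  moreover have "coeff g e \<noteq> 0" using coeff_g h by simp
  ultimately have "degree g = e" "g \<noteq> 0" by (auto intro: antisym le_degree)
  moreover have "f $ n = poly g (of_nat n)" if n: "n \<ge> D" for n
  proof -
    have "f $ n = (\<Sum>j=0..n. coeff h j * B $ (n - j))"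
      unfolding fB fps_mult_nth by simp
    also have "\<dots> = (\<Sum>j\<le>D. coeff h j * B $ (n - j))"
      using n by (intro sum.mono_neutral_right) (auto simp: D_def coeff_eq_0)
    also have "\<dots> = (\<Sum>j\<le>D. coeff h j * poly b (of_nat (n - j)))"
      by (simp add: B_def poly_b)
    also have "\<dots> = poly g (of_nat n)"
      unfolding g_def poly_sum using n by (intro sum.cong) (auto simp: poly_pcompose of_nat_diff)
    finally show ?thesis .
  qed
  ultimately show ?thesis unfolding D_def by blast
qed

section \<open>Minors and saturated lattices\<close>

text \<open>Rows and columns are selected by functions, in any order and with repetitions, so that a
  minor can be bordered by a function update.\<close>

definition fminor :: "(nat \<Rightarrow> nat \<Rightarrow> 'a::comm_ring_1) \<Rightarrow> nat \<Rightarrow> (nat \<Rightarrow> nat) \<Rightarrow> (nat \<Rightarrow> nat) \<Rightarrow> 'a" where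
  "fminor B r \<rho> \<gamma> = Determinant.det (Matrix.mat r r (\<lambda>(i, j). B (\<rho> i) (\<gamma> j)))"

text \<open>Cramer's determinant: it vanishes if \<open>x\<close> depends on the selected columns,
  and its expansion along the last row solves for \<open>x\<close>.\<close>

definition bordered :: "(nat \<Rightarrow> nat \<Rightarrow> 'a::comm_ring_1) \<Rightarrow> nat \<Rightarrow> (nat \<Rightarrow> nat) \<Rightarrow> (nat \<Rightarrow> nat) \<Rightarrow> (nat \<Rightarrow> 'a) \<Rightarrow> 'a" where
  "bordered B r \<rho> \<gamma> x =
     Determinant.det (Matrix.mat (Suc r) (Suc r) (\<lambda>(i, j). if j < r then B (\<rho> i) (\<gamma> j) else x (\<rho> i)))"

lemma bordered_column: "bordered B r \<rho> \<gamma> (\<lambda>i. B i j) = fminor B (Suc r) \<rho> (\<gamma>(r := j))"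
proof -
  have "Matrix.mat (Suc r) (Suc r) (\<lambda>(i, l). if l < r then B (\<rho> i) (\<gamma> l) else B (\<rho> i) j) =
      Matrix.mat (Suc r) (Suc r) (\<lambda>(i, l). B (\<rho> i) ((\<gamma>(r := j)) l))"
    by (rule cong_mat) simp_all
  then show ?thesis by (simp only: bordered_def fminor_def)
qed

text \<open>The cofactors along the last row do not see that row, so one family \<open>a\<close>
  serves every row index \<open>i\<close>.\<close>

lemma bordered_expand_row:
  "\<exists>a. \<forall>i. bordered B r (\<rho>(r := i)) \<gamma> x = (\<Sum>l<r. B i (\<gamma> l) * a l) + x i * fminor B r \<rho> \<gamma>"
proof -
  define A where "A i = Matrix.mat (Suc r) (Suc r)
     (\<lambda>(i', j). if j < r then B ((\<rho>(r := i)) i') (\<gamma> j) else x ((\<rho>(r := i)) i'))" for i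
  have A: "A i \<in> carrier_mat (Suc r) (Suc r)" for i by (simp add: A_def)
  have dim: "dim_row (A i) = Suc r" "dim_col (A i) = Suc r" for i by (simp_all add: A_def)
  have idx: "A i $$ (i', j) = (if j < r then B (\<rho> i') (\<gamma> j) else x (\<rho> i'))" if "i' < r" "j < Suc r" for i i' j
    using that by (simp add: A_def)
  have del: "mat_delete (A i) r l = mat_delete (A 0) r l" for i l
    unfolding mat_delete_def dim by (rule cong_mat) (simp_all add: idx)
  have last: "mat_delete (A i) r r = Matrix.mat r r (\<lambda>(i, j). B (\<rho> i) (\<gamma> j))" for i
    unfolding mat_delete_def dim by (rule cong_mat) (simp_all add: idx)
  have "bordered B r (\<rho>(r := i)) \<gamma> x = (\<Sum>l<r. B i (\<gamma> l) * cofactor (A 0) r l) + x i * fminor B r \<rho> \<gamma>" for i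
  proof -
    have "bordered B r (\<rho>(r := i)) \<gamma> x = (\<Sum>l<Suc r. A i $$ (r, l) * cofactor (A i) r l)"
      using laplace_expansion_row[OF A, of r i] by (simp only: bordered_def A_def lessI)
    moreover have "cofactor (A i) r r = fminor B r \<rho> \<gamma>"
      unfolding cofactor_def last fminor_def by (simp add: power_add flip: power_mult_distrib)
    moreover have "A i $$ (r, r) = x i" by (simp add: A_def)
    moreover have "(\<Sum>l<r. A i $$ (r, l) * cofactor (A i) r l) = (\<Sum>l<r. B i (\<gamma> l) * cofactor (A 0) r l)"
      unfolding cofactor_def del[of i] by (intro sum.cong) (auto simp: A_def)
    ultimately show ?thesis by (simp only: sum.lessThan_Suc)
  qed
  then show ?thesis by blast
qed

text \<open>The cofactors along the last column do not see \<open>x\<close>. This linearity with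
  fixed coefficients lets combinations of columns be inserted for \<open>x\<close>, real ones
  included.\<close>

lemma bordered_expand_column:
  "\<exists>a. \<forall>x. bordered B r \<rho> \<gamma> x = (\<Sum>i<Suc r. x (\<rho> i) * a i)"
proof -
  define A where "A x = Matrix.mat (Suc r) (Suc r)
     (\<lambda>(i, j). if j < r then B (\<rho> i) (\<gamma> j) else x (\<rho> i))" for x
  have A: "A x \<in> carrier_mat (Suc r) (Suc r)" for x by (simp add: A_def)
  have dim: "dim_row (A x) = Suc r" "dim_col (A x) = Suc r" for x by (simp_all add: A_def)
  have idx: "A x $$ (i, j) = B (\<rho> i) (\<gamma> j)" if "i < Suc r" "j < r" for x i j
    using that by (simp add: A_def)
  have del: "mat_delete (A x) i r = mat_delete (A (\<lambda>_. 0)) i r" for x i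
    unfolding mat_delete_def dim by (rule cong_mat) (simp_all add: idx)
  have "bordered B r \<rho> \<gamma> x = (\<Sum>i<Suc r. x (\<rho> i) * cofactor (A (\<lambda>_. 0)) i r)" for x
  proof -
    have "bordered B r \<rho> \<gamma> x = (\<Sum>i<Suc r. A x $$ (i, r) * cofactor (A x) i r)"
      using laplace_expansion_column[OF A, of r x] by (simp only: bordered_def A_def lessI)
    also have "\<dots> = (\<Sum>i<Suc r. x (\<rho> i) * cofactor (A (\<lambda>_. 0)) i r)"
      unfolding cofactor_def del[of x] by (intro sum.cong) (auto simp: A_def)
    finally show ?thesis .
  qed
  then show ?thesis by (intro exI[of _ "\<lambda>i. cofactor (A (\<lambda>_. 0)) i r"]) simp
qed

text \<open>\<open>p i\<close> counts the selected indices below \<open>\<rho> i\<close>, while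
  \<open>pick\<close> lists the selected indices in increasing order.\<close>

lemma obtain_sorting_permutation:
  assumes "inj_on \<rho> {..<r}"
  obtains p where "p permutes {0..<r}" "\<And>i. i < r \<Longrightarrow> \<rho> i = pick (\<rho> ` {..<r}) (p i)"
proof
  define I where "I = \<rho> ` {..<r}"
  have I: "finite I" "card I = r" using assms by (auto simp: I_def card_image)
  define p where "p i = (if i < r then card {a \<in> I. a < \<rho> i} else i)" for i
  have pick: "\<rho> i = pick I (p i)" if "i < r" for i
    using that pick_card_in_set[of "\<rho> i" I] by (simp add: p_def I_def)
  then show "\<And>i. i < r \<Longrightarrow> \<rho> i = pick (\<rho> ` {..<r}) (p i)" by (simp add: I_def)
  have "p i < r" if "i < r" for i
  proof -
    have "\<rho> i \<in> I" using that by (simp add: I_def)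
    then have "{a \<in> I. a < \<rho> i} \<subset> I" by blast
    then show ?thesis using psubset_card_mono[OF I(1)] that I(2) by (simp add: p_def)
  qed
  moreover have "inj_on p {0..<r}"
    using assms pick by (metis (no_types, lifting) atLeast0LessThan inj_on_def lessThan_iff)
  ultimately have "bij_betw p {0..<r} {0..<r}"
    by (auto simp: bij_betw_def endo_inj_surj image_subset_iff)
  then show "p permutes {0..<r}" by (rule bij_imp_permutes) (simp add: p_def)
qed

text \<open>A repeated index produces two equal rows or columns; otherwise sorting the indices turns
  the determinant, up to sign, into that of a submatrix. The case \<open>d = 0\<close> carries the
  vanishing of all minors over to \<open>fminor\<close>.\<close>

lemma dvd_fminor:
  fixes B :: "'a::comm_ring_1 Matrix.mat"
  assumes d: "\<And>I J. I \<subseteq> {..<dim_row B} \<Longrightarrow> J \<subseteq> {..<dim_col B} \<Longrightarrow> card I = r \<Longrightarrow> card J = r \<Longrightarrow>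
      d dvd Determinant.det (submatrix B I J)"
    and \<rho>: "\<And>i. i < r \<Longrightarrow> \<rho> i < dim_row B" and \<gamma>: "\<And>i. i < r \<Longrightarrow> \<gamma> i < dim_col B"
  shows "d dvd fminor (\<lambda>i j. B $$ (i, j)) r \<rho> \<gamma>"
proof -
  let ?M = "Matrix.mat r r (\<lambda>(i, j). B $$ (\<rho> i, \<gamma> j))"
  have M: "?M \<in> carrier_mat r r" by simp
  consider "\<not> inj_on \<rho> {..<r}" | "\<not> inj_on \<gamma> {..<r}" | "inj_on \<rho> {..<r}" "inj_on \<gamma> {..<r}" by blast
  then show ?thesis
  proof cases
    case 1
    then obtain i j where ij: "i \<noteq> j" "i < r" "j < r" "\<rho> i = \<rho> j" by (auto simp: inj_on_def)
    have "Matrix.row ?M i = Matrix.row ?M j" using ij by (intro eq_vecI) auto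
    then have "Determinant.det ?M = 0" using det_identical_rows[OF M ij(1,2,3)] by blast
    then show ?thesis by (simp add: fminor_def)
  next
    case 2
    then obtain i j where ij: "i \<noteq> j" "i < r" "j < r" "\<gamma> i = \<gamma> j" by (auto simp: inj_on_def)
    have "Matrix.col ?M i = Matrix.col ?M j" using ij by (intro eq_vecI) auto
    then have "Determinant.det ?M = 0" using det_identical_cols[OF M ij(1,2,3)] by blast
    then show ?thesis by (simp add: fminor_def)
  next
    case 3
    obtain p where p: "p permutes {0..<r}" "\<And>i. i < r \<Longrightarrow> \<rho> i = pick (\<rho> ` {..<r}) (p i)"
      using obtain_sorting_permutation[OF 3(1)] by blast
    obtain q where q: "q permutes {0..<r}" "\<And>i. i < r \<Longrightarrow> \<gamma> i = pick (\<gamma> ` {..<r}) (q i)"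
      using obtain_sorting_permutation[OF 3(2)] by blast
    define I where "I = \<rho> ` {..<r}"
    define J where "J = \<gamma> ` {..<r}"
    have I: "I \<subseteq> {..<dim_row B}" "card I = r" using \<rho> 3(1) by (auto simp: I_def card_image)
    have J: "J \<subseteq> {..<dim_col B}" "card J = r" using \<gamma> 3(2) by (auto simp: J_def card_image)
    have cI: "{i. i < dim_row B \<and> i \<in> I} = I" and cJ: "{j. j < dim_col B \<and> j \<in> J} = J"
      using I J by auto
    have pr: "p i < r" if "i < r" for i using permutes_in_image[OF p(1), of i] that by simp
    have qr: "q i < r" if "i < r" for i using permutes_in_image[OF q(1), of i] that by simp
    define S where "S = submatrix B I J"
    have S: "S \<in> carrier_mat r r" unfolding S_def by (intro carrier_matI) (simp_all add: dim_submatrix cI cJ I J)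
    have Sij: "S $$ (i, j) = B $$ (pick I i, pick J j)" if "i < r" "j < r" for i j
      unfolding S_def using that by (intro submatrix_index) (simp_all add: cI cJ I J)
    define T where "T = Matrix.mat r r (\<lambda>(i, j). S $$ (p i, j))"
    have T: "T \<in> carrier_mat r r" "transpose_mat T \<in> carrier_mat r r" by (simp_all add: T_def)
    have M_eq: "?M = transpose_mat (Matrix.mat r r (\<lambda>(i, j). transpose_mat T $$ (q i, j)))"
      by (rule eq_matI) (auto simp: T_def Sij pr qr p(2) q(2) I_def J_def)
    have "Determinant.det ?M = signof q * Determinant.det T"
      unfolding M_eq by (subst det_transpose[of _ r], simp, subst det_permute_rows[OF T(2) q(1)]) (simp add: det_transpose[OF T(1)])
    also have "Determinant.det T = signof p * Determinant.det S"
      unfolding T_def by (rule det_permute_rows[OF S p(1)])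
    finally show ?thesis using d[OF I(1) J(1) I(2) J(2)] by (simp add: fminor_def S_def)
  qed
qed

lemma dvd_fminor_minors:
  assumes "\<And>x. x \<in> minors r B \<Longrightarrow> d dvd x"
    and "\<And>i. i < r \<Longrightarrow> \<rho> i < dim_row B" "\<And>i. i < r \<Longrightarrow> \<gamma> i < dim_col B"
  shows "d dvd fminor (\<lambda>i j. B $$ (i, j)) r \<rho> \<gamma>"
  using assms by (intro dvd_fminor) (auto simp: minors_def)

lemma submatrix_in_minors:
  assumes "x \<in> minors r B"
  obtains \<rho> \<gamma> where "\<And>i. i < r \<Longrightarrow> \<rho> i < dim_row B" "\<And>i. i < r \<Longrightarrow> \<gamma> i < dim_col B"
    "x = fminor (\<lambda>i j. B $$ (i, j)) r \<rho> \<gamma>"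
proof -
  obtain I J where IJ: "I \<subseteq> {..<dim_row B}" "J \<subseteq> {..<dim_col B}" "card I = r" "card J = r"
    "x = Determinant.det (submatrix B I J)" using assms by (auto simp: minors_def)
  have cI: "{i. i < dim_row B \<and> i \<in> I} = I" and cJ: "{j. j < dim_col B \<and> j \<in> J} = J"
    using IJ by auto
  show thesis
  proof
    show "pick I i < dim_row B" if "i < r" for i using pick_in_set_le[of i I] that IJ by auto
    show "pick J i < dim_col B" if "i < r" for i using pick_in_set_le[of i J] that IJ by auto
    show "x = fminor (\<lambda>i j. B $$ (i, j)) r (pick I) (pick J)"
      unfolding IJ(5) fminor_def submatrix_def cI cJ IJ(3,4) ..
  qed
qed

section \<open>Minors and rank\<close>

lemma minors_eq_0_of_rank:
  assumes "int_mat_rank B < r" "x \<in> minors r B"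
  shows "x = 0"
proof (rule ccontr)
  assume "x \<noteq> 0"
  obtain I J where IJ: "I \<subseteq> {..<dim_row B}" "J \<subseteq> {..<dim_col B}" "card I = r" "card J = r"
    "x = Determinant.det (submatrix B I J)" using assms by (auto simp: minors_def)
  have cI: "{i. i < dim_row B \<and> i \<in> I} = I" and cJ: "{j. j < dim_col B \<and> j \<in> J} = J"
    using IJ by auto
  let ?R = "map_mat rat_of_int B"
  have "submatrix ?R I J = map_mat rat_of_int (submatrix B I J)"
    unfolding submatrix_def using IJ pick_in_set_le[of _ I] pick_in_set_le[of _ J] 
    by (intro eq_matI) (auto simp: cI cJ subset_iff)
  then have "Determinant.det (submatrix ?R I J) \<noteq> 0"
    using \<open>x \<noteq> 0\<close> IJ(5) by (simp add: of_int_hom.hom_det)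
  then have "card {j. j < dim_col B \<and> j \<in> J} \<le> int_mat_rank B"
    unfolding int_mat_rank_def by (intro vec_space.rank_gt_minor[of ?R]) auto
  then show False using assms(1) IJ(4) by (simp add: cJ)
qed

text \<open>The matrix factors through dimension \<open>r\<close>. For more than \<open>r\<close>
  independent columns, the corresponding columns of \<open>Y\<close> satisfy a nontrivial relation,
  and \<open>X\<close> transports it to the columns of \<open>A\<close>.\<close>

lemma rank_le_of_combinations:
  fixes A :: "'a::field Matrix.mat"
  assumes A: "A \<in> carrier_mat n m" and X: "\<And>i j. i < n \<Longrightarrow> j < m \<Longrightarrow> A $$ (i, j) = (\<Sum>l<r. X i l * Y l j)"
  shows "vec_space.rank n A \<le> r"
proof (rule ccontr)
  assume "\<not> vec_space.rank n A \<le> r"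
  interpret vec_space "TYPE('a)" n .
  have less: "r < rank A" using \<open>\<not> _\<close> by simp
  obtain S where S: "maximal S (\<lambda>T. T \<subseteq> set (cols A) \<and> lin_indpt T)" "finite S"
    using maximal_exists_superset[of "set (cols A)" "(\<lambda>T. T \<subseteq> set (cols A) \<and> lin_indpt T)" "{}"]
    by (auto simp: finite_lin_indpt2)
  define k where "k = card S"
  have k: "r < k" using less rank_card_indpt[OF A S(1)] by (simp add: k_def)
  have sub: "S \<subseteq> set (cols A)" and ind: "lin_indpt S" using S(1) by (auto simp: maximal_def)
  obtain xs where xs: "set xs = S" "distinct xs" using finite_distinct_list[OF S(2)] by blast
  have len: "length xs = k" using distinct_card[OF xs(2)] by (simp add: xs(1) k_def)
  have "\<exists>j. j < m \<and> xs ! l = Matrix.col A j" if "l < k" for l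
  proof -
    have "xs ! l \<in> set (cols A)" using that len xs(1) sub by auto
    then show ?thesis using A by (auto simp: cols_def)
  qed
  then obtain c where c: "\<And>l. l < k \<Longrightarrow> c l < m \<and> xs ! l = Matrix.col A (c l)" by metis
  define Z where "Z = mat_of_cols n xs"
  have Z: "Z \<in> carrier_mat n k" by (simp add: Z_def len[symmetric])
  have colsZ: "cols Z = xs"
    unfolding Z_def using sub xs(1) A by (intro cols_mat_of_cols) (auto simp: cols_def)
  \<comment> \<open>The chosen columns of \<open>Y\<close>, padded with zero rows to a square
    matrix; as \<open>r < k\<close>, row \<open>r\<close> is zero and the determinant
    vanishes.\<close>
  define P where "P = Matrix.mat k k (\<lambda>(i, j). if i < r then Y i (c j) else 0)"
  have P: "P \<in> carrier_mat k k" by (simp add: P_def)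
  have "Determinant.det P = 0"
  proof -
    have "Determinant.det P = (\<Sum>j<k. P $$ (r, j) * cofactor P r j)"
      by (rule laplace_expansion_row[OF P k])
    also have "\<dots> = 0" using k by (intro sum.neutral) (auto simp: P_def)
    finally show ?thesis .
  qed
  then obtain v where v: "v \<in> carrier_vec k" "v \<noteq> 0\<^sub>v k" "P *\<^sub>v v = 0\<^sub>v k"
    using det_0_iff_vec_prod_zero_field[OF P] by blast
  have Pv: "(\<Sum>j<k. Y i (c j) * vec_index v j) = 0" if "i < r" for i
  proof -
    have "vec_index (P *\<^sub>v v) i = (\<Sum>j<k. Y i (c j) * vec_index v j)"
      using that k v(1) P by (simp add: P_def scalar_prod_def lessThan_atLeast0)
    then show ?thesis using v(3) that k by simp
  qed
  have "Z *\<^sub>v v = 0\<^sub>v n"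
  proof (rule eq_vecI)
    fix i assume "i < dim_vec (0\<^sub>v n :: 'a Matrix.vec)"
    then have i: "i < n" by simp
    have Zij: "Z $$ (i, j) = (\<Sum>l<r. X i l * Y l (c j))" if "j < k" for j
      using c[OF that] that i len A X[of i "c j"] by (simp add: Z_def mat_of_cols_index)
    have "vec_index (Z *\<^sub>v v) i = (\<Sum>j<k. Z $$ (i, j) * vec_index v j)"
      using i Z v(1) by (simp add: scalar_prod_def lessThan_atLeast0)
    also have "\<dots> = (\<Sum>j<k. \<Sum>l<r. X i l * (Y l (c j) * vec_index v j))"
      by (intro sum.cong) (auto simp: Zij sum_distrib_right mult.assoc)
    also have "\<dots> = (\<Sum>l<r. X i l * (\<Sum>j<k. Y l (c j) * vec_index v j))"
      by (subst sum.swap) (simp add: sum_distrib_left)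
    also have "\<dots> = 0" by (intro sum.neutral) (simp add: Pv)
    finally show "vec_index (Z *\<^sub>v v) i = vec_index (0\<^sub>v n) i" using i by simp
  qed (use Z in auto)
  then have "lin_dep (set (cols Z))"
    using lin_depI[OF Z v(1,2)] colsZ xs(2) by blast
  then show False using ind colsZ xs(1) by simp
qed

text \<open>Equivalently, the cokernel of \<open>B\<close> over the integers is torsion-free. Real
  coefficients are allowed because points of a polytope come with real weights.\<close>

definition saturated :: "int Matrix.mat \<Rightarrow> bool" where
  "saturated B \<longleftrightarrow> (\<forall>x \<mu>. (\<forall>i<dim_row B. real_of_int (x i) = (\<Sum>j<dim_col B. \<mu> j * real_of_int (B $$ (i, j)))) \<longrightarrow>
     (\<exists>c::nat \<Rightarrow> int. \<forall>i<dim_row B. x i = (\<Sum>j<dim_col B. c j * B $$ (i, j))))"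

lemma finite_minors: "finite (minors k B)"
proof -
  have "minors k B \<subseteq> (\<lambda>(I, J). Determinant.det (submatrix B I J)) ` (Pow {..<dim_row B} \<times> Pow {..<dim_col B})"
    by (auto simp: minors_def)
  then show ?thesis by (rule finite_subset) auto
qed

lemma Gcd_in_ideal:
  fixes D :: "int set"
  assumes "0 \<in> D" "\<And>a b. a \<in> D \<Longrightarrow> b \<in> D \<Longrightarrow> a + b \<in> D" "\<And>a c. a \<in> D \<Longrightarrow> c * a \<in> D"
    and "finite A" "A \<subseteq> D"
  shows "Gcd A \<in> D"
  using assms(4,5)
proof (induction A)
  case (insert x A)
  obtain u v where "u * x + v * Gcd A = gcd x (Gcd A)" using bezout_int by blast
  then show ?case using insert assms(2,3) by (metis Gcd_insert insert_subset)
qed (simp add: assms(1))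

text \<open>Cramer's rule: each minor of maximal size carries the real span into the lattice.\<close>

lemma saturated_of_Gcd_minors:
  assumes gcd: "Gcd (minors (int_mat_rank B) B - {0}) = 1"
  shows "saturated B"
  unfolding saturated_def
proof (intro allI impI)
  fix x \<mu>
  let ?N = "dim_row B" and ?m = "dim_col B" and ?k = "int_mat_rank B"
  let ?B = "\<lambda>i j. B $$ (i, j)"
  assume x: "\<forall>i<?N. real_of_int (x i) = (\<Sum>j<?m. \<mu> j * real_of_int (B $$ (i, j)))"
  \<comment> \<open>The multipliers that carry \<open>x\<close> into the lattice of the columns form
    an ideal. It will contain all minors of size \<open>?k\<close>, hence their gcd 1.\<close>
  define D where "D = {d. \<exists>c::nat \<Rightarrow> int. \<forall>i<?N. d * x i = (\<Sum>j<?m. c j * B $$ (i, j))}"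
  have D0: "0 \<in> D" unfolding D_def by (auto intro: exI[of _ "\<lambda>_. 0"])
  have Dadd: "a + b \<in> D" if ab: "a \<in> D" "b \<in> D" for a b
  proof -
    obtain c c' where "\<And>i. i < ?N \<Longrightarrow> a * x i = (\<Sum>j<?m. c j * B $$ (i, j))" "\<And>i. i < ?N \<Longrightarrow> b * x i = (\<Sum>j<?m. c' j * B $$ (i, j))"
      using ab unfolding D_def by blast
    then show ?thesis unfolding D_def
      by (intro CollectI exI[of _ "\<lambda>j. c j + c' j"]) (simp add: ring_distribs sum.distrib)
  qed
  have Dmult: "b * a \<in> D" if a: "a \<in> D" for a b
  proof -
    obtain c where "\<And>i. i < ?N \<Longrightarrow> a * x i = (\<Sum>j<?m. c j * B $$ (i, j))"
      using a unfolding D_def by blast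
    then show ?thesis unfolding D_def
      by (intro CollectI exI[of _ "\<lambda>j. b * c j"]) (simp add: mult.assoc flip: sum_distrib_left)
  qed
  have "minors ?k B \<subseteq> D"
  proof
    fix \<delta> assume "\<delta> \<in> minors ?k B"
    then obtain \<rho> \<gamma> where \<rho>: "\<And>i. i < ?k \<Longrightarrow> \<rho> i < ?N" and \<gamma>: "\<And>i. i < ?k \<Longrightarrow> \<gamma> i < ?m"
      and \<delta>: "\<delta> = fminor ?B ?k \<rho> \<gamma>" using submatrix_in_minors by blast
    have zero: "fminor ?B (Suc ?k) (\<rho>(?k := i)) (\<gamma>(?k := j)) = 0" if "i < ?N" "j < ?m" for i j
    proof -
      have "0 dvd fminor ?B (Suc ?k) (\<rho>(?k := i)) (\<gamma>(?k := j))"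
        using \<rho> \<gamma> that minors_eq_0_of_rank[of B "Suc ?k"] by (intro dvd_fminor_minors) (auto simp: less_Suc_eq)
      then show ?thesis by simp
    qed
    \<comment> \<open>On a column of \<open>B\<close> the bordered determinant is a minor of size
      \<open>?k + 1\<close>, which is 0; by linearity it vanishes on the real span of the
      columns.\<close>
    have bord0: "bordered ?B ?k (\<rho>(?k := i)) \<gamma> x = 0" if i: "i < ?N" for i
    proof -
      let ?\<rho> = "\<rho>(?k := i)"
      obtain a where a: "\<And>x. bordered ?B ?k ?\<rho> \<gamma> x = (\<Sum>i<Suc ?k. x (?\<rho> i) * a i)"
        using bordered_expand_column by blast
      have "real_of_int (bordered ?B ?k ?\<rho> \<gamma> x) = (\<Sum>i<Suc ?k. real_of_int (x (?\<rho> i)) * real_of_int (a i))"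
        by (simp add: a)
      also have "\<dots> = (\<Sum>i<Suc ?k. (\<Sum>j<?m. \<mu> j * real_of_int (B $$ (?\<rho> i, j))) * real_of_int (a i))"
        using \<rho> i x by (intro sum.cong refl) (auto simp: less_Suc_eq)
      also have "\<dots> = (\<Sum>j<?m. \<mu> j * real_of_int (\<Sum>i<Suc ?k. B $$ (?\<rho> i, j) * a i))"
        unfolding sum_distrib_right by (subst sum.swap) (simp add: sum_distrib_left mult.assoc del: sum.lessThan_Suc)
      also have "\<dots> = (\<Sum>j<?m. \<mu> j * real_of_int (fminor ?B (Suc ?k) ?\<rho> (\<gamma>(?k := j))))"
        unfolding bordered_column[symmetric] a ..
      also have "\<dots> = 0" using i zero by (intro sum.neutral) simp
      finally show ?thesis by simp
    qed
    obtain a where a: "\<And>i. bordered ?B ?k (\<rho>(?k := i)) \<gamma> x = (\<Sum>l<?k. ?B i (\<gamma> l) * a l) + x i * \<delta>"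
      using bordered_expand_row unfolding \<delta> by blast
    \<comment> \<open>The expansion uses the columns \<open>\<gamma> l\<close>; its coefficients are
      collected by column index.\<close>
    have "\<delta> * x i = (\<Sum>j<?m. (- (\<Sum>l | l < ?k \<and> \<gamma> l = j. a l)) * B $$ (i, j))" if i: "i < ?N" for i
    proof -
      have "\<delta> * x i = - (\<Sum>l<?k. B $$ (i, \<gamma> l) * a l)"
        using a[of i] bord0[OF i] by (simp add: mult.commute)
      also have "(\<Sum>l<?k. B $$ (i, \<gamma> l) * a l) = (\<Sum>j<?m. \<Sum>l | l \<in> {..<?k} \<and> \<gamma> l = j. B $$ (i, \<gamma> l) * a l)"
        using \<gamma> by (intro sum.group[symmetric]) auto
      also have "\<dots> = (\<Sum>j<?m. (\<Sum>l | l < ?k \<and> \<gamma> l = j. a l) * B $$ (i, j))"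
        by (intro sum.cong refl) (auto simp: sum_distrib_left mult.commute intro!: sum.cong)
      finally show ?thesis by (simp add: sum_negf)
    qed
    then show "\<delta> \<in> D" unfolding D_def
      by (intro CollectI exI[of _ "\<lambda>j. - (\<Sum>l | l < ?k \<and> \<gamma> l = j. a l)"]) simp
  qed
  then have "Gcd (minors ?k B - {0}) \<in> D"
    using finite_minors by (intro Gcd_in_ideal D0 Dadd Dmult) auto
  then show "\<exists>c::nat \<Rightarrow> int. \<forall>i<?N. x i = (\<Sum>j<?m. c j * B $$ (i, j))"
    unfolding gcd by (simp add: D_def)
qed

lemma det_cong_mod:
  fixes A A' :: "int Matrix.mat"
  assumes "A \<in> carrier_mat n n" "A' \<in> carrier_mat n n"
    and "\<And>i j. i < n \<Longrightarrow> j < n \<Longrightarrow> q dvd A $$ (i, j) - A' $$ (i, j)"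
  shows "q dvd Determinant.det A - Determinant.det A'"
proof -
  have cong: "A $$ (i, j) mod q = A' $$ (i, j) mod q" if "i < n" "j < n" for i j
    using assms(3)[OF that] by (simp add: mod_eq_dvd_iff)
  have "(\<Prod>i=0..<n. A $$ (i, p i)) mod q = (\<Prod>i=0..<n. A' $$ (i, p i)) mod q" if "p permutes {0..<n}" for p
  proof -
    have "p i < n" if "i < n" for i using permutes_in_image[OF \<open>p permutes _\<close>, of i] that by simp
    then have "(\<Prod>i=0..<n. A $$ (i, p i) mod q) = (\<Prod>i=0..<n. A' $$ (i, p i) mod q)"
      by (intro prod.cong) (auto simp: cong)
    then have "(\<Prod>i=0..<n. A $$ (i, p i) mod q) mod q = (\<Prod>i=0..<n. A' $$ (i, p i) mod q) mod q"
      by (rule arg_cong)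
    then show ?thesis by (simp only: mod_prod_eq)
  qed
  then have "signof p * (\<Prod>i=0..<n. A $$ (i, p i)) mod q = signof p * (\<Prod>i=0..<n. A' $$ (i, p i)) mod q"
    if "p permutes {0..<n}" for p using that by (intro mod_mult_cong refl) blast
  then have "(\<Sum>p | p permutes {0..<n}. signof p * (\<Prod>i=0..<n. A $$ (i, p i)) mod q) =
      (\<Sum>p | p permutes {0..<n}. signof p * (\<Prod>i=0..<n. A' $$ (i, p i)) mod q)"
    by (intro sum.cong refl) (simp only: mem_Collect_eq)
  then have "(\<Sum>p | p permutes {0..<n}. signof p * (\<Prod>i=0..<n. A $$ (i, p i)) mod q) mod q =
      (\<Sum>p | p permutes {0..<n}. signof p * (\<Prod>i=0..<n. A' $$ (i, p i)) mod q) mod q"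
    by (rule arg_cong)
  then have "Determinant.det A mod q = Determinant.det A' mod q"
    unfolding det_def'[OF assms(1)] det_def'[OF assms(2)] by (simp only: mod_sum_eq)
  then show ?thesis by (simp add: mod_eq_dvd_iff)
qed

text \<open>If a prime \<open>q\<close> divides all minors of size \<open>rank B\<close>, there is an \<open>r < rank B\<close> such that \<open>q\<close>
  divides all minors of size \<open>r + 1\<close> but not some minor \<open>\<delta>\<close> of size \<open>r\<close>. Expanding the bordered
  minors of \<open>\<delta>\<close> modulo \<open>q\<close> and using saturation gives \<open>B (\<delta> - q C) = B\<^sub>J A\<close> with \<open>r\<close> columns \<open>B\<^sub>J\<close>
  of \<open>B\<close>; as \<open>\<delta> - q C\<close> is invertible over the rationals, \<open>rank B \<le> r\<close>.\<close>

lemma Gcd_minors_of_saturated: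
  assumes sat: "saturated B"
  shows "Gcd (minors (int_mat_rank B) B - {0}) = 1"
proof (rule ccontr)
  let ?N = "dim_row B" and ?m = "dim_col B" and ?k = "int_mat_rank B"
  let ?B = "\<lambda>i j. B $$ (i, j)"
  assume "Gcd (minors ?k B - {0}) \<noteq> 1"
  moreover have "Gcd (minors ?k B - {0}) \<ge> 0" by simp
  ultimately have "\<not> is_unit (Gcd (minors ?k B - {0}))" by auto
  \<comment> \<open>If there is no nonzero minor, the gcd is 0 and every prime divides it.\<close>
  then obtain q where q: "prime q" "q dvd Gcd (minors ?k B - {0})"
    by (metis Gcd_0_iff dvd_0_right prime_divisor_exists two_is_prime)
  have q_minors: "q dvd x" if "x \<in> minors ?k B" for x
    using that q(2) by (cases "x = 0") (auto intro: dvd_trans[OF _ Gcd_dvd])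
  define P where "P r \<longleftrightarrow> (\<forall>\<rho> \<gamma>. (\<forall>i<r. \<rho> i < ?N) \<and> (\<forall>i<r. \<gamma> i < ?m) \<longrightarrow> q dvd fminor ?B r \<rho> \<gamma>)" for r
  have Pk: "P ?k" unfolding P_def using q_minors by (auto intro!: dvd_fminor_minors)
  \<comment> \<open>The empty determinant is 1, so the least size at which \<open>q\<close> divides
    everything is positive and has a predecessor \<open>r\<close>.\<close>
  have P0: "\<not> P 0" using q(1) by (auto simp: P_def fminor_def not_prime_unit)
  obtain r where r: "r < ?k" "\<not> P r" "P (Suc r)"
    using ex_least_nat_less[of P ?k] Pk P0 by (metis order_refl)
  obtain \<rho> \<gamma> where \<rho>: "\<And>i. i < r \<Longrightarrow> \<rho> i < ?N" and \<gamma>: "\<And>i. i < r \<Longrightarrow> \<gamma> i < ?m"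
    and nd: "\<not> q dvd fminor ?B r \<rho> \<gamma>" using r(2) unfolding P_def by blast
  define \<delta> where "\<delta> = fminor ?B r \<rho> \<gamma>"
  define E where "E j a \<longleftrightarrow> (\<forall>i. bordered ?B r (\<rho>(r := i)) \<gamma> (\<lambda>i. B $$ (i, j)) = (\<Sum>l<r. ?B i (\<gamma> l) * a l) + B $$ (i, j) * \<delta>)" for j a
  have "\<forall>j. \<exists>a. E j a"
    unfolding E_def \<delta>_def by (intro allI bordered_expand_row)
  then obtain a where "\<forall>j. E j (a j)" by metis
  then have a: "bordered ?B r (\<rho>(r := i)) \<gamma> (\<lambda>i. B $$ (i, j)) = (\<Sum>l<r. ?B i (\<gamma> l) * a j l) + B $$ (i, j) * \<delta>" for i j
    unfolding E_def by simp
  have "q dvd (\<Sum>l<r. ?B i (\<gamma> l) * a j l) + B $$ (i, j) * \<delta>" if "i < ?N" "j < ?m" for i j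
  proof -
    have "q dvd fminor ?B (Suc r) (\<rho>(r := i)) (\<gamma>(r := j))"
      using r(3) \<rho> \<gamma> that unfolding P_def by (auto simp: less_Suc_eq)
    then show ?thesis by (simp only: bordered_column[symmetric] a)
  qed
  then obtain y where y: "\<And>i j. i < ?N \<Longrightarrow> j < ?m \<Longrightarrow> (\<Sum>l<r. ?B i (\<gamma> l) * a j l) + B $$ (i, j) * \<delta> = q * y j i"
    using dvd_mult_div_cancel that[of "\<lambda>j i. ((\<Sum>l<r. ?B i (\<gamma> l) * a j l) + B $$ (i, j) * \<delta>) div q"] by simp
  have "\<exists>c::nat \<Rightarrow> int. \<forall>i<?N. y j i = (\<Sum>j'<?m. c j' * B $$ (i, j'))" if j: "j < ?m" for j
  proof -
    \<comment> \<open>The vector \<open>q * y j\<close> is an integral combination of columns, so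
      \<open>y j\<close> lies in the real span; as \<open>y j\<close> is integral, saturation
      supplies integral coefficients.\<close>
    define \<mu> where "\<mu> j' = real_of_int ((\<Sum>l | l < r \<and> \<gamma> l = j'. a j l) + (if j' = j then \<delta> else 0)) / real_of_int q" for j'
    have q0: "real_of_int q \<noteq> 0" using q(1) by auto
    have "real_of_int (y j i) = (\<Sum>j'<?m. \<mu> j' * real_of_int (B $$ (i, j')))" if i: "i < ?N" for i
    proof -
      have "(\<Sum>l<r. ?B i (\<gamma> l) * a j l) = (\<Sum>j'<?m. \<Sum>l | l \<in> {..<r} \<and> \<gamma> l = j'. ?B i (\<gamma> l) * a j l)"
        using \<gamma> by (intro sum.group[symmetric]) auto
      also have "\<dots> = (\<Sum>j'<?m. (\<Sum>l | l < r \<and> \<gamma> l = j'. a j l) * B $$ (i, j'))"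
        by (intro sum.cong refl) (auto simp: sum_distrib_left mult.commute intro!: sum.cong)
      finally have *: "(\<Sum>l<r. ?B i (\<gamma> l) * a j l) = (\<Sum>j'<?m. (\<Sum>l | l < r \<and> \<gamma> l = j'. a j l) * B $$ (i, j'))" .
      have "B $$ (i, j) * \<delta> = (\<Sum>j'<?m. (if j' = j then \<delta> else 0) * B $$ (i, j'))"
        using j by (subst sum.remove[of _ j]) auto
      with * have "q * y j i = (\<Sum>j'<?m. ((\<Sum>l | l < r \<and> \<gamma> l = j'. a j l) + (if j' = j then \<delta> else 0)) * B $$ (i, j'))"
        using y[OF i j] by (simp only: ring_distribs sum.distrib)
      then have "real_of_int q * real_of_int (y j i) = (\<Sum>j'<?m. real_of_int ((\<Sum>l | l < r \<and> \<gamma> l = j'. a j l) + (if j' = j then \<delta> else 0)) * real_of_int (B $$ (i, j')))"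
        by (metis (no_types, lifting) of_int_mult of_int_sum sum.cong)
      also have "\<dots> = real_of_int q * (\<Sum>j'<?m. \<mu> j' * real_of_int (B $$ (i, j')))"
        unfolding sum_distrib_left \<mu>_def using q0 by (intro sum.cong) auto
      finally show ?thesis using q0 by simp
    qed
    then show ?thesis using sat unfolding saturated_def by blast
  qed
  moreover define C where "C j c \<longleftrightarrow> (\<forall>i<?N. y j i = (\<Sum>j'<?m. c j' * B $$ (i, j')))" for j and c :: "nat \<Rightarrow> int"
  ultimately have "\<forall>j. \<exists>c. j < ?m \<longrightarrow> C j c" by auto
  then obtain c where "\<forall>j. j < ?m \<longrightarrow> C j (c j)" by metis
  then have c: "y j i = (\<Sum>j'<?m. c j j' * B $$ (i, j'))" if "i < ?N" "j < ?m" for i j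
    using that unfolding C_def by simp
  \<comment> \<open>Modulo \<open>q\<close> this is \<open>\<delta>\<close> times the identity, so
    its determinant is congruent to a power of \<open>\<delta>\<close> and cannot be 0.\<close>
  define M where "M = Matrix.mat ?m ?m (\<lambda>(j', j). (if j' = j then \<delta> else 0) - q * c j j')"
  have M: "M \<in> carrier_mat ?m ?m" by (simp add: M_def)
  have "q dvd Determinant.det M - Determinant.det (\<delta> \<cdot>\<^sub>m 1\<^sub>m ?m)"
    by (rule det_cong_mod[OF M]) (auto simp: M_def)
  moreover have "\<not> q dvd Determinant.det (\<delta> \<cdot>\<^sub>m 1\<^sub>m ?m)"
    using nd q(1) by (auto simp: \<delta>_def dest: prime_dvd_power)
  ultimately have "Determinant.det M \<noteq> 0" by auto
  define R where "R = map_mat rat_of_int M"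
  have R: "R \<in> carrier_mat ?m ?m" using M by (simp add: R_def)
  have "Determinant.det R \<noteq> 0" using \<open>Determinant.det M \<noteq> 0\<close> by (simp add: R_def of_int_hom.hom_det)
  then have "R \<in> Units (ring_mat TYPE(rat) ?m ())" by (rule det_non_zero_imp_unit[OF R])
  then obtain R' where R': "R' \<in> carrier_mat ?m ?m" "R * R' = 1\<^sub>m ?m"
    by (auto simp: Units_def ring_mat_def)
  have RR': "(\<Sum>j<?m. R $$ (j', j) * R' $$ (j, i)) = (if j' = i then 1 else 0)" if "j' < ?m" "i < ?m" for j' i
  proof -
    have "(R * R') $$ (j', i) = (\<Sum>j<?m. R $$ (j', j) * R' $$ (j, i))"
      using that R R'(1) by (simp add: scalar_prod_def lessThan_atLeast0)
    then show ?thesis using that R'(2) by simp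
  qed
  have BM: "(\<Sum>j'<?m. B $$ (i, j') * M $$ (j', j)) = - (\<Sum>l<r. B $$ (i, \<gamma> l) * a j l)" if i: "i < ?N" and j: "j < ?m" for i j
  proof -
    have "(\<Sum>j'<?m. B $$ (i, j') * M $$ (j', j)) =
        (\<Sum>j'<?m. B $$ (i, j') * (if j' = j then \<delta> else 0)) - q * (\<Sum>j'<?m. c j j' * B $$ (i, j'))"
      using j by (simp add: M_def right_diff_distrib sum_subtractf sum_distrib_left mult_ac)
    also have "(\<Sum>j'<?m. B $$ (i, j') * (if j' = j then \<delta> else 0)) = B $$ (i, j) * \<delta>"
      using j by (subst sum.remove[of _ j]) auto
    finally show ?thesis using y[OF i j] c[OF i j] by simp
  qed
  have BR: "(\<Sum>j'<?m. rat_of_int (B $$ (i, j')) * R $$ (j', j)) = - (\<Sum>l<r. rat_of_int (B $$ (i, \<gamma> l)) * rat_of_int (a j l))"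
    if "i < ?N" "j < ?m" for i j
  proof -
    have "(\<Sum>j'<?m. rat_of_int (B $$ (i, j')) * R $$ (j', j)) = rat_of_int (\<Sum>j'<?m. B $$ (i, j') * M $$ (j', j))"
      using that M by (simp add: R_def)
    then show ?thesis unfolding BM[OF that] by simp
  qed
  \<comment> \<open>Multiplying \<open>BR\<close> by the inverse \<open>R'\<close> expresses every
    column of \<open>B\<close> through the \<open>r\<close> columns
    \<open>\<gamma> l\<close>.\<close>
  have "rat_of_int (B $$ (i, j)) = (\<Sum>l<r. rat_of_int (B $$ (i, \<gamma> l)) * (- (\<Sum>h<?m. rat_of_int (a h l) * R' $$ (h, j))))"
    if i: "i < ?N" and j: "j < ?m" for i j
  proof -
    have "rat_of_int (B $$ (i, j)) = (\<Sum>j'<?m. rat_of_int (B $$ (i, j')) * (if j' = j then 1 else 0))"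
      using j by (subst sum.remove[of _ j]) auto
    also have "\<dots> = (\<Sum>j'<?m. rat_of_int (B $$ (i, j')) * (\<Sum>h<?m. R $$ (j', h) * R' $$ (h, j)))"
      by (intro sum.cong refl) (simp add: RR' j)
    also have "\<dots> = (\<Sum>h<?m. (\<Sum>j'<?m. rat_of_int (B $$ (i, j')) * R $$ (j', h)) * R' $$ (h, j))"
      unfolding sum_distrib_left sum_distrib_right by (subst sum.swap) (simp add: mult.assoc)
    also have "\<dots> = (\<Sum>h<?m. - (\<Sum>l<r. rat_of_int (B $$ (i, \<gamma> l)) * rat_of_int (a h l)) * R' $$ (h, j))"
      by (intro sum.cong refl) (simp add: BR i)
    also have "\<dots> = - (\<Sum>h<?m. \<Sum>l<r. rat_of_int (B $$ (i, \<gamma> l)) * (rat_of_int (a h l) * R' $$ (h, j)))"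
      by (simp add: sum_negf sum_distrib_right mult.assoc)
    also have "\<dots> = (\<Sum>l<r. rat_of_int (B $$ (i, \<gamma> l)) * (- (\<Sum>h<?m. rat_of_int (a h l) * R' $$ (h, j))))"
      by (subst sum.swap) (simp add: sum_distrib_left sum_negf)
    finally show ?thesis .
  qed
  then have "vec_space.rank ?N (map_mat rat_of_int B) \<le> r"
    by (intro rank_le_of_combinations[where m = ?m and X = "\<lambda>i l. rat_of_int (B $$ (i, \<gamma> l))"
          and Y = "\<lambda>l j. - (\<Sum>h<?m. rat_of_int (a h l) * R' $$ (h, j))"]) simp_all
  then show False using r(1) by (simp add: int_mat_rank_def)
qed

lemma Gcd_minors_eq_1_iff: "Gcd (minors (int_mat_rank B) B - {0}) = 1 \<longleftrightarrow> saturated B"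
  using saturated_of_Gcd_minors Gcd_minors_of_saturated by blast

section \<open>Integral extensions\<close>

definition subring :: "'a::comm_ring_1 set \<Rightarrow> bool" where
  "subring R \<longleftrightarrow> 0 \<in> R \<and> 1 \<in> R \<and> (\<forall>x\<in>R. \<forall>y\<in>R. x + y \<in> R \<and> x - y \<in> R \<and> x * y \<in> R)"

lemma subringD:
  assumes "subring R"
  shows "0 \<in> R" "1 \<in> R" "x \<in> R \<Longrightarrow> y \<in> R \<Longrightarrow> x + y \<in> R" "x \<in> R \<Longrightarrow> y \<in> R \<Longrightarrow> x - y \<in> R"
    "x \<in> R \<Longrightarrow> y \<in> R \<Longrightarrow> x * y \<in> R"
  using assms by (auto simp: subring_def)

lemma subring_uminus: "subring R \<Longrightarrow> x \<in> R \<Longrightarrow> - x \<in> R"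
  using subringD(4)[of R 0 x] by (simp add: subringD(1))

lemma subring_sum: "subring R \<Longrightarrow> (\<And>x. x \<in> X \<Longrightarrow> f x \<in> R) \<Longrightarrow> sum f X \<in> R"
  by (induction X rule: infinite_finite_induct) (auto intro: subringD)

lemma subring_prod: "subring R \<Longrightarrow> (\<And>x. x \<in> X \<Longrightarrow> f x \<in> R) \<Longrightarrow> prod f X \<in> R"
  by (induction X rule: infinite_finite_induct) (auto intro: subringD)

lemma subring_power: "subring R \<Longrightarrow> x \<in> R \<Longrightarrow> x ^ n \<in> R"
  by (induction n) (auto intro: subringD)

lemma subring_kmon: "add_closed S \<Longrightarrow> subring (kmon S)"
  by (auto simp: subring_def intro: kmon_1 kmon_add kmon_diff kmon_mult)

lemma subring_det:
  assumes R: "subring R" and A: "A \<in> carrier_mat n n" and AR: "\<And>i j. i < n \<Longrightarrow> j < n \<Longrightarrow> A $$ (i, j) \<in> R"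
  shows "Determinant.det A \<in> R"
  unfolding det_def'[OF A]
proof (intro subring_sum subringD(5) subring_prod R)
  show "signof p \<in> R" for p :: "nat \<Rightarrow> nat"
    using subringD(2)[OF R] subring_uminus[OF R] by (simp add: sign_def)
  show "A $$ (i, p i) \<in> R" if "p \<in> {p. p permutes {0..<n}}" "i \<in> {0..<n}" for p i
    using that permutes_in_image[of p "{0..<n}" i] by (intro AR) auto
qed

lemma subring_coeffs:
  assumes R: "subring R"
  shows "subring {p. \<forall>i. coeff p i \<in> R}"
  unfolding subring_def
proof (intro conjI ballI)
  fix p q assume pq: "p \<in> {p. \<forall>i. coeff p i \<in> R}" "q \<in> {p. \<forall>i. coeff p i \<in> R}"
  show "p + q \<in> {p. \<forall>i. coeff p i \<in> R}" "p - q \<in> {p. \<forall>i. coeff p i \<in> R}"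
    using pq R by (auto intro: subringD)
  show "p * q \<in> {p. \<forall>i. coeff p i \<in> R}"
    using pq by (auto simp: Polynomial.coeff_mult intro!: subring_sum[OF R] subringD(5)[OF R])
qed (use R in \<open>auto simp: coeff_pCons one_pCons subringD split: nat.splits\<close>)

text \<open>The determinant trick: a generating family is an eigenvector for the matrix that describes
  multiplication by \<open>x\<close>.\<close>

lemma integral_over_finite_extension:
  fixes R S :: "'a::idom set"
  assumes R: "subring R" and S: "subring S" and fin: "finite_extension R S" and x: "x \<in> S"
  shows "integral_over R x"
proof -
  obtain F where F: "finite F" "F \<subseteq> S"
    and gen: "\<And>y. y \<in> S \<Longrightarrow> \<exists>c. (\<forall>f\<in>F. c f \<in> R) \<and> y = (\<Sum>f\<in>F. c f * f)"
    using fin unfolding finite_extension_def by metis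
  obtain fs where fs: "set fs = F" "distinct fs" using finite_distinct_list[OF F(1)] by blast
  define n where "n = length fs"
  have sum_fs: "(\<Sum>f\<in>F. h f) = (\<Sum>j<n. h (fs ! j))" for h :: "'a \<Rightarrow> 'a"
    unfolding n_def fs(1)[symmetric]
    by (rule sum.reindex_bij_betw[OF bij_betw_nth[OF fs(2)], symmetric]) auto
  have fsF: "fs ! i \<in> F" if "i < n" for i using that fs(1) by (auto simp: n_def)
  have "\<exists>c. (\<forall>f\<in>F. c f \<in> R) \<and> x * fs ! i = (\<Sum>f\<in>F. c f * f)" if "i < n" for i
    using that F(2) fsF x by (intro gen subringD(5)[OF S]) auto
  then obtain c where c: "\<And>i f. i < n \<Longrightarrow> f \<in> F \<Longrightarrow> c i f \<in> R"
    "\<And>i. i < n \<Longrightarrow> x * fs ! i = (\<Sum>f\<in>F. c i f * f)" by metis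
  define C where "C = Matrix.mat n n (\<lambda>(i, j). c i (fs ! j))"
  have C: "C \<in> carrier_mat n n" by (simp add: C_def)
  define A where "A = Matrix.mat n n (\<lambda>(i, j). (if i = j then x else 0) - c i (fs ! j))"
  have A: "A \<in> carrier_mat n n" by (simp add: A_def)
  define w where "w = Matrix.vec n (\<lambda>i. fs ! i)"
  have w: "w \<in> carrier_vec n" by (simp add: w_def)
  have "A *\<^sub>v w = 0\<^sub>v n"
  proof (rule eq_vecI)
    fix i assume "i < dim_vec (0\<^sub>v n :: 'a Matrix.vec)"
    then have i: "i < n" by simp
    have "vec_index (A *\<^sub>v w) i = (\<Sum>j<n. ((if i = j then x else 0) - c i (fs ! j)) * fs ! j)"
      using i A w by (simp add: scalar_prod_def lessThan_atLeast0 A_def w_def)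
    also have "\<dots> = (\<Sum>j<n. (if i = j then x else 0) * fs ! j) - (\<Sum>j<n. c i (fs ! j) * fs ! j)"
      by (simp add: left_diff_distrib sum_subtractf)
    also have "(\<Sum>j<n. (if i = j then x else 0) * fs ! j) = x * fs ! i"
      using i by (subst sum.remove[of _ i]) auto
    also have "(\<Sum>j<n. c i (fs ! j) * fs ! j) = x * fs ! i"
      unfolding c(2)[OF i] by (rule sum_fs[symmetric])
    finally show "vec_index (A *\<^sub>v w) i = vec_index (0\<^sub>v n) i" using i by simp
  qed (simp add: A_def)
  \<comment> \<open>Otherwise 1, being a combination of the generators, would be 0.\<close>
  moreover have "w \<noteq> 0\<^sub>v n"
  proof
    assume w0: "w = 0\<^sub>v n"
    obtain b where "1 = (\<Sum>f\<in>F. b f * f)" using gen[OF subringD(2)[OF S]] by blast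
    also have "\<dots> = (\<Sum>j<n. b (fs ! j) * vec_index w j)"
      unfolding sum_fs by (simp add: w_def)
    also have "\<dots> = 0" by (simp add: w0)
    finally show False by simp
  qed
  ultimately have "Determinant.det A = 0"
    using det_0_iff_vec_prod_zero[OF A] w by blast
  moreover have "poly (char_poly C) x = Determinant.det A"
    unfolding char_poly_def
    by (rule poly_det_cong[of _ n]) (auto simp: char_poly_matrix_def C_def A_def)
  moreover have "lead_coeff (char_poly C) = 1"
    using degree_monic_char_poly[OF C] by simp
  moreover have "char_poly C \<in> {p. \<forall>i. coeff p i \<in> R}"
    unfolding char_poly_def
  proof (rule subring_det[OF subring_coeffs[OF R], of _ n])
    show "char_poly_matrix C \<in> carrier_mat n n" using C by simp
    show "char_poly_matrix C $$ (i, j) \<in> {p. \<forall>i. coeff p i \<in> R}" if "i < n" "j < n" for i j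
      using that c(1)[OF _ fsF] R
      by (auto simp: char_poly_matrix_def C_def coeff_pCons subringD subring_uminus split: nat.splits)
  qed
  ultimately show ?thesis unfolding integral_over_def by auto
qed

section \<open>Fractions and almost integral elements\<close>

lemma to_frac_simps:
  "to_frac 0 = 0" "to_frac 1 = 1" "to_frac (x + y) = to_frac x + to_frac y"
  "to_frac (x - y) = to_frac x - to_frac y" "to_frac (x * y) = to_frac x * to_frac y"
  by (simp_all add: to_frac_def Zero_fract_def One_fract_def)

lemma to_frac_uminus: "to_frac (- x) = - to_frac x"
  by (simp add: to_frac_def)

lemma to_frac_eq_iff [simp]: "to_frac x = to_frac y \<longleftrightarrow> x = y"
  by (simp add: to_frac_def eq_fract)

lemma to_frac_power: "to_frac (x ^ n) = to_frac x ^ n"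
  by (induction n) (simp_all add: to_frac_simps)

lemma to_frac_sum: "to_frac (sum f X) = (\<Sum>x\<in>X. to_frac (f x))"
  by (induction X rule: infinite_finite_induct) (simp_all add: to_frac_simps)

lemma Fract_conv_to_frac: "b \<noteq> 0 \<Longrightarrow> Fraction_Field.Fract a b = to_frac a / to_frac b"
  by (simp add: to_frac_def)

lemma integral_over_mono: "integral_over R x \<Longrightarrow> R \<subseteq> S \<Longrightarrow> integral_over S x"
  unfolding integral_over_def by blast

lemma integral_over_to_frac:
  assumes "integral_over R x"
  shows "integral_over (to_frac ` R) (to_frac x)"
proof -
  obtain q where q: "lead_coeff q = 1" "\<And>i. coeff q i \<in> R" "poly q x = 0"
    using assms unfolding integral_over_def by blast
  define q' where "q' = map_poly to_frac q"
  have coeff: "coeff q' i = to_frac (coeff q i)" for i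
    unfolding q'_def by (simp add: coeff_map_poly to_frac_simps)
  have deg: "degree q' = degree q"
    unfolding q'_def by (rule map_poly_degree_eq) (simp add: q(1) to_frac_simps(2))
  have "poly q' (to_frac x) = to_frac (poly q x)"
    unfolding poly_altdef deg by (simp add: coeff to_frac_sum to_frac_simps to_frac_power)
  then show ?thesis unfolding integral_over_def
    using q by (intro exI[of _ q']) (auto simp: coeff deg to_frac_simps)
qed

text \<open>By a monic equation of degree \<open>N\<close>, all powers of \<open>f / g\<close> are
  combinations over \<open>R\<close> of the powers below \<open>N\<close>. So \<open>g ^ N\<close>
  is a common denominator of all of them and can be taken as \<open>c\<close>.\<close>

lemma integral_over_almost_integral:
  fixes f g :: "'a::idom"
  assumes R: "subring R" and int: "integral_over (to_frac ` R) (Fraction_Field.Fract f g)"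
    and fg: "f \<in> R" "g \<in> R" "g \<noteq> 0"
  shows "\<exists>c\<in>R. c \<noteq> 0 \<and> (\<forall>n. \<exists>r\<in>R. c * f ^ n = g ^ n * r)"
proof -
  define x where "x = Fraction_Field.Fract f g"
  have xg: "x * to_frac g = to_frac f" using fg(3) by (simp add: x_def Fract_conv_to_frac to_frac_simps flip: to_frac_simps(1))
  obtain q where q: "lead_coeff q = 1" "\<And>i. coeff q i \<in> to_frac ` R" "poly q x = 0"
    using int unfolding integral_over_def x_def by blast
  define N where "N = degree q"
  have "\<forall>i. \<exists>b. b \<in> R \<and> coeff q i = to_frac b" using q(2) by blast
  then obtain a where a: "\<And>i. a i \<in> R" "\<And>i. coeff q i = to_frac (a i)"
    using choice[of "\<lambda>i b. b \<in> R \<and> coeff q i = to_frac b"] by blast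
  have "poly q x = (\<Sum>i<N. to_frac (a i) * x ^ i) + x ^ N"
    unfolding poly_altdef N_def[symmetric] using q(1) by (simp add: a(2) N_def flip: lessThan_Suc_atMost)
  then have xN: "x ^ N = (\<Sum>i<N. to_frac (- a i) * x ^ i)"
    using q(3) by (simp add: sum_negf to_frac_uminus eq_neg_iff_add_eq_0 add.commute)
  have pow: "\<exists>b. (\<forall>i. b i \<in> R) \<and> x ^ n = (\<Sum>i<N. to_frac (b i) * x ^ i)" if N: "N > 0" for n
  proof (induction n)
    case 0
    show ?case
    proof (intro exI conjI allI)
      show "(if i = 0 then 1 else 0) \<in> R" for i :: nat using R by (simp add: subringD)
      have "(\<Sum>i<N. to_frac (if i = 0 then 1 else 0) * x ^ i) = (\<Sum>i<N. if i = 0 then 1 else 0)"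
        by (intro sum.cong) (auto simp: to_frac_simps)
      then show "x ^ 0 = (\<Sum>i<N. to_frac (if i = 0 then 1 else 0) * x ^ i)" using N by simp
    qed
  next
    case (Suc n)
    then obtain b where b: "\<And>i. b i \<in> R" "x ^ n = (\<Sum>i<N. to_frac (b i) * x ^ i)" by blast
    obtain M where M: "N = Suc M" using N gr0_implies_Suc by blast
    have "x ^ Suc n = (\<Sum>i<N. to_frac (b i) * x ^ Suc i)"
      by (simp add: b(2) sum_distrib_left mult_ac)
    also have "\<dots> = (\<Sum>i<M. to_frac (b i) * x ^ Suc i) + to_frac (b M) * x ^ N"
      by (simp add: M)
    also have "(\<Sum>i<M. to_frac (b i) * x ^ Suc i) = (\<Sum>i<N. to_frac (if i = 0 then 0 else b (i - 1)) * x ^ i)"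
      unfolding M by (subst sum.lessThan_Suc_shift) (simp add: to_frac_simps)
    also have "to_frac (b M) * x ^ N = (\<Sum>i<N. to_frac (b M * - a i) * x ^ i)"
      unfolding xN by (simp add: sum_distrib_left to_frac_simps to_frac_uminus mult.assoc)
    finally have "x ^ Suc n = (\<Sum>i<N. to_frac ((if i = 0 then 0 else b (i - 1)) + b M * - a i) * x ^ i)"
      by (simp only: to_frac_simps(3) ring_distribs sum.distrib)
    moreover have "(if i = 0 then 0 else b (i - 1)) + b M * - a i \<in> R" for i
      using b(1) a(1) R by (intro subringD subring_uminus) (auto intro: subringD)
    ultimately show ?case by (intro exI[of _ "\<lambda>i. (if i = 0 then 0 else b (i - 1)) + b M * - a i"]) blast
  qed
  \<comment> \<open>A monic equation of degree 0 would read 1 = 0.\<close>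
  have N0: "N > 0"
  proof (rule ccontr)
    assume "\<not> N > 0"
    then show False using xN by simp
  qed
  have "\<exists>r\<in>R. g ^ N * f ^ n = g ^ n * r" for n
  proof -
    obtain b where b: "\<And>i. b i \<in> R" "x ^ n = (\<Sum>i<N. to_frac (b i) * x ^ i)" using pow[OF N0] by blast
    define r where "r = (\<Sum>i<N. b i * (g ^ (N - i) * f ^ i))"
    have "r \<in> R" unfolding r_def using R b(1) fg by (intro subring_sum subringD(5) subring_power) auto
    moreover have "g ^ N * f ^ n = g ^ n * r"
    proof -
      have gx: "to_frac g ^ N * x ^ i = to_frac (g ^ (N - i) * f ^ i)" if "i < N" for i
      proof -
        have "to_frac g ^ N = to_frac g ^ (N - i) * to_frac g ^ i" using that by (simp flip: power_add)
        then show ?thesis by (simp add: to_frac_simps to_frac_power xg[symmetric] power_mult_distrib)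
      qed
      have "to_frac (g ^ N * f ^ n) = to_frac g ^ n * (to_frac g ^ N * x ^ n)"
        by (simp add: to_frac_simps to_frac_power xg[symmetric] power_mult_distrib)
      also have "to_frac g ^ N * x ^ n = (\<Sum>i<N. to_frac (b i) * (to_frac g ^ N * x ^ i))"
        unfolding b(2) sum_distrib_left by (intro sum.cong) (simp_all only: mult_ac)
      also have "\<dots> = to_frac r" unfolding r_def to_frac_sum by (intro sum.cong) (simp_all add: gx to_frac_simps)
      finally have "to_frac (g ^ N * f ^ n) = to_frac (g ^ n * r)" by (simp add: to_frac_simps to_frac_power)
      then show ?thesis by simp
    qed
    ultimately show ?thesis by blast
  qed
  moreover have "g ^ N \<in> R" "g ^ N \<noteq> 0" using fg R by (auto intro: subring_power)
  ultimately show ?thesis by blast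
qed

section \<open>Lowest monomials and normality\<close>

text \<open>A total order compatible with addition, z-degree first; it singles out one extreme
  monomial of a polynomial.\<close>

definition mle :: "'i::linorder expo \<Rightarrow> 'i expo \<Rightarrow> bool" where
  "mle s t \<longleftrightarrow> snd s < snd t \<or> snd s = snd t \<and> fst s \<le> fst t"

lemma mle_refl: "mle s s"
  by (simp add: mle_def)

lemma mle_antisym: "mle s t \<Longrightarrow> mle t s \<Longrightarrow> s = t"
  by (auto simp: mle_def prod_eq_iff)

lemma mle_trans: "mle s t \<Longrightarrow> mle t u \<Longrightarrow> mle s u"
  by (auto simp: mle_def)

lemma mle_total: "mle s t \<or> mle t s"
  by (auto simp: mle_def)

lemma mle_add_right: "mle s t \<Longrightarrow> mle (s + u) (t + u)"
  by (auto simp: mle_def add_right_mono)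

lemma mle_add_left: "mle s t \<Longrightarrow> mle (u + s) (u + t)"
  using mle_add_right[of s t u] by (simp add: add.commute)

text \<open>This is why the lowest monomial of a product cannot cancel: only the two lowest
  monomials of the factors contribute to it.\<close>

lemma mle_add_eq:
  assumes "mle s s'" "mle t t'" "s' + t' = s + t"
  shows "s' = s \<and> t' = t"
proof -
  have "mle (s + t) (s' + t)" "mle (s' + t) (s' + t')"
    using assms mle_add_left mle_add_right by blast+
  then have "s' + t = s + t" using assms(3) mle_antisym by metis
  then show ?thesis using assms(3) by simp
qed

lemma mle_finite_least:
  assumes "finite X" "X \<noteq> {}"
  shows "\<exists>s\<in>X. \<forall>t\<in>X. mle s t"
  using assms
proof (induction X rule: finite_ne_induct)
  case (insert x X)
  then obtain s where s: "s \<in> X" "\<And>t. t \<in> X \<Longrightarrow> mle s t" by blast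
  show ?case
  proof (cases "mle s x")
    case True
    then show ?thesis using s by blast
  next
    case False
    then have "mle x t" if "t \<in> X" for t using mle_total[of s x] mle_trans[of x s t] s(2)[OF that] by blast
    then show ?thesis using mle_refl by blast
  qed
qed (simp add: mle_refl)

definition lmon :: "('i::linorder, 'k::field) polyz \<Rightarrow> 'i expo" where
  "lmon f = (SOME s. s \<in> msupp f \<and> (\<forall>t\<in>msupp f. mle s t))"

lemma lmon:
  assumes "f \<noteq> 0"
  shows "lmon f \<in> msupp f" "\<And>t. t \<in> msupp f \<Longrightarrow> mle (lmon f) t"
proof -
  have "\<exists>s. s \<in> msupp f \<and> (\<forall>t\<in>msupp f. mle s t)"
    using mle_finite_least[of "msupp f"] assms unfolding msupp_eq_empty_iff Bex_def by simp
  from someI_ex[OF this] show "lmon f \<in> msupp f" "\<And>t. t \<in> msupp f \<Longrightarrow> mle (lmon f) t"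
    unfolding lmon_def by blast+
qed

lemma lmon_eqI:
  assumes "s \<in> msupp f" "\<And>t. t \<in> msupp f \<Longrightarrow> mle s t"
  shows "lmon f = s"
proof -
  have "f \<noteq> 0" using assms(1) by auto
  then show ?thesis using lmon assms mle_antisym by blast
qed

lemma mcoeff_lmon_mult:
  assumes "f \<noteq> 0" "g \<noteq> 0"
  shows "mcoeff (f * g) (lmon f + lmon g) = mcoeff f (lmon f) * mcoeff g (lmon g)"
proof -
  have "mcoeff (f * g) (lmon f + lmon g) =
      (\<Sum>(s, t)\<in>msupp f \<times> msupp g. mcoeff f s * mcoeff g t * (if s + t = lmon f + lmon g then 1 else 0))"
    unfolding mcoeff_mult by (rule sum.cartesian_product)
  also have "\<dots> = (\<Sum>(s, t)\<in>{(lmon f, lmon g)}. mcoeff f s * mcoeff g t * (if s + t = lmon f + lmon g then 1 else 0))"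
  proof (rule sum.mono_neutral_right)
    show "\<forall>p\<in>msupp f \<times> msupp g - {(lmon f, lmon g)}.
        (case p of (s, t) \<Rightarrow> mcoeff f s * mcoeff g t * (if s + t = lmon f + lmon g then 1 else 0)) = 0"
    proof
      fix p assume p: "p \<in> msupp f \<times> msupp g - {(lmon f, lmon g)}"
      obtain s t where st: "p = (s, t)" by (cases p) 
      then have "s \<in> msupp f" "t \<in> msupp g" "\<not> (s = lmon f \<and> t = lmon g)" using p by auto
      then have "s + t \<noteq> lmon f + lmon g"
        using mle_add_eq[of "lmon f" s "lmon g" t] lmon(2)[OF assms(1)] lmon(2)[OF assms(2)] by blast
      then show "(case p of (s, t) \<Rightarrow> mcoeff f s * mcoeff g t * (if s + t = lmon f + lmon g then 1 else 0)) = 0"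
        by (simp add: st)
    qed
  qed (use lmon(1)[OF assms(1)] lmon(1)[OF assms(2)] in simp_all)
  finally show ?thesis by simp
qed

lemma lmon_mult:
  assumes "f \<noteq> 0" "g \<noteq> 0"
  shows "lmon (f * g) = lmon f + lmon g"
proof (rule lmon_eqI)
  have "mcoeff f (lmon f) \<noteq> 0" "mcoeff g (lmon g) \<noteq> 0"
    using lmon(1)[OF assms(1)] lmon(1)[OF assms(2)] by (simp_all add: msupp_def)
  then show "lmon f + lmon g \<in> msupp (f * g)"
    using mcoeff_lmon_mult[OF assms] by (simp add: msupp_def)
  fix r assume "r \<in> msupp (f * g)"
  then obtain s t where "r = s + t" "s \<in> msupp f" "t \<in> msupp g" using msupp_mult by blast
  then show "mle (lmon f + lmon g) r"
    using lmon(2)[OF assms(1)] lmon(2)[OF assms(2)] mle_add_left mle_add_right mle_trans by metis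
qed

lemma lmon_mon: "lmon (mon s) = s"
  by (rule lmon_eqI) (simp_all add: mle_refl)

definition nmult :: "nat \<Rightarrow> 'a::comm_monoid_add \<Rightarrow> 'a" where
  "nmult n s = ((+) s ^^ n) 0"

lemma nmult_0 [simp]: "nmult 0 s = 0"
  by (simp add: nmult_def)

lemma nmult_Suc [simp]: "nmult (Suc n) s = s + nmult n s"
  by (simp add: nmult_def)

lemma nmult_add: "nmult (a + b) s = nmult a s + nmult b s"
  by (induction a) (simp_all add: add.assoc)

lemma nmult_plus: "nmult n (s + t) = nmult n s + nmult n t"
  by (induction n) (simp_all add: ac_simps)

lemma snd_nmult: "snd (nmult n s) = n * snd s"
  by (induction n) simp_all

lemma lmon_power:
  assumes "f \<noteq> 0"
  shows "lmon (f ^ n) = nmult n (lmon f)"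
proof (induction n)
  case 0
  then show ?case using lmon_mon[of 0] by (simp add: mon_0)
next
  case (Suc n)
  then show ?case using assms by (simp add: lmon_mult)
qed

lemma snd_le_degree:
  assumes "s \<in> msupp f"
  shows "snd s \<le> degree f"
proof (rule le_degree)
  show "coeff f (snd s) \<noteq> 0" using assms by (auto simp: msupp_def mcoeff_def)
qed

lemma degree_mon: "degree (mon s :: ('i, 'k::field) polyz) = snd s"
proof -
  have "Poly_Mapping.single (fst s) 1 \<noteq> (0 :: ('i \<Rightarrow>\<^sub>0 nat) \<Rightarrow>\<^sub>0 'k)"
    by (metis lookup_single_eq lookup_zero zero_neq_one)
  then show ?thesis unfolding mon_def by (rule degree_monom_eq)
qed

lemma degree_kscale_le: "degree (kscale c f) \<le> degree f"
  unfolding kscale_def kconst_def by (simp add: degree_smult_le)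

lemma kmon_of_nat: "add_closed S \<Longrightarrow> of_nat n \<in> kmon S"
  by (induction n) (auto intro: kmon_add kmon_1)

text \<open>A fraction \<open>f / g\<close> that is almost integral over \<open>kmon S\<close> is expanded monomial by monomial:
  its lowest monomial lies in \<open>S\<close> and is split off. The \<open>z\<close>-degree bounds the number of steps.\<close>

lemma normal_kmon:
  fixes f g c :: "('i::linorder, 'k::field) polyz"
  assumes S: "add_closed S"
    and closed: "\<And>u s t. (\<And>n. \<exists>r\<in>S. u + nmult n s = nmult n t + r) \<Longrightarrow> \<exists>d\<in>S. s = t + d"
    and fin: "\<And>D. finite {s \<in> S. snd s \<le> D}"
    and g: "g \<noteq> 0" and c: "c \<noteq> 0"
    and f: "\<And>n. \<exists>r\<in>kmon S. c * f ^ n = g ^ n * r"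
  shows "\<exists>h\<in>kmon S. f = g * h"
proof -
  define D where "D = degree f"
  \<comment> \<open>The exponents that may still occur in \<open>f / g\<close>: of z-degree at most
    \<open>D\<close>, which is fixed by the initial \<open>f\<close>, and not below the current
    lowest one. Each step removes at least \<open>d\<close>, so the cardinality decreases.\<close>
  define N where "N f = {s \<in> S. snd s \<le> D \<and> mle (lmon f) (lmon g + s)}" for f :: "('i, 'k) polyz"
  have finN: "finite (N f)" for f by (rule finite_subset[OF _ fin[of D]]) (auto simp: N_def)
  have "degree f \<le> D + degree g" by (simp add: D_def)
  with f show ?thesis
  proof (induction "card (N f)" arbitrary: f rule: less_induct)
    case (less f)
    show ?case
    proof (cases "f = 0")
      case True
      then show ?thesis by (intro bexI[of _ 0]) simp_all
    next
      case False
      obtain r where r: "\<And>n. r n \<in> kmon S" "\<And>n. c * f ^ n = g ^ n * r n"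
        using less.prems(1) by metis
      have r0: "r n \<noteq> 0" for n
        using r(2)[of n] False c by (metis mult_zero_right no_zero_divisors power_not_zero)
      have eq: "lmon c + nmult n (lmon f) = nmult n (lmon g) + lmon (r n)" for n
        using arg_cong[OF r(2)[of n], of lmon] False g c r0 by (simp add: lmon_mult lmon_power)
      have rS: "lmon (r n) \<in> S" for n
        using lmon(1)[OF r0] r(1) unfolding kmon_iff by blast
      obtain d where d: "d \<in> S" "lmon f = lmon g + d"
        using closed[of "lmon c" "lmon f" "lmon g"] eq rS by blast
      have dD: "snd d \<le> D"
      proof (rule ccontr)
        assume "\<not> snd d \<le> D"
        \<comment> \<open>Comparing z-degrees gives \<open>n * snd d \<le> degree c + n * D\<close>;
          for \<open>snd d > D\<close> this means \<open>n \<le> degree c\<close>, so the first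
          larger \<open>n\<close> refutes it.\<close>
        define n where "n = Suc (degree c)"
        have "lmon (r n) = lmon c + nmult n d"
          using eq[of n] unfolding d(2) nmult_plus by (metis add.assoc add.commute add_left_cancel)
        then have "n * snd d \<le> snd (lmon (r n))" by (simp add: snd_nmult)
        also have "\<dots> \<le> degree (r n)" by (rule snd_le_degree[OF lmon(1)[OF r0]])
        finally have 1: "n * snd d \<le> degree (r n)" .
        have "degree c + n * degree f = n * degree g + degree (r n)"
          using arg_cong[OF r(2)[of n], of degree] False g c r0
          by (simp add: degree_mult_eq degree_power_eq mult.commute)
        moreover have "n * degree f \<le> n * D + n * degree g"
          using less.prems(2) by (metis add_mult_distrib2 mult_le_mono2)
        ultimately have "n * snd d \<le> degree c + n * D" using 1 by linarith
        moreover have "n * Suc D \<le> n * snd d" using \<open>\<not> snd d \<le> D\<close> by (intro mult_le_mono2) simp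
        ultimately show False by (simp add: n_def)
      qed
      \<comment> \<open>The ratio of the lowest coefficients, so that \<open>f - g * t\<close> loses
        the lowest monomial of \<open>f\<close>.\<close>
      define \<kappa> where "\<kappa> = mcoeff f (lmon f) / mcoeff g (lmon g)"
      define t where "t = kscale \<kappa> (mon d)"
      have t: "t \<in> kmon S" unfolding t_def using d(1) by (intro kmon_kscale) simp
      define f' where "f' = f - g * t"
      have gt: "g * t = kscale \<kappa> (mon d * g)"
        by (simp add: t_def kscale_def mult_ac)
      have cg: "mcoeff g (lmon g) \<noteq> 0" using lmon(1)[OF g] by (simp add: msupp_def)
      have f'_lmon: "mcoeff f' (lmon f) = 0"
        using mcoeff_mon_mult[of d g "lmon g"] cg by (simp add: f'_def gt d(2) \<kappa>_def add.commute)
      have f'_supp: "mle (lmon f) s" if "s \<in> msupp f'" for s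
      proof -
        have "s \<in> msupp f \<or> s \<in> msupp (mon d * g)"
          using that msupp_diff[of f "g * t"] msupp_kscale[of \<kappa> "mon d * g"] unfolding f'_def gt by blast
        then show ?thesis
        proof
          assume "s \<in> msupp (mon d * g)"
          then obtain s' where "s' \<in> msupp g" "s = d + s'" unfolding msupp_mon_mult by blast
          then show ?thesis using lmon(2)[OF g, of s'] mle_add_left[of "lmon g" s' d] by (simp add: d(2) add.commute)
        qed (rule lmon(2)[OF False])
      qed
      have "\<exists>h\<in>kmon S. f' = g * h"
      proof (cases "f' = 0")
        case True
        then show ?thesis by (intro bexI[of _ 0]) simp_all
      next
        case f'0: False
        have le: "mle (lmon f) (lmon f')" "lmon f' \<noteq> lmon f"
          using f'_supp lmon(1)[OF f'0] f'_lmon by (auto simp: msupp_def)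
        have "d \<in> N f - N f'"
          using d dD le mle_antisym[of "lmon f" "lmon f'"] mle_refl[of "lmon f"] by (auto simp: N_def)
        moreover have "N f' \<subseteq> N f" using mle_trans[OF le(1)] unfolding N_def by blast
        ultimately have "card (N f') < card (N f)" by (intro psubset_card_mono finN) blast
        moreover have "\<exists>r\<in>kmon S. c * f' ^ n = g ^ n * r" for n
        proof
          \<comment> \<open>Binomial expansion of \<open>(f - g * t) ^ n\<close>: each term takes
            its factor \<open>g ^ n\<close> partly from \<open>c * f ^ k\<close> and partly from the
            powers of \<open>g * t\<close>, so the same \<open>c\<close> works for
            \<open>f'\<close>.\<close>
          let ?r = "\<Sum>k\<le>n. of_nat (n choose k) * r k * (- t) ^ (n - k)"
          show "?r \<in> kmon S"
            using r(1) t by (intro kmon_sum kmon_mult kmon_power kmon_uminus kmon_of_nat S) auto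
          have "c * f' ^ n = c * (f + g * (- t)) ^ n" by (simp add: f'_def)
          also have "\<dots> = (\<Sum>k\<le>n. of_nat (n choose k) * (c * f ^ k) * (g * (- t)) ^ (n - k))"
            unfolding binomial_ring sum_distrib_left by (intro sum.cong) (simp_all only: mult_ac)
          also have "\<dots> = (\<Sum>k\<le>n. g ^ n * (of_nat (n choose k) * r k * (- t) ^ (n - k)))"
          proof (intro sum.cong refl)
            fix k assume "k \<in> {..n}"
            then have "g ^ n = g ^ k * g ^ (n - k)" by (simp flip: power_add)
            then show "of_nat (n choose k) * (c * f ^ k) * (g * (- t)) ^ (n - k) =
                g ^ n * (of_nat (n choose k) * r k * (- t) ^ (n - k))"
              unfolding r(2) power_mult_distrib by (simp only: mult_ac)
          qed
          finally show "c * f' ^ n = g ^ n * ?r" unfolding sum_distrib_left .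
        qed
        moreover have "degree f' \<le> D + degree g"
          unfolding f'_def
        proof (rule degree_diff_le[OF less.prems(2)])
          have "degree (g * t) \<le> degree g + degree t" by (rule degree_mult_le)
          also have "degree t \<le> snd d"
            unfolding t_def using degree_kscale_le[of \<kappa> "mon d"] degree_mon by metis
          finally show "degree (g * t) \<le> D + degree g" using dD by simp
        qed
        ultimately show ?thesis by (rule less.hyps)
      qed
      then obtain h where h: "h \<in> kmon S" "f' = g * h" by blast
      have "f = g * (h + t)" using h(2) by (simp add: f'_def ring_distribs diff_eq_eq)
      then show ?thesis using kmon_add[OF h(1) t] by blast
    qed
  qed
qed

section \<open>Exponents and lattice points\<close>

text \<open>A right inverse of \<open>exponent\<close>, total on exponents, so that identities of
  exponents can be checked on real vectors.\<close>

definition rvec :: "('i::finite \<Rightarrow>\<^sub>0 nat) \<Rightarrow> real ^ 'i" where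
  "rvec a = (\<chi> i. real (Poly_Mapping.lookup a i))"

lemma rvec_nth [simp]: "rvec a $ i = real (Poly_Mapping.lookup a i)"
  by (simp add: rvec_def)

lemma exponent_rvec [simp]: "exponent (rvec a) = a"
  by (rule poly_mapping_eqI) (simp add: lookup_exponent)

lemma rvec_natural [simp]: "rvec a \<in> natural_vectors"
  by (simp add: natural_vectors_def)

lemma rvec_exponent [simp]: "x \<in> natural_vectors \<Longrightarrow> rvec (exponent x) = x"
  unfolding Finite_Cartesian_Product.vec_eq_iff
proof
  fix i assume "x \<in> natural_vectors"
  then have "x $ i \<in> \<nat>" by (simp add: natural_vectors_def)
  then show "rvec (exponent x) $ i = x $ i" by (auto simp: lookup_exponent elim: Nats_cases)
qed

lemma rvec_add: "rvec (a + b) = rvec a + rvec b"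
  by (simp add: Finite_Cartesian_Product.vec_eq_iff lookup_add)

lemma rvec_0 [simp]: "rvec 0 = 0"
  by (simp add: Finite_Cartesian_Product.vec_eq_iff)

lemma rvec_eq_iff [simp]: "rvec a = rvec b \<longleftrightarrow> a = b"
  by (metis exponent_rvec)

lemma rvec_sum: "rvec (sum f X) = (\<Sum>x\<in>X. rvec (f x))"
  by (induction X rule: infinite_finite_induct) (simp_all add: rvec_add)

lemma fst_nmult: "fst (nmult n s) = nmult n (fst s)"
  by (induction n) simp_all

lemma rvec_nmult: "rvec (nmult n a) = real n *\<^sub>R rvec a"
  by (induction n) (simp_all add: rvec_add scaleR_left_distrib)

lemma exponent_eqI: "x = rvec a \<Longrightarrow> exponent x = a"
  by simp

lemma exponent_inj: "x \<in> natural_vectors \<Longrightarrow> y \<in> natural_vectors \<Longrightarrow> exponent x = exponent y \<Longrightarrow> x = y"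
  by (metis rvec_exponent)

lemma expo_eqI: "rvec (fst s) = rvec (fst t) \<Longrightarrow> snd s = snd t \<Longrightarrow> s = t"
  by (simp add: prod_eq_iff)

lemma natural_vectors_iff: "x \<in> natural_vectors \<longleftrightarrow> (\<forall>j. x $ j \<in> \<int> \<and> x $ j \<ge> 0)"
  unfolding natural_vectors_def by (auto simp: Nats_altdef2)

lemma finite_bounded_natural_vectors:
  assumes "bounded X" "X \<subseteq> natural_vectors"
  shows "finite (X :: (real ^ 'i::finite) set)"
proof -
  obtain B where B: "\<And>x. x \<in> X \<Longrightarrow> norm x \<le> B" using assms(1) unfolding bounded_iff by blast
  have "X \<subseteq> (\<lambda>f. \<chi> j. real (f j)) ` (UNIV \<rightarrow>\<^sub>E {..nat \<lceil>B\<rceil>})"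
  proof
    fix x assume x: "x \<in> X"
    have "nat \<lfloor>x $ j\<rfloor> \<le> nat \<lceil>B\<rceil>" for j
    proof -
      have "x $ j \<le> B" using B[OF x] component_le_norm_cart[of x j] by linarith
      then show ?thesis by (intro nat_mono) linarith
    qed
    moreover have "x = (\<chi> j. real (nat \<lfloor>x $ j\<rfloor>))"
      using rvec_exponent[of x] x assms(2) unfolding rvec_def lookup_exponent by auto
    ultimately show "x \<in> (\<lambda>f. \<chi> j. real (f j)) ` (UNIV \<rightarrow>\<^sub>E {..nat \<lceil>B\<rceil>})"
      by (intro image_eqI[of _ _ "\<lambda>j. nat \<lfloor>x $ j\<rfloor>"]) auto
  qed
  then show ?thesis by (rule finite_subset) (intro finite_imageI finite_PiE; simp)
qed

lemma monoid_gen_image: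
  assumes "finite I"
  shows "x \<in> monoid_gen (u ` I) \<longleftrightarrow> (\<exists>k. x = (\<Sum>i\<in>I. nmult (k i) (u i)))"
proof
  assume "x \<in> monoid_gen (u ` I)"
  then show "\<exists>k. x = (\<Sum>i\<in>I. nmult (k i) (u i))"
  proof induction
    case zero
    show ?case by (intro exI[of _ "\<lambda>_. 0"]) simp
  next
    case (add s t)
    then obtain i k where i: "i \<in> I" "s = u i" and k: "t = (\<Sum>i\<in>I. nmult (k i) (u i))" by blast
    have "(\<Sum>j\<in>I. nmult ((if j = i then 1 else 0) + k j) (u j)) = (\<Sum>j\<in>I. nmult (if j = i then 1 else 0) (u j)) + t"
      unfolding nmult_add sum.distrib k ..
    also have "(\<Sum>j\<in>I. nmult (if j = i then 1 else 0) (u j)) = s"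
      using i assms by (subst sum.remove[of _ i]) auto
    finally show ?case by (intro exI[of _ "\<lambda>j. (if j = i then 1 else 0) + k j"]) simp
  qed
next
  assume "\<exists>k. x = (\<Sum>i\<in>I. nmult (k i) (u i))"
  then obtain k where k: "x = (\<Sum>i\<in>I. nmult (k i) (u i))" by blast
  have 1: "nmult n (u i) \<in> monoid_gen (u ` I)" if "i \<in> I" for n i
    using that by (induction n) (auto intro: monoid_gen.intros)
  have "(\<Sum>i\<in>J. nmult (k i) (u i)) \<in> monoid_gen (u ` I)" if "J \<subseteq> I" "finite J" for J
    using that(2,1) by (induction J) (auto intro: monoid_gen.zero monoid_gen_plus 1)
  then show "x \<in> monoid_gen (u ` I)" using k assms by blast
qed

text \<open>Weights are attached to indices, since the points \<open>v i\<close> may repeat; scaling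
  by \<open>n\<close> makes their sum \<open>n\<close>. For \<open>n = 0\<close> all weights vanish,
  and \<open>m \<ge> 1\<close> ensures that the dilation is \<open>{0}\<close> and not
  empty.\<close>

lemma dilation_convex_hull:
  fixes m :: nat and v :: "nat \<Rightarrow> real ^ 'n"
  assumes "m \<ge> 1"
  shows "x \<in> dilation n (convex hull (v ` {1..m})) \<longleftrightarrow>
    (\<exists>c. (\<forall>i\<in>{1..m}. c i \<ge> 0) \<and> sum c {1..m} = real n \<and> x = (\<Sum>i\<in>{1..m}. c i *\<^sub>R v i))"
proof -
  define T where "T = {x. \<exists>c. (\<forall>i\<in>{1..m}. c i \<ge> 0) \<and> sum c {1..m} = 1 \<and> x = (\<Sum>i\<in>{1..m}. c i *\<^sub>R v i)}"
  have "convex hull (v ` {1..m}) \<subseteq> T"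
  proof (rule hull_minimal)
    show "v ` {1..m} \<subseteq> T"
    proof
      fix y assume "y \<in> v ` {1..m}"
      then obtain j where j: "j \<in> {1..m}" "y = v j" by blast
      show "y \<in> T" unfolding T_def
      proof (intro CollectI exI conjI)
        show "(\<Sum>i\<in>{1..m}. if i = j then 1 else 0 :: real) = 1" using j by simp
        have "(\<Sum>i\<in>{1..m}. (if i = j then 1 else 0 :: real) *\<^sub>R v i) = (\<Sum>i\<in>{1..m}. if i = j then v i else 0)"
          by (intro sum.cong) auto
        then show "y = (\<Sum>i\<in>{1..m}. (if i = j then 1 else 0 :: real) *\<^sub>R v i)" using j by simp
      qed auto
    qed
    show "convex T"
    proof (rule convexI)
      fix x y and a b :: real assume xy: "x \<in> T" "y \<in> T" and ab: "0 \<le> a" "0 \<le> b" "a + b = 1"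
      obtain c where c: "\<forall>i\<in>{1..m}. c i \<ge> 0" "sum c {1..m} = 1" "x = (\<Sum>i\<in>{1..m}. c i *\<^sub>R v i)"
        using xy(1) unfolding T_def by blast
      obtain d where d: "\<forall>i\<in>{1..m}. d i \<ge> 0" "sum d {1..m} = 1" "y = (\<Sum>i\<in>{1..m}. d i *\<^sub>R v i)"
        using xy(2) unfolding T_def by blast
      show "a *\<^sub>R x + b *\<^sub>R y \<in> T" unfolding T_def
      proof (intro CollectI exI conjI)
        show "\<forall>i\<in>{1..m}. 0 \<le> a * c i + b * d i" using c(1) d(1) ab by simp
        show "(\<Sum>i\<in>{1..m}. a * c i + b * d i) = 1"
          using c(2) d(2) ab by (simp add: sum.distrib flip: sum_distrib_left)
        show "a *\<^sub>R x + b *\<^sub>R y = (\<Sum>i\<in>{1..m}. (a * c i + b * d i) *\<^sub>R v i)"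
          unfolding c(3) d(3) by (simp add: scaleR_left_distrib sum.distrib scaleR_sum_right)
      qed
    qed
  qed
  moreover have "T \<subseteq> convex hull (v ` {1..m})"
    unfolding T_def by (auto intro!: convex_sum[OF _ convex_convex_hull] intro: hull_inc)
  ultimately have hull: "convex hull (v ` {1..m}) = T" by blast
  show ?thesis
  proof
    assume "x \<in> dilation n (convex hull (v ` {1..m}))"
    then obtain c where c: "\<forall>i\<in>{1..m}. c i \<ge> 0" "sum c {1..m} = 1" "x = real n *\<^sub>R (\<Sum>i\<in>{1..m}. c i *\<^sub>R v i)"
      unfolding hull dilation_def T_def by blast
    then show "\<exists>c. (\<forall>i\<in>{1..m}. c i \<ge> 0) \<and> sum c {1..m} = real n \<and> x = (\<Sum>i\<in>{1..m}. c i *\<^sub>R v i)"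
      by (intro exI[of _ "\<lambda>i. real n * c i"]) (auto simp: scaleR_sum_right simp flip: sum_distrib_left)
  next
    assume "\<exists>c. (\<forall>i\<in>{1..m}. c i \<ge> 0) \<and> sum c {1..m} = real n \<and> x = (\<Sum>i\<in>{1..m}. c i *\<^sub>R v i)"
    then obtain c where c: "\<forall>i\<in>{1..m}. c i \<ge> 0" "sum c {1..m} = real n" "x = (\<Sum>i\<in>{1..m}. c i *\<^sub>R v i)" by blast
    show "x \<in> dilation n (convex hull (v ` {1..m}))"
    proof (cases "n = 0")
      case True
      then have "c i = 0" if "i \<in> {1..m}" for i
        using c(1,2) sum_nonneg_eq_0_iff[of "{1..m}" c] that by auto
      then have "x = 0" using c(3) by simp
      moreover have "v 1 \<in> convex hull (v ` {1..m})" using assms by (intro hull_inc) auto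
      ultimately show ?thesis using True unfolding dilation_def by auto
    next
      case False
      have "(\<Sum>i\<in>{1..m}. (c i / real n) *\<^sub>R v i) \<in> T"
        unfolding T_def using c False by (intro CollectI exI[of _ "\<lambda>i. c i / real n"]) (auto simp flip: sum_divide_distrib)
      moreover have "x = real n *\<^sub>R (\<Sum>i\<in>{1..m}. (c i / real n) *\<^sub>R v i)"
        using False unfolding c(3) by (simp add: scaleR_sum_right)
      ultimately show ?thesis unfolding hull dilation_def by blast
    qed
  qed
qed

lemma bounded_dilation: "bounded X \<Longrightarrow> bounded (dilation n X)"
  unfolding dilation_def by (rule bounded_scaling)

section \<open>The monoid of a weighted polytope\<close>

text \<open>Used in three ways: with the given map for \<open>A^w(P)\<close>, with the identity on
  the \<open>v i\<close> for \<open>A(P)\<close>, and with the identity on the points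
  \<open>W (v i)\<close> for \<open>A(w(P))\<close>.\<close>

locale weighted_polytope =
  fixes v :: "nat \<Rightarrow> real ^ 's" and m :: nat and W :: "real ^ 's \<Rightarrow> real ^ 'p"
  assumes m: "m \<ge> 1"
    and v: "i \<in> {1..m} \<Longrightarrow> v i \<in> natural_vectors"
    and W: "linear W"
    and W_natural: "x \<in> natural_vectors \<Longrightarrow> W x \<in> natural_vectors"
begin

definition P :: "(real ^ 's) set" where "P = convex hull (v ` {1..m})"

definition S :: "'p expo set" where
  "S = {(exponent (W a), n) | a n. a \<in> lattice_points (dilation n P)}"

definition u :: "nat \<Rightarrow> 'p expo" where "u i = (exponent (W (v i)), 1)"

definition G :: "'p expo set" where "G = monoid_gen (u ` {1..m})"

text \<open>The bound \<open>m\<close> is the number of points: after rounding down, the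
  \<open>m\<close> remaining weights are at most 1 each.\<close>

definition T0 :: "'p expo set" where
  "T0 = {(exponent (W a), n) | a n. n \<le> m \<and> a \<in> lattice_points (dilation n P)}"

lemma dilation_P: "x \<in> dilation n P \<longleftrightarrow>
    (\<exists>c. (\<forall>i\<in>{1..m}. c i \<ge> 0) \<and> sum c {1..m} = real n \<and> x = (\<Sum>i\<in>{1..m}. c i *\<^sub>R v i))"
  unfolding P_def by (rule dilation_convex_hull[OF m])

lemma bounded_P: "bounded P"
  unfolding P_def by (intro bounded_convex_hull finite_imp_bounded) simp

lemma lattice_points_natural: "lattice_points (dilation n P) \<subseteq> natural_vectors"
proof
  fix x assume x: "x \<in> lattice_points (dilation n P)"
  then obtain c where c: "\<And>i. i \<in> {1..m} \<Longrightarrow> c i \<ge> 0" "x = (\<Sum>i\<in>{1..m}. c i *\<^sub>R v i)"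
    unfolding lattice_points_def dilation_P by blast
  have "x $ j \<ge> 0" for j
    unfolding c(2) sum_component using c(1) v by (intro sum_nonneg) (auto simp: natural_vectors_iff)
  then show "x \<in> natural_vectors" using x by (simp add: natural_vectors_iff lattice_points_def)
qed

lemma finite_lattice_points: "finite (lattice_points (dilation n P))"
  by (intro finite_bounded_natural_vectors lattice_points_natural)
    (rule bounded_subset[OF bounded_dilation[OF bounded_P, of n]], auto simp: lattice_points_def)

lemma u_in_S: "i \<in> {1..m} \<Longrightarrow> u i \<in> S"
  unfolding S_def u_def lattice_points_def dilation_def P_def
  using v[of i] by (auto simp: natural_vectors_iff intro!: hull_inc exI[of _ "v i"] image_eqI[of _ _ "v i"])

lemma exponent_W_add:
  "a \<in> natural_vectors \<Longrightarrow> b \<in> natural_vectors \<Longrightarrow> exponent (W (a + b)) = exponent (W a) + exponent (W b)"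
  by (rule exponent_eqI) (simp add: rvec_add W_natural linear_add[OF W])

lemma lattice_points_add:
  assumes "a \<in> lattice_points (dilation n P)" "b \<in> lattice_points (dilation k P)"
  shows "a + b \<in> lattice_points (dilation (n + k) P)"
proof -
  obtain c where c: "\<forall>i\<in>{1..m}. c i \<ge> 0" "sum c {1..m} = real n" "a = (\<Sum>i\<in>{1..m}. c i *\<^sub>R v i)"
    using assms(1) unfolding lattice_points_def dilation_P by blast
  obtain d where d: "\<forall>i\<in>{1..m}. d i \<ge> 0" "sum d {1..m} = real k" "b = (\<Sum>i\<in>{1..m}. d i *\<^sub>R v i)"
    using assms(2) unfolding lattice_points_def dilation_P by blast
  have "a + b \<in> dilation (n + k) P"
    unfolding dilation_P using c d
    by (intro exI[of _ "\<lambda>i. c i + d i"]) (simp add: sum.distrib scaleR_left_distrib)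
  then show ?thesis using assms by (simp add: lattice_points_def)
qed

lemma add_closed_S: "add_closed S"
  unfolding add_closed_def
proof (intro conjI ballI)
  have "0 \<in> dilation 0 P" unfolding dilation_P by (intro exI[of _ "\<lambda>_. 0"]) simp
  then have "0 \<in> lattice_points (dilation 0 P)" by (simp add: lattice_points_def)
  moreover have "exponent (W 0) = 0" using exponent_rvec[of 0] by (simp add: linear_0[OF W])
  ultimately show "0 \<in> S" unfolding S_def zero_prod_def by (auto intro!: exI[of _ 0])
  fix s t assume "s \<in> S" "t \<in> S"
  then obtain a n b k where s: "s = (exponent (W a), n)" "a \<in> lattice_points (dilation n P)"
    and t: "t = (exponent (W b), k)" "b \<in> lattice_points (dilation k P)" unfolding S_def by blast
  then have "s + t = (exponent (W (a + b)), n + k)"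
    using exponent_W_add[of a b] lattice_points_natural by (simp add: subset_iff)
  then show "s + t \<in> S" using lattice_points_add[OF s(2) t(2)] unfolding S_def by blast
qed

lemma G_subset_S: "G \<subseteq> S"
  unfolding G_def by (intro monoid_gen_minimal[OF add_closed_S] image_subsetI u_in_S)

lemma T0_subset_S: "T0 \<subseteq> S"
  unfolding T0_def S_def by blast

lemma u_in_T0:
  assumes "i \<in> {1..m}"
  shows "u i \<in> T0"
proof -
  have "v i \<in> convex hull (v ` {1..m})" using assms by (intro hull_inc) auto
  then have "v i \<in> lattice_points (dilation 1 P)"
    using v[OF assms] by (auto simp: lattice_points_def dilation_def P_def natural_vectors_iff)
  then show ?thesis unfolding T0_def u_def using m by blast
qed

lemma finite_T0: "finite T0"
proof -
  have "T0 = (\<Union>n\<le>m. (\<lambda>a. (exponent (W a), n)) ` lattice_points (dilation n P))"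
    unfolding T0_def by auto
  then show ?thesis using finite_lattice_points by simp
qed

text \<open>Subtracting the rounded-down weights removes an integral combination of the integral
  points \<open>v i\<close>, so the remainder is a lattice point again, of a degree that is a
  natural number at most \<open>m\<close>.\<close>

lemma lattice_point_decomposition:
  assumes a: "a \<in> lattice_points (dilation n P)"
  obtains a' n' k where "n' \<le> m" "a' \<in> lattice_points (dilation n' P)"
    "a = a' + (\<Sum>i\<in>{1..m}. real (k i) *\<^sub>R v i)" "n = n' + sum k {1..m}"
proof -
  obtain c where c: "\<And>i. i \<in> {1..m} \<Longrightarrow> c i \<ge> 0" "sum c {1..m} = real n" "a = (\<Sum>i\<in>{1..m}. c i *\<^sub>R v i)"
    using a unfolding lattice_points_def dilation_P by blast
  define k where "k i = nat \<lfloor>c i\<rfloor>" for i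
  have k: "real (k i) \<le> c i" "c i \<le> real (k i) + 1" if "i \<in> {1..m}" for i
    using c(1)[OF that] unfolding k_def by linarith+
  define a' where "a' = (\<Sum>i\<in>{1..m}. (c i - real (k i)) *\<^sub>R v i)"
  have "real (sum k {1..m}) \<le> real n"
    unfolding c(2)[symmetric] of_nat_sum using k by (intro sum_mono) auto
  then have le: "sum k {1..m} \<le> n" by linarith
  define n' where "n' = n - sum k {1..m}"
  have sum: "(\<Sum>i\<in>{1..m}. c i - real (k i)) = real n'"
    using le c(2) by (simp add: n'_def sum_subtractf of_nat_diff)
  show thesis
  proof
    have "real n' \<le> (\<Sum>i\<in>{1..m}. 1)"
      unfolding sum[symmetric] using k by (intro sum_mono) (auto simp: algebra_simps)
    then show "n' \<le> m" by simp
    show a_eq: "a = a' + (\<Sum>i\<in>{1..m}. real (k i) *\<^sub>R v i)"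
      unfolding a'_def c(3) by (simp add: scaleR_left_diff_distrib sum_subtractf)
    show "n = n' + sum k {1..m}" using le by (simp add: n'_def)
    have "a' \<in> dilation n' P"
      unfolding dilation_P using k sum by (intro exI[of _ "\<lambda>i. c i - real (k i)"]) (auto simp: a'_def)
    moreover have "a' $ j \<in> \<int>" for j
    proof -
      have "a' $ j = a $ j - (\<Sum>i\<in>{1..m}. real (k i) * v i $ j)" unfolding a_eq by simp
      moreover have "a $ j \<in> \<int>" using a by (simp add: lattice_points_def)
      moreover have "(\<Sum>i\<in>{1..m}. real (k i) * v i $ j) \<in> \<int>"
        using v by (intro Ints_sum Ints_mult) (auto simp: natural_vectors_iff)
      ultimately show ?thesis by simp
    qed
    ultimately show "a' \<in> lattice_points (dilation n' P)" by (simp add: lattice_points_def)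
  qed
qed

lemma snd_sum_u: "snd (\<Sum>i\<in>I. nmult (k i) (u i)) = sum k I"
  by (induction I rule: infinite_finite_induct) (simp_all add: snd_nmult u_def)

lemma rvec_fst_sum_u:
  "I \<subseteq> {1..m} \<Longrightarrow> rvec (fst (\<Sum>i\<in>I. nmult (k i) (u i))) = (\<Sum>i\<in>I. real (k i) *\<^sub>R W (v i))"
  by (induction I rule: infinite_finite_induct)
    (simp_all add: rvec_add fst_nmult rvec_nmult u_def W_natural v)

lemma S_decomposition:
  assumes "a \<in> lattice_points (dilation n P)"
  obtains a' n' k where "n' \<le> m" "a' \<in> lattice_points (dilation n' P)"
    "(exponent (W a), n) = (exponent (W a'), n') + (\<Sum>i\<in>{1..m}. nmult (k i) (u i))"
proof -
  obtain a' n' k where *: "n' \<le> m" "a' \<in> lattice_points (dilation n' P)"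
    "a = a' + (\<Sum>i\<in>{1..m}. real (k i) *\<^sub>R v i)" "n = n' + sum k {1..m}"
    by (rule lattice_point_decomposition[OF assms])
  have nat: "a \<in> natural_vectors" "a' \<in> natural_vectors" using assms *(2) lattice_points_natural by auto
  have W_eq: "W a = W a' + (\<Sum>i\<in>{1..m}. real (k i) *\<^sub>R W (v i))"
    unfolding *(3) by (simp add: linear_add[OF W] linear_sum[OF W] linear_scale[OF W])
  show thesis
  proof (rule that[OF *(1,2)], rule expo_eqI)
    show "rvec (fst (exponent (W a), n)) = rvec (fst ((exponent (W a'), n') + (\<Sum>i\<in>{1..m}. nmult (k i) (u i))))"
      using W_eq nat rvec_fst_sum_u[of "{1..m}" k] W_natural[of a] by (simp add: rvec_add W_natural)
  qed (use *(4) snd_sum_u[of k "{1..m}"] in simp)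
qed

lemma S_eq: "S = {f + g | f g. f \<in> T0 \<and> g \<in> G}"
proof
  show "{f + g | f g. f \<in> T0 \<and> g \<in> G} \<subseteq> S"
    using T0_subset_S G_subset_S add_closedD[OF add_closed_S] by blast
  show "S \<subseteq> {f + g | f g. f \<in> T0 \<and> g \<in> G}"
  proof
    fix s assume "s \<in> S"
    then obtain a n where s: "s = (exponent (W a), n)" "a \<in> lattice_points (dilation n P)"
      unfolding S_def by blast
    obtain a' n' k where *: "n' \<le> m" "a' \<in> lattice_points (dilation n' P)"
      "(exponent (W a), n) = (exponent (W a'), n') + (\<Sum>i\<in>{1..m}. nmult (k i) (u i))"
      by (rule S_decomposition[OF s(2)])
    have "(exponent (W a'), n') \<in> T0" using * unfolding T0_def by blast
    moreover have "(\<Sum>i\<in>{1..m}. nmult (k i) (u i)) \<in> G"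
      unfolding G_def by (subst monoid_gen_image) auto
    ultimately show "s \<in> {f + g | f g. f \<in> T0 \<and> g \<in> G}" using *(3) s(1) by blast
  qed
qed

text \<open>The pairs \<open>(a, n)\<close> behind \<open>T0\<close> depend on the polytope only and
  not on \<open>W\<close>. That is why one list of generators serves both rings in (c).\<close>

lemma monoid_gen_T0: "monoid_gen T0 = S"
proof
  show "monoid_gen T0 \<subseteq> S" by (rule monoid_gen_minimal[OF add_closed_S T0_subset_S])
  have "G \<subseteq> monoid_gen T0"
    unfolding G_def by (intro monoid_gen_minimal[OF add_closed_monoid_gen] image_subsetI monoid_gen_base u_in_T0)
  then show "S \<subseteq> monoid_gen T0"
    unfolding S_eq using monoid_gen_base[of _ T0] monoid_gen_plus[of _ T0] by blast
qed

lemma S_slice: "{s \<in> S. snd s = n} = (\<lambda>a. (exponent (W a), n)) ` lattice_points (dilation n P)"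
  unfolding S_def by auto

lemma finite_S_slice: "finite {s \<in> S. snd s = n}"
  unfolding S_slice using finite_lattice_points by simp

lemma finite_S_le: "finite {s \<in> S. snd s \<le> D}"
proof -
  have "{s \<in> S. snd s \<le> D} = (\<Union>n\<le>D. {s \<in> S. snd s = n})" by auto
  then show ?thesis using finite_S_slice by simp
qed

lemma card_S_slice: "card {s \<in> S. snd s = n} = card (W ` lattice_points (dilation n P))"
proof -
  have "{s \<in> S. snd s = n} = (\<lambda>b. (exponent b, n)) ` W ` lattice_points (dilation n P)"
    unfolding S_slice by auto
  moreover have "inj_on (\<lambda>b. (exponent b, n)) (W ` lattice_points (dilation n P))"
    using lattice_points_natural by (intro inj_onI) (auto intro: exponent_inj W_natural)
  ultimately show ?thesis by (simp add: card_image)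
qed

lemma finite_extension_kmon: "finite_extension (kmon G) (kmon S :: ('p, 'k::field) polyz set)"
  unfolding finite_extension_def
proof (intro conjI exI[of _ "mon ` T0"] ballI)
  show "kmon G \<subseteq> kmon S" by (rule kmon_mono[OF G_subset_S])
  show "finite (mon ` T0)" using finite_T0 by simp
  show "mon ` T0 \<subseteq> kmon S" using T0_subset_S by auto
  fix x :: "('p, 'k) polyz" assume x: "x \<in> kmon S"
  have "\<forall>s\<in>S. \<exists>p. s = fst p + snd p \<and> fst p \<in> T0 \<and> snd p \<in> G"
  proof
    fix s assume "s \<in> S"
    then obtain f g where "s = f + g" "f \<in> T0" "g \<in> G" unfolding S_eq by blast
    then show "\<exists>p. s = fst p + snd p \<and> fst p \<in> T0 \<and> snd p \<in> G" by (intro exI[of _ "(f, g)"]) simp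
  qed
  from bchoice[OF this] obtain p where p: "\<forall>s\<in>S. s = fst (p s) + snd (p s) \<and> fst (p s) \<in> T0 \<and> snd (p s) \<in> G" ..
  define f where "f s = fst (p s)" for s
  define g where "g s = snd (p s)" for s
  have fg: "s = f s + g s" "f s \<in> T0" "g s \<in> G" if "s \<in> S" for s
    using bspec[OF p that] unfolding f_def g_def by blast+
  \<comment> \<open>With a decomposition \<open>s = f s + g s\<close> fixed for each exponent, the
    coefficient of a generator collects the exponents whose first part is that generator.\<close>
  define c where "c h = (\<Sum>s | s \<in> msupp x \<and> mon (f s) = h. kscale (mcoeff x s) (mon (g s)))" for h :: "('p, 'k) polyz"
  have xS: "msupp x \<subseteq> S" using x by (simp add: kmon_iff)
  show "\<exists>c. (\<forall>h\<in>mon ` T0. c h \<in> kmon G) \<and> x = (\<Sum>h\<in>mon ` T0. c h * h)"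
  proof (intro exI[of _ c] conjI ballI)
    show "c h \<in> kmon G" for h
      unfolding c_def using xS fg(3) by (intro kmon_sum kmon_kscale) auto
    have "(\<Sum>h\<in>mon ` T0. c h * h) = (\<Sum>h\<in>(mon ` T0 :: ('p, 'k) polyz set). \<Sum>s | s \<in> msupp x \<and> mon (f s) = h. kscale (mcoeff x s) (mon s))"
    proof (intro sum.cong refl)
      fix h :: "('p, 'k) polyz"
      show "c h * h = (\<Sum>s | s \<in> msupp x \<and> mon (f s) = h. kscale (mcoeff x s) (mon s))"
        unfolding c_def sum_distrib_right
      proof (intro sum.cong refl)
        fix s assume s: "s \<in> {s. s \<in> msupp x \<and> mon (f s) = h}"
        then have "mon (g s) * h = mon s" using fg(1)[of s] xS by (auto simp: mon_mult add.commute)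
        then show "kscale (mcoeff x s) (mon (g s)) * h = kscale (mcoeff x s) (mon s)"
          by (simp add: kscale_mult_left)
      qed
    qed
    also have "\<dots> = (\<Sum>s\<in>msupp x. kscale (mcoeff x s) (mon s))"
      using xS fg(2) finite_T0 by (intro sum.group) auto
    also have "\<dots> = x" by (rule polyz_expand[symmetric])
    finally show "x = (\<Sum>h\<in>mon ` T0. c h * h)" by simp
  qed
qed

text \<open>As a finite union of translates of \<open>G\<close>, the set \<open>S\<close> is the
  image of finitely many copies of N^m, under maps that respect translations and degrees.\<close>

lemma hilbert_series_polynomial:
  "\<exists>h :: int poly. Abs_fps (\<lambda>n. of_nat (card {s \<in> S. snd s = n})) * (1 - fps_X) ^ m = fps_of_poly h"
proof -
  obtain fs where fs: "set fs = T0" "distinct fs" using finite_distinct_list[OF finite_T0] by blast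
  define q where "q = length fs"
  define e where "e j xs = fs ! j + (\<Sum>i<m. nmult (xs ! i) (u (Suc i)))" for j xs
  have sum_shift: "(\<Sum>i\<in>{1..m}. nmult (k i) (u i)) = (\<Sum>i<m. nmult (k (Suc i)) (u (Suc i)))" for k
    by (rule sum.reindex_bij_witness[of _ Suc "\<lambda>i. i - 1"]) auto
  show ?thesis
  proof (rule hilbert_series_fg_module[where e = e and q = q and d = "\<lambda>j. snd (fs ! j)"])
    show "S = (\<Union>j<q. e j ` {xs. length xs = m})"
    proof
      show "(\<Union>j<q. e j ` {xs. length xs = m}) \<subseteq> S"
      proof
        fix s assume "s \<in> (\<Union>j<q. e j ` {xs. length xs = m})"
        then obtain j xs where j: "j < q" "s = e j xs" by blast
        have "(\<Sum>i\<in>{1..m}. nmult (xs ! (i - 1)) (u i)) \<in> G"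
          unfolding G_def by (subst monoid_gen_image) auto
        then have "(\<Sum>i<m. nmult (xs ! i) (u (Suc i))) \<in> G" unfolding sum_shift by simp
        moreover have "fs ! j \<in> T0" using nth_mem[of j fs] j(1) unfolding fs(1) q_def by blast
        ultimately show "s \<in> S" unfolding S_eq j(2) e_def by blast
      qed
      show "S \<subseteq> (\<Union>j<q. e j ` {xs. length xs = m})"
      proof
        fix s assume "s \<in> S"
        then obtain f g where s: "s = f + g" "f \<in> T0" "g \<in> G" unfolding S_eq by blast
        obtain j where j: "j < q" "f = fs ! j" using s(2) fs(1) unfolding q_def by (metis in_set_conv_nth)
        obtain k where "g = (\<Sum>i\<in>{1..m}. nmult (k i) (u i))"
          using s(3) unfolding G_def by (subst (asm) monoid_gen_image) auto
        then have "s = e j (map (\<lambda>i. k (Suc i)) [0..<m])"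
          unfolding s(1) j(2) e_def sum_shift by simp
        then show "s \<in> (\<Union>j<q. e j ` {xs. length xs = m})"
          using j(1) by (intro UN_I[of j] image_eqI[of _ _ "map (\<lambda>i. k (Suc i)) [0..<m]"]) auto
      qed
    qed
    show "e i (map2 (+) xs zs) = e j (map2 (+) ys zs)"
      if "length xs = m" "length ys = m" "length zs = m" "e i xs = e j ys" for i j xs ys zs
    proof -
      have "e i (map2 (+) xs zs) = e i xs + (\<Sum>l<m. nmult (zs ! l) (u (Suc l)))" if "length xs = m" for i xs
        using that \<open>length zs = m\<close> by (simp add: e_def nmult_add sum.distrib add.assoc)
      then show ?thesis using that by simp
    qed
    show "snd (e j xs) = snd (fs ! j) + sum_list xs" if "length xs = m" for j xs
    proof -
      have "snd (\<Sum>i<m. nmult (xs ! i) (u (Suc i))) = (\<Sum>i<m. xs ! i)"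
        using snd_sum_u[of "\<lambda>i. xs ! (i - 1)" "{1..m}"] unfolding sum_shift
        by (simp add: sum.shift_bounds_cl_Suc_ivl[symmetric] sum.atLeast1_atMost_eq)
      then show ?thesis using that by (simp add: e_def sum_list_sum_nth lessThan_atLeast0)
    qed
  qed
qed

end

section \<open>Growth of the Hilbert function\<close>

text \<open>Take a determining set of coordinates of least size. Dropping \<open>j\<close> from it
  destroys the property, which yields a vector of \<open>V\<close> that vanishes on \<open>J\<close>
  except at \<open>j\<close>; these vectors are independent.\<close>

lemma coordinates_determine_subspace:
  fixes V :: "(real ^ 'n) set"
  assumes "Real_Vector_Spaces.subspace V"
  shows "\<exists>J. card J \<le> dim V \<and> (\<forall>x\<in>V. (\<forall>j\<in>J. x $ j = 0) \<longrightarrow> x = 0)"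
proof -
  define good where "good J \<longleftrightarrow> (\<forall>x\<in>V. (\<forall>j\<in>J. x $ j = 0) \<longrightarrow> x = 0)" for J
  have "good UNIV" by (simp add: good_def Finite_Cartesian_Product.vec_eq_iff)
  then obtain J where J: "good J" "\<And>J'. good J' \<Longrightarrow> card J \<le> card J'"
    using ex_has_least_nat[of good UNIV card] by blast
  have "\<forall>j\<in>J. \<exists>x. x \<in> V \<and> (\<forall>i\<in>J - {j}. x $ i = 0) \<and> x $ j \<noteq> 0"
  proof
    fix j assume j: "j \<in> J"
    have "card (J - {j}) < card J" using j by (intro card_Diff1_less) auto
    then have "\<not> good (J - {j})" using J(2) not_le by blast
    then obtain x where x: "x \<in> V" "\<forall>i\<in>J - {j}. x $ i = 0" "x \<noteq> 0" unfolding good_def by blast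
    then have "x $ j \<noteq> 0" using J(1) unfolding good_def by blast
    then show "\<exists>x. x \<in> V \<and> (\<forall>i\<in>J - {j}. x $ i = 0) \<and> x $ j \<noteq> 0" using x by blast
  qed
  from bchoice[OF this] obtain e where
    e: "\<forall>j\<in>J. e j \<in> V \<and> (\<forall>i\<in>J - {j}. e j $ i = 0) \<and> e j $ j \<noteq> 0" ..
  have inj: "inj_on e J" using e by (metis DiffI empty_iff inj_onI insert_iff)
  have "independent (e ` J)"
  proof (rule independent_if_scalars_zero)
    fix f x assume f: "(\<Sum>x\<in>e ` J. f x *\<^sub>R x) = 0" and "x \<in> e ` J"
    then obtain j where j: "j \<in> J" "x = e j" by blast
    have "0 = (\<Sum>i\<in>J. f (e i) *\<^sub>R e i) $ j"
      using f sum.reindex[OF inj, of "\<lambda>x. f x *\<^sub>R x"] by simp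
    also have "\<dots> = (\<Sum>i\<in>J. if i = j then f x * e j $ j else 0)"
      unfolding sum_component using e j by (intro sum.cong) auto
    also have "\<dots> = f x * e j $ j" using j by (simp add: sum.delta)
    finally show "f x = 0" using e j by auto
  qed simp
  moreover have "e ` J \<subseteq> V" using e by blast
  ultimately have "card (e ` J) \<le> dim V" using independent_card_le_dim by blast
  then show ?thesis using J(1) card_image[OF inj] unfolding good_def by auto
qed

text \<open>With \<open>e = degree g\<close>, the quotient \<open>H n / n ^ e\<close> tends to the
  nonzero leading coefficient. A degree above \<open>k\<close> would force the limit 0, a degree
  below \<open>k\<close> divergence. For \<open>k = 0\<close> the lower bound just reads
  \<open>1 \<le> H n\<close>.\<close>

lemma degree_from_growth:
  fixes g :: "rat poly"
  assumes g: "g \<noteq> 0" and ev: "eventually (\<lambda>n. of_nat (H n) = poly g (of_nat n)) sequentially"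
    and lower: "\<And>n. (n div k + 1) ^ k \<le> H n" and upper: "\<And>n. H n \<le> (B * n + 1) ^ k"
  shows "degree g = k"
proof -
  define e where "e = degree g"
  define p :: "real poly" where "p = map_poly of_rat g"
  have deg: "degree p = e" unfolding p_def e_def by (rule degree_map_poly) simp
  have lead: "lead_coeff p \<noteq> 0" using g unfolding deg by (simp add: p_def e_def coeff_map_poly)
  have poly_p: "poly p (of_nat n) = of_rat (poly g (of_nat n))" for n
    unfolding poly_altdef deg by (simp add: p_def e_def coeff_map_poly of_rat_sum of_rat_mult of_rat_power)
  have "((\<lambda>x. poly p x / x ^ e) \<longlongrightarrow> lead_coeff p) at_infinity"
    using poly_divide_tendsto_aux[of p] deg by simp
  moreover have "filterlim real at_infinity sequentially"
    using filterlim_real_sequentially by (rule filterlim_at_top_imp_at_infinity)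
  ultimately have "(\<lambda>n. poly p (real n) / real n ^ e) \<longlonglongrightarrow> lead_coeff p"
    by (rule filterlim_compose)
  moreover have "eventually (\<lambda>n. poly p (real n) / real n ^ e = real (H n) / real n ^ e) sequentially"
    using ev
  proof eventually_elim
    case (elim n)
    then have "of_rat (of_nat (H n)) = (of_rat (poly g (of_nat n)) :: real)" by simp
    then show ?case by (simp add: poly_p)
  qed
  ultimately have lim: "(\<lambda>n. real (H n) / real n ^ e) \<longlonglongrightarrow> lead_coeff p"
    by (rule Lim_transform_eventually)
  have "\<not> k < e"
  proof
    assume ke: "k < e"
    have "(\<lambda>n. real (H n) / real n ^ e) \<longlonglongrightarrow> 0"
    proof (rule tendsto_sandwich)
      show "eventually (\<lambda>n. 0 \<le> real (H n) / real n ^ e) sequentially" by simp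
      show "eventually (\<lambda>n. real (H n) / real n ^ e \<le> (real B + 1) ^ k / real n) sequentially"
        using eventually_gt_at_top[of 0]
      proof eventually_elim
        case (elim n)
        have "real (H n) \<le> (real B * real n + 1) ^ k" using upper[of n] by (metis of_nat_1 of_nat_add of_nat_le_iff of_nat_mult of_nat_power)
        also have "\<dots> \<le> ((real B + 1) * real n) ^ k"
          using elim by (intro power_mono) (auto simp: algebra_simps)
        also have "\<dots> = (real B + 1) ^ k * real n ^ k" by (simp add: power_mult_distrib)
        finally have "real (H n) / real n ^ e \<le> (real B + 1) ^ k * real n ^ k / real n ^ e"
          using elim by (intro divide_right_mono) auto
        also have "\<dots> = (real B + 1) ^ k / real n ^ (e - k)"
        proof -
          have "real n ^ e = real n ^ k * real n ^ (e - k)" using ke by (simp flip: power_add)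
          then show ?thesis using elim by simp
        qed
        also have "\<dots> \<le> (real B + 1) ^ k / real n"
        proof (rule divide_left_mono)
          have "real n ^ 1 \<le> real n ^ (e - k)" using ke elim by (intro power_increasing) auto
          then show "real n \<le> real n ^ (e - k)" by simp
        qed (use elim in auto)
        finally show ?case .
      qed
      show "(\<lambda>n. (real B + 1) ^ k / real n) \<longlonglongrightarrow> 0" by (rule lim_const_over_n)
    qed simp
    then show False using LIMSEQ_unique[OF lim] lead by simp
  qed
  moreover have "\<not> e < k"
  proof
    assume ek: "e < k"
    have "filterlim (\<lambda>n. (1 / real k) ^ k * real n) at_top sequentially"
      using ek by (intro filterlim_tendsto_pos_mult_at_top[OF tendsto_const _ filterlim_real_sequentially]) auto
    moreover have "eventually (\<lambda>n. (1 / real k) ^ k * real n \<le> real (H n) / real n ^ e) sequentially"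
      using eventually_gt_at_top[of 0]
    proof eventually_elim
      case (elim n)
      have "real n \<le> real k * (real (n div k) + 1)"
      proof -
        have "n = k * (n div k) + n mod k" by simp
        moreover have "n mod k \<le> k" using ek by (simp add: mod_less_divisor less_imp_le)
        ultimately have "n \<le> k * (n div k + 1)" by (simp only: ring_distribs)
        then show ?thesis by (metis of_nat_1 of_nat_add of_nat_le_iff of_nat_mult)
      qed
      then have "real n / real k \<le> real (n div k) + 1" using ek by (simp add: field_simps)
      then have "(real n / real k) ^ k \<le> (real (n div k) + 1) ^ k" by (intro power_mono) auto
      also have "\<dots> \<le> real (H n)" using lower[of n] by (metis of_nat_1 of_nat_add of_nat_le_iff of_nat_power)
      finally have "(1 / real k) ^ k * real n ^ k \<le> real (H n)" by (simp add: power_divide)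
      moreover have "real n * real n ^ e \<le> real n ^ k"
        using ek elim power_increasing[of "Suc e" k "real n"] by simp
      ultimately have "(1 / real k) ^ k * (real n * real n ^ e) \<le> real (H n)"
        by (meson mult_left_mono order_trans zero_le_divide_1_iff zero_le_power of_nat_0_le_iff)
      then show ?case using elim by (simp add: field_simps)
    qed
    ultimately have "filterlim (\<lambda>n. real (H n) / real n ^ e) at_top sequentially"
      by (rule filterlim_at_top_mono)
    then show False
      using not_tendsto_and_filterlim_at_infinity[OF _ lim] filterlim_at_top_imp_at_infinity by fastforce
  qed
  ultimately show ?thesis by (simp add: e_def)
qed

section \<open>Counting the exponents of a given degree\<close>

context weighted_polytope
begin

definition Q :: "(real ^ 'p) set" where "Q = convex hull (W ` v ` {1..m})"

lemma Wv_in_Q: "i \<in> {1..m} \<Longrightarrow> W (v i) \<in> Q"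
  unfolding Q_def by (intro hull_inc) auto

lemma bounded_Q: "bounded Q"
  unfolding Q_def by (intro bounded_convex_hull finite_imp_bounded) simp

lemma Q_nonempty: "Q \<noteq> {}"
  using Wv_in_Q[of 1] m by auto

lemma dilation_Q: "x \<in> dilation n Q \<longleftrightarrow>
    (\<exists>c. (\<forall>i\<in>{1..m}. c i \<ge> 0) \<and> sum c {1..m} = real n \<and> x = (\<Sum>i\<in>{1..m}. c i *\<^sub>R W (v i)))"
  using dilation_convex_hull[OF m, of x n "\<lambda>i. W (v i)"] unfolding Q_def image_image .

lemma S_in_dilation_Q:
  assumes "s \<in> S"
  shows "rvec (fst s) \<in> dilation (snd s) Q"
proof -
  obtain a n where s: "s = (exponent (W a), n)" "a \<in> lattice_points (dilation n P)"
    using assms unfolding S_def by blast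
  obtain c where c: "\<forall>i\<in>{1..m}. c i \<ge> 0" "sum c {1..m} = real n" "a = (\<Sum>i\<in>{1..m}. c i *\<^sub>R v i)"
    using s(2) unfolding lattice_points_def dilation_P by blast
  have "W a = (\<Sum>i\<in>{1..m}. c i *\<^sub>R W (v i))"
    unfolding c(3) by (simp add: linear_sum[OF W] linear_scale[OF W])
  moreover have "rvec (exponent (W a)) = W a"
    using s(2) lattice_points_natural by (intro rvec_exponent W_natural) blast
  ultimately show ?thesis unfolding s(1) dilation_Q using c by auto
qed

text \<open>Differences of exponents of degree \<open>n\<close> lie in the direction space of
  \<open>Q\<close>, where at most \<open>dim Q\<close> coordinates determine a vector; each of these
  coordinates takes natural values up to \<open>B * n\<close>.\<close>

lemma card_slice_upper: "\<exists>B. \<forall>n. card {s \<in> S. snd s = n} \<le> (B * n + 1) ^ nat (aff_dim Q)"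
proof -
  obtain a where a: "a \<in> Q" using Q_nonempty by blast
  define V where "V = span ((\<lambda>x. x - a) ` Q)"
  have dimV: "int (dim V) = aff_dim Q"
    unfolding V_def dim_span using a by (intro aff_dim_eq_dim_subtract[symmetric] hull_inc)
  obtain J where J: "card J \<le> dim V" "\<And>x. x \<in> V \<Longrightarrow> (\<forall>j\<in>J. x $ j = 0) \<Longrightarrow> x = 0"
    using coordinates_determine_subspace[of V] unfolding V_def by (meson subspace_span)
  obtain b where b: "\<And>x. x \<in> Q \<Longrightarrow> norm x \<le> b" using bounded_Q unfolding bounded_iff by blast
  define B where "B = nat \<lceil>b\<rceil>"
  have "card {s \<in> S. snd s = n} \<le> (B * n + 1) ^ nat (aff_dim Q)" for n
  proof -
    define F where "F s = restrict (\<lambda>j. Poly_Mapping.lookup (fst s) j) J" for s :: "'p expo"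
    have mem: "\<exists>q\<in>Q. rvec (fst s) = real n *\<^sub>R q" if "s \<in> {s \<in> S. snd s = n}" for s
      using S_in_dilation_Q[of s] that unfolding dilation_def by auto
    have "F ` {s \<in> S. snd s = n} \<subseteq> J \<rightarrow>\<^sub>E {..B * n}"
    proof
      fix f assume "f \<in> F ` {s \<in> S. snd s = n}"
      then obtain s where s: "s \<in> {s \<in> S. snd s = n}" "f = F s" by blast
      obtain q where q: "q \<in> Q" "rvec (fst s) = real n *\<^sub>R q" using mem[OF s(1)] by blast
      have "Poly_Mapping.lookup (fst s) j \<le> B * n" for j
      proof -
        have "real (Poly_Mapping.lookup (fst s) j) = real n * q $ j"
          using arg_cong[OF q(2), of "\<lambda>x. x $ j"] by simp
        also have "q $ j \<le> real B"
          using b[OF q(1)] component_le_norm_cart[of q j] unfolding B_def by linarith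
        then have "real n * q $ j \<le> real n * real B" by (rule mult_left_mono) simp
        finally have "real (Poly_Mapping.lookup (fst s) j) \<le> real (B * n)" by (simp add: mult.commute)
        then show ?thesis by (simp only: of_nat_le_iff)
      qed
      then show "f \<in> J \<rightarrow>\<^sub>E {..B * n}" unfolding s(2) F_def by auto
    qed
    moreover have "inj_on F {s \<in> S. snd s = n}"
    proof (rule inj_onI)
      fix s t assume s: "s \<in> {s \<in> S. snd s = n}" and t: "t \<in> {s \<in> S. snd s = n}" and eq: "F s = F t"
      obtain q where q: "q \<in> Q" "rvec (fst s) = real n *\<^sub>R q" using mem[OF s] by blast
      obtain q' where q': "q' \<in> Q" "rvec (fst t) = real n *\<^sub>R q'" using mem[OF t] by blast
      have "rvec (fst s) - rvec (fst t) = real n *\<^sub>R ((q - a) - (q' - a))"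
        unfolding q q' by (simp add: scaleR_diff_right)
      also have "\<dots> \<in> V" unfolding V_def using q q' by (intro span_scale span_diff span_base) auto
      finally have "rvec (fst s) - rvec (fst t) \<in> V" .
      moreover have "(rvec (fst s) - rvec (fst t)) $ j = 0" if "j \<in> J" for j
        using fun_cong[OF eq, of j] that by (simp add: F_def)
      ultimately have "rvec (fst s) - rvec (fst t) = 0" using J(2) by blast
      then show "s = t" using s t by (intro expo_eqI) auto
    qed
    ultimately have "card {s \<in> S. snd s = n} \<le> card (J \<rightarrow>\<^sub>E {..B * n})"
      by (intro card_inj_on_le[of F]) (auto intro: finite_PiE)
    also have "\<dots> = (B * n + 1) ^ card J" by (simp add: card_PiE)
    also have "\<dots> \<le> (B * n + 1) ^ nat (aff_dim Q)"
      using J(1) dimV by (intro power_increasing) auto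
    finally show ?thesis .
  qed
  then show ?thesis by blast
qed

text \<open>An affine basis of the hull, chosen among the \<open>W (v i)\<close>, consists of a base
  point \<open>a\<close> and \<open>k\<close> further points. Each of the latter is used up to
  \<open>n div k\<close> times, and \<open>a\<close> fills up to degree \<open>n\<close>. Affine
  independence keeps these sums distinct.\<close>

lemma card_slice_lower: "(n div nat (aff_dim Q) + 1) ^ nat (aff_dim Q) \<le> card {s \<in> S. snd s = n}"
proof -
  define k where "k = nat (aff_dim Q)"
  obtain A where A: "A \<subseteq> W ` v ` {1..m}" "\<not> affine_dependent A" "affine hull (W ` v ` {1..m}) = affine hull A"
    using affine_basis_exists by blast
  have finA: "finite A" using A(1) finite_subset by blast
  have "int (card A) = aff_dim Q + 1"
    unfolding Q_def aff_dim_convex_hull using A(2,3) by (intro aff_dim_unique) auto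
  moreover have "aff_dim Q \<ge> 0" using Q_nonempty aff_dim_geq[of Q] aff_dim_empty[of Q] by linarith
  ultimately have cA: "card A = k + 1" by (simp add: k_def)
  then obtain a where a: "a \<in> A" by fastforce
  define A' where "A' = A - {a}"
  have A': "card A' = k" "finite A'" "a \<notin> A'" "insert a A' = A"
    using cA a finA by (auto simp: A'_def)
  have A'_sub: "A' \<subseteq> A" by (auto simp: A'_def)
  have indep: "independent ((\<lambda>x. x - a) ` A')"
    using A(2) affine_dependent_iff_dependent[OF A'(3)] A'(4) by simp
  have "\<forall>x\<in>A. \<exists>i. i \<in> {1..m} \<and> W (v i) = x" using A(1) by blast
  from bchoice[OF this] obtain i where i: "\<forall>x\<in>A. i x \<in> {1..m} \<and> W (v (i x)) = x" ..
  define F where "F c = (\<Sum>x\<in>A'. nmult (c x) (u (i x))) + nmult (n - sum c A') (u (i a))" for c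
  define C where "C = A' \<rightarrow>\<^sub>E {..n div k}"
  have le: "sum c A' \<le> n" if "c \<in> C" for c
  proof -
    have "sum c A' \<le> of_nat (card A') * (n div k)"
      using that unfolding C_def by (intro sum_bounded_above) auto
    also have "\<dots> \<le> n" by (simp add: A'(1))
    finally show ?thesis .
  qed
  have snd_u: "snd (u j) = 1" for j by (simp add: u_def)
  have snd_sum: "snd (\<Sum>x\<in>X. nmult (c x) (u (i x))) = sum c X" for c X
    by (induction X rule: infinite_finite_induct) (simp_all add: snd_nmult snd_u)
  have rvec_u: "rvec (fst (u (i x))) = x" if "x \<in> A" for x
    using i that v W_natural[of "v (i x)"] by (auto simp: u_def)
  have rvec_sum: "rvec (fst (\<Sum>x\<in>X. nmult (c x) (u (i x)))) = (\<Sum>x\<in>X. real (c x) *\<^sub>R x)" if "X \<subseteq> A" for c X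
    using that by (induction X rule: infinite_finite_induct) (simp_all add: rvec_add fst_nmult rvec_nmult rvec_u)
  have FS: "F c \<in> {s \<in> S. snd s = n}" if "c \<in> C" for c
  proof -
    have nm: "nmult l (u j) \<in> S" if "j \<in> {1..m}" for l j
      using u_in_S[OF that] add_closed_S by (induction l) (auto simp: add_closed_def)
    have "(\<Sum>x\<in>X. nmult (c x) (u (i x))) \<in> S" if "X \<subseteq> A" for X
      using that
    proof (induction X rule: infinite_finite_induct)
      case (insert x X)
      then show ?case using i by (auto intro!: add_closedD[OF add_closed_S] nm)
    qed (use add_closed_S in \<open>auto simp: add_closed_def\<close>)
    then have "F c \<in> S" unfolding F_def using A'_sub i a by (intro add_closedD[OF add_closed_S] nm) auto
    moreover have "snd (F c) = n" using le[OF that] by (simp add: F_def snd_sum snd_nmult snd_u)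
    ultimately show ?thesis by simp
  qed
  have "inj_on F C"
  proof (rule inj_onI)
    fix c d assume c: "c \<in> C" and d: "d \<in> C" and eq: "F c = F d"
    have rF: "rvec (fst (F c)) = real n *\<^sub>R a + (\<Sum>x\<in>A'. real (c x) *\<^sub>R (x - a))" if "c \<in> C" for c
    proof -
      have "rvec (fst (F c)) = (\<Sum>x\<in>A'. real (c x) *\<^sub>R x) + (real n - (\<Sum>x\<in>A'. real (c x))) *\<^sub>R a"
        unfolding F_def using rvec_sum[of A' c] rvec_u[OF a] A'_sub le[OF that]
        by (simp add: rvec_add fst_nmult rvec_nmult of_nat_diff subset_insertI)
      then show ?thesis
        by (simp add: scaleR_diff_right scaleR_left_diff_distrib sum_subtractf scaleR_sum_left)
    qed
    have inj: "inj_on (\<lambda>x. x - a) A'" by (simp add: inj_on_def)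
    have z: "(\<Sum>x\<in>A'. (real (c x) - real (d x)) *\<^sub>R (x - a)) = 0"
      using rF[OF c] rF[OF d] eq by (simp add: scaleR_left_diff_distrib sum_subtractf)
    define h where "h y = real (c (y + a)) - real (d (y + a))" for y
    have "(\<Sum>y\<in>(\<lambda>x. x - a) ` A'. h y *\<^sub>R y) = 0"
      using z by (simp add: sum.reindex[OF inj] h_def)
    then have h0: "h y = 0" if "y \<in> (\<lambda>x. x - a) ` A'" for y
      using indep that A'(2) unfolding independent_explicit by blast
    have "c x = d x" if "x \<in> A'" for x using h0[of "x - a"] that by (simp add: h_def)
    then show "c = d" using c d unfolding C_def by (intro PiE_ext[of c A' _ d]) auto
  qed
  then have "card C \<le> card {s \<in> S. snd s = n}"
    using FS finite_S_slice by (intro card_inj_on_le[of F]) auto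
  moreover have "card C = (n div k + 1) ^ k" unfolding C_def by (simp add: card_PiE A')
  ultimately show ?thesis unfolding k_def by simp
qed

text \<open>The pole is cancelled over the integers, so that \<open>h\<close> stays integral; the
  series is then mapped to the rationals, where the pole order gives a polynomial. Its degree is
  determined by the two growth bounds.\<close>

lemma hilbert_polynomial:
  defines "H \<equiv> (\<lambda>n. card {s \<in> S. snd s = n})" and "d \<equiv> nat (aff_dim Q) + 1"
  shows "polynomial_function_of_degree H (d - 1)"
    and "\<exists>h :: int poly. poly h 1 \<noteq> 0 \<and>
          Abs_fps (\<lambda>n. of_nat (H n)) = fps_of_poly (map_poly rat_of_int h) / (1 - fps_X) ^ d"
proof -
  let ?k = "nat (aff_dim Q)"
  have lower: "(n div ?k + 1) ^ ?k \<le> H n" for n unfolding H_def by (rule card_slice_lower)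
  obtain B where upper: "\<And>n. H n \<le> (B * n + 1) ^ ?k" using card_slice_upper unfolding H_def by blast
  have pos: "H n \<noteq> 0" for n using lower[of n] by (metis One_nat_def Suc_n_not_le_n Suc_eq_plus1 le_zero_eq not_less_eq_eq power_not_zero zero_less_Suc zero_neq_one add_is_0)
  obtain h0 :: "int poly" where "Abs_fps (\<lambda>n. of_nat (H n)) * (1 - fps_X) ^ m = fps_of_poly h0"
    using hilbert_series_polynomial unfolding H_def by blast
  \<comment> \<open>As no coefficient is 0, the series is not a polynomial and a pole of positive
    order remains.\<close>
  moreover have "\<exists>n\<ge>N. Abs_fps (\<lambda>n. int (H n)) $ n \<noteq> 0" for N using pos[of N] by auto
  ultimately obtain d' and h :: "int poly" where d': "d' \<ge> 1" "poly h 1 \<noteq> 0"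
    "Abs_fps (\<lambda>n. int (H n)) * (1 - fps_X) ^ d' = fps_of_poly h"
    using fps_of_poly_cancel_pole[of "Abs_fps (\<lambda>n. int (H n))" m h0] by auto
  define f :: "rat fps" where "f = Abs_fps (\<lambda>n. of_nat (H n))"
  define hq where "hq = map_poly rat_of_int h"
  have f: "f * (1 - fps_X) ^ d' = fps_of_poly hq"
  proof (rule fps_ext)
    fix n
    have X: "(1 - fps_X :: rat fps) ^ d' $ j = of_int ((1 - fps_X :: int fps) ^ d' $ j)" for j
    proof (induction d' arbitrary: j)
      case (Suc d')
      then show ?case by (cases j) (simp_all add: left_diff_distrib)
    qed (simp add: fps_one_nth)
    have "fps_of_poly hq $ n = of_int (fps_of_poly h $ n)" by (simp add: hq_def coeff_map_poly)
    also have "\<dots> = of_int ((Abs_fps (\<lambda>n. int (H n)) * (1 - fps_X) ^ d') $ n)" unfolding d'(3) ..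
    also have "\<dots> = (f * (1 - fps_X) ^ d') $ n"
      unfolding fps_mult_nth of_int_sum by (intro sum.cong) (simp_all add: X f_def)
    finally show "(f * (1 - fps_X) ^ d') $ n = fps_of_poly hq $ n" ..
  qed
  have hq1: "poly hq 1 \<noteq> 0" using d'(2) by (simp add: hq_def of_int_poly_hom.poly_map_poly)
  obtain e where e: "d' = Suc e" using d'(1) by (cases d') auto
  obtain g where g: "g \<noteq> 0" "degree g = e" "\<And>n. n \<ge> degree hq \<Longrightarrow> f $ n = poly g (of_nat n)"
    using fps_pole_polynomial[OF f[unfolded e] hq1] by blast
  have ev: "eventually (\<lambda>n. of_nat (H n) = poly g (of_nat n)) sequentially"
    using eventually_ge_at_top[of "degree hq"] by eventually_elim (use g(3) in \<open>simp add: f_def\<close>)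
  have "e = ?k" using degree_from_growth[OF g(1) ev lower upper] g(2) by simp
  then have d: "d' = d" by (simp add: e d_def)
  show "polynomial_function_of_degree H (d - 1)"
    unfolding polynomial_function_of_degree_def using g(1,2) ev \<open>e = ?k\<close> by (auto simp: d_def)
  have "f = fps_of_poly hq / (1 - fps_X) ^ d"
  proof -
    have unit: "inverse ((1 - fps_X :: rat fps) ^ d) * (1 - fps_X) ^ d = 1"
      by (rule inverse_mult_eq_1) simp
    have "fps_of_poly hq / (1 - fps_X) ^ d = f * (1 - fps_X) ^ d * inverse ((1 - fps_X) ^ d)"
      unfolding f[symmetric] d by (rule fps_divide_unit) simp
    then show ?thesis using unit by (simp add: mult.assoc mult.commute[of _ "inverse _"])
  qed
  then show "\<exists>h :: int poly. poly h 1 \<noteq> 0 \<and>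
          Abs_fps (\<lambda>n. of_nat (H n)) = fps_of_poly (map_poly rat_of_int h) / (1 - fps_X) ^ d"
    using d'(2) unfolding f_def hq_def by blast
qed

end

section \<open>Krull dimension\<close>

lemma primeideal_ring_ofD:
  assumes "primeideal \<pp> (ring_of R)"
  shows "\<pp> \<subseteq> R" "0 \<in> \<pp>" "x \<in> \<pp> \<Longrightarrow> y \<in> \<pp> \<Longrightarrow> x + y \<in> \<pp>" "x \<in> R \<Longrightarrow> y \<in> \<pp> \<Longrightarrow> x * y \<in> \<pp>"
    "x \<in> R \<Longrightarrow> y \<in> R \<Longrightarrow> x * y \<in> \<pp> \<Longrightarrow> x \<in> \<pp> \<or> y \<in> \<pp>" "1 \<notin> \<pp>"
proof -
  interpret primeideal \<pp> "ring_of R" by fact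
  show "\<pp> \<subseteq> R" using a_subset by (simp add: ring_of_def)
  show "0 \<in> \<pp>" using additive_subgroup.zero_closed[OF is_additive_subgroup] by (simp add: ring_of_def)
  show "x \<in> \<pp> \<Longrightarrow> y \<in> \<pp> \<Longrightarrow> x + y \<in> \<pp>"
    using additive_subgroup.a_closed[OF is_additive_subgroup, of x y] by (simp add: ring_of_def)
  show "x \<in> R \<Longrightarrow> y \<in> \<pp> \<Longrightarrow> x * y \<in> \<pp>" using I_l_closed[of y x] by (simp add: ring_of_def)
  show "x \<in> R \<Longrightarrow> y \<in> R \<Longrightarrow> x * y \<in> \<pp> \<Longrightarrow> x \<in> \<pp> \<or> y \<in> \<pp>" using I_prime[of x y] by (simp add: ring_of_def)
  show "1 \<notin> \<pp>" using one_imp_carrier I_notcarr by (auto simp: ring_of_def)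
qed

lemma cring_ring_of:
  assumes "subring R"
  shows "cring (ring_of R)"
proof (rule cringI)
  show "abelian_group (ring_of R)"
  proof (rule abelian_groupI)
    fix x assume "x \<in> carrier (ring_of R)"
    then show "\<exists>y\<in>carrier (ring_of R). y \<oplus>\<^bsub>ring_of R\<^esub> x = \<zero>\<^bsub>ring_of R\<^esub>"
      using subring_uminus[OF assms, of x] by (intro bexI[of _ "- x"]) (simp_all add: ring_of_def)
  qed (use subringD[OF assms] in \<open>simp_all add: ring_of_def add.assoc add.commute\<close>)
  show "Group.comm_monoid (ring_of R)"
    by (rule comm_monoidI) (use subringD[OF assms] in \<open>simp_all add: ring_of_def mult.assoc mult.commute\<close>)
qed (simp add: ring_of_def ring_distribs)

lemma primeideal_ring_ofI:
  assumes R: "subring R" and I: "\<pp> \<subseteq> R" "0 \<in> \<pp>" "\<And>x y. x \<in> \<pp> \<Longrightarrow> y \<in> \<pp> \<Longrightarrow> x + y \<in> \<pp>"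
    "\<And>x y. x \<in> R \<Longrightarrow> y \<in> \<pp> \<Longrightarrow> x * y \<in> \<pp>" "1 \<notin> \<pp>"
    "\<And>x y. x \<in> R \<Longrightarrow> y \<in> R \<Longrightarrow> x * y \<in> \<pp> \<Longrightarrow> x \<in> \<pp> \<or> y \<in> \<pp>"
  shows "primeideal \<pp> (ring_of R)"
proof (rule primeidealI)
  interpret cring "ring_of R" by (rule cring_ring_of[OF R])
  have minus: "- x \<in> \<pp>" if "x \<in> \<pp>" for x
    using I(4)[of "- 1" x] that subring_uminus[OF R subringD(2)[OF R]] by simp
  have I4': "y * x \<in> \<pp>" if "x \<in> R" "y \<in> \<pp>" for x y
    using I(4)[OF that] by (simp add: mult.commute)
  have inv: "\<ominus>\<^bsub>ring_of R\<^esub> x = - x" if "x \<in> R" for x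
    using that subring_uminus[OF R that] by (intro minus_equality) (simp_all add: ring_of_def)
  show "ideal \<pp> (ring_of R)"
  proof (rule idealI)
    show "Ring.ring (ring_of R)" by (rule ring_axioms)
    show "Group.subgroup \<pp> (add_monoid (ring_of R))"
    proof
      show "inv\<^bsub>add_monoid (ring_of R)\<^esub> x \<in> \<pp>" if "x \<in> \<pp>" for x
        using inv[of x] minus[OF that] that I(1) by (auto simp: a_inv_def)
    qed (use I in \<open>auto simp: ring_of_def\<close>)
  qed (use I(4) I4' in \<open>auto simp: ring_of_def\<close>)
  show "cring (ring_of R)" by (rule cring_axioms)
  show "carrier (ring_of R) \<noteq> \<pp>" using I(5) subringD(2)[OF R] by (auto simp: ring_of_def)
  show "a \<in> \<pp> \<or> b \<in> \<pp>"
    if "a \<in> carrier (ring_of R)" "b \<in> carrier (ring_of R)" "a \<otimes>\<^bsub>ring_of R\<^esub> b \<in> \<pp>" for a b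
    using that I(6) by (simp add: ring_of_def)
qed

text \<open>The argument of Coquand and Lombardi: an algebraic relation among elements \<open>x 0, \<dots>, x (l - 1)\<close>
  that climb a chain of primes contradicts the primes one after the other, starting from the
  lexicographically least monomial of the relation.\<close>

lemma prime_chain_monomials:
  fixes R :: "('i::linorder, 'k::field) polyz set"
  assumes R: "subring R" "\<And>c. kconst c \<in> R"
    and \<pp>: "\<And>i. i \<le> l \<Longrightarrow> primeideal (\<pp> i) (ring_of R)" "\<And>i. i < l \<Longrightarrow> \<pp> i \<subseteq> \<pp> (Suc i)"
    and x: "\<And>i. i < l \<Longrightarrow> x i \<in> \<pp> (Suc i) - \<pp> i"
    and E: "finite E" "E \<noteq> {}" "\<And>\<alpha>. \<alpha> \<in> E \<Longrightarrow> length \<alpha> = l \<and> c \<alpha> \<noteq> 0"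
  shows "(\<Sum>\<alpha>\<in>E. kscale (c \<alpha>) (\<Prod>i<l. x i ^ (\<alpha> ! i))) \<notin> \<pp> 0"
  using \<pp> x E
proof (induction l arbitrary: \<pp> x E c)
  case 0
  then have E: "E = {[]}" by blast
  have c0: "c [] \<noteq> 0" using 0 E by blast
  show ?case
  proof
    assume "(\<Sum>\<alpha>\<in>E. kscale (c \<alpha>) (\<Prod>i<0. x i ^ (\<alpha> ! i))) \<in> \<pp> 0"
    then have "kscale (c []) 1 \<in> \<pp> 0" by (simp add: E)
    then have "kconst (1 / c []) * kscale (c []) 1 \<in> \<pp> 0"
      using primeideal_ring_ofD(4)[OF 0(1)] R(2) by blast
    moreover have "kconst (1 / c []) * kscale (c []) 1 = (1 :: ('i, 'k) polyz)"
      using c0 by (simp add: kconst_eq kscale_mult ks.scale_one)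
    ultimately show False using primeideal_ring_ofD(6)[OF 0(1)] by simp
  qed
next
  case (Suc l)
  note \<pp> = Suc.prems(1,2) and x = Suc.prems(3) and E = Suc.prems(4-6)
  have xR: "x i \<in> R" if "i < Suc l" for i
    using x[OF that] primeideal_ring_ofD(1)[OF \<pp>(1)[of "Suc i"]] that by auto
  \<comment> \<open>With the least power of \<open>x 0\<close> taken out, the sum is
    \<open>x 0 ^ a * (y + x 0 * z)\<close>; here \<open>y\<close> collects the terms with exponent
    exactly \<open>a\<close> and does not involve \<open>x 0\<close>.\<close>
  define a where "a = Min (hd ` E)"
  have a_le: "a \<le> hd \<alpha>" if "\<alpha> \<in> E" for \<alpha> unfolding a_def using that E(1) by simp
  have "a \<in> hd ` E" unfolding a_def using E(1,2) by simp
  define E0 where "E0 = {\<alpha> \<in> E. hd \<alpha> = a}"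
  have E0: "finite E0" "E0 \<noteq> {}" "E0 \<subseteq> E" using E(1) \<open>a \<in> hd ` E\<close> by (auto simp: E0_def)
  define T where "T \<alpha> = (\<Prod>i<l. x (Suc i) ^ (tl \<alpha> ! i))" for \<alpha> :: "nat list"
  have TR: "T \<alpha> \<in> R" for \<alpha> unfolding T_def using xR by (intro subring_prod subring_power R) auto
  have kR: "kscale b f \<in> R" if "f \<in> R" for b f
    unfolding kscale_def using R that by (intro subringD(5)) auto
  have prod: "(\<Prod>i<Suc l. x i ^ (\<alpha> ! i)) = x 0 ^ hd \<alpha> * T \<alpha>" if "\<alpha> \<in> E" for \<alpha>
  proof -
    have "\<alpha> = hd \<alpha> # tl \<alpha>" using E(3)[OF that] by (cases \<alpha>) auto
    then have "\<alpha> ! 0 = hd \<alpha>" "\<And>i. \<alpha> ! Suc i = tl \<alpha> ! i" by (metis nth_Cons_0, metis nth_Cons_Suc)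
    then show ?thesis by (simp add: prod.lessThan_Suc_shift T_def del: prod.lessThan_Suc)
  qed
  define y where "y = (\<Sum>\<alpha>\<in>E0. kscale (c \<alpha>) (T \<alpha>))"
  define z where "z = (\<Sum>\<alpha>\<in>E - E0. kscale (c \<alpha>) (x 0 ^ (hd \<alpha> - Suc a) * T \<alpha>))"
  have zR: "z \<in> R" unfolding z_def
    using xR TR R by (intro subring_sum kR subringD(5) subring_power) auto
  have yR: "y \<in> R" unfolding y_def using TR R by (intro subring_sum kR) auto
  have sum: "(\<Sum>\<alpha>\<in>E. kscale (c \<alpha>) (\<Prod>i<Suc l. x i ^ (\<alpha> ! i))) = x 0 ^ a * (y + x 0 * z)"
  proof -
    have "(\<Sum>\<alpha>\<in>E. kscale (c \<alpha>) (\<Prod>i<Suc l. x i ^ (\<alpha> ! i))) = (\<Sum>\<alpha>\<in>E. kscale (c \<alpha>) (x 0 ^ hd \<alpha> * T \<alpha>))"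
      by (intro sum.cong refl) (simp only: prod)
    also have "\<dots> = (\<Sum>\<alpha>\<in>E - E0. kscale (c \<alpha>) (x 0 ^ hd \<alpha> * T \<alpha>)) + (\<Sum>\<alpha>\<in>E0. kscale (c \<alpha>) (x 0 ^ hd \<alpha> * T \<alpha>))"
      by (rule sum.subset_diff[OF E0(3) E(1)])
    also have "(\<Sum>\<alpha>\<in>E0. kscale (c \<alpha>) (x 0 ^ hd \<alpha> * T \<alpha>)) = x 0 ^ a * y"
      unfolding y_def sum_distrib_left by (intro sum.cong) (auto simp: E0_def kscale_def mult_ac)
    also have "(\<Sum>\<alpha>\<in>E - E0. kscale (c \<alpha>) (x 0 ^ hd \<alpha> * T \<alpha>)) = x 0 ^ a * (x 0 * z)"
      unfolding z_def sum_distrib_left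
    proof (intro sum.cong refl)
      fix \<alpha> assume "\<alpha> \<in> E - E0"
      then have "hd \<alpha> = a + Suc (hd \<alpha> - Suc a)" using a_le[of \<alpha>] by (auto simp: E0_def)
      then have "x 0 ^ hd \<alpha> = x 0 ^ a * (x 0 * x 0 ^ (hd \<alpha> - Suc a))" by (metis power_Suc power_add)
      then show "kscale (c \<alpha>) (x 0 ^ hd \<alpha> * T \<alpha>) = x 0 ^ a * (x 0 * kscale (c \<alpha>) (x 0 ^ (hd \<alpha> - Suc a) * T \<alpha>))"
        by (simp only: kscale_def mult_ac)
    qed
    finally show ?thesis by (simp add: ring_distribs add.commute)
  qed
  show ?case
  proof
    assume "(\<Sum>\<alpha>\<in>E. kscale (c \<alpha>) (\<Prod>i<Suc l. x i ^ (\<alpha> ! i))) \<in> \<pp> 0"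
    then have mem: "x 0 ^ a * (y + x 0 * z) \<in> \<pp> 0" unfolding sum .
    note p0 = primeideal_ring_ofD[OF \<pp>(1)[of 0, simplified]]
    note p1 = primeideal_ring_ofD[OF \<pp>(1)[of "Suc 0", simplified]]
    have wR: "y + x 0 * z \<in> R" using yR zR xR[of 0] R by (intro subringD(3,5)) auto
    have step: "w \<in> \<pp> 0" if "x 0 ^ b * w \<in> \<pp> 0" "w \<in> R" for b w
      using that(1)
    proof (induction b)
      case (Suc b)
      then have "x 0 * (x 0 ^ b * w) \<in> \<pp> 0" by (simp add: mult.assoc)
      moreover have "x 0 ^ b * w \<in> R"
        using xR[of 0] that(2) by (intro subringD(5)[OF R(1)] subring_power[OF R(1)]) auto
      ultimately have "x 0 \<in> \<pp> 0 \<or> x 0 ^ b * w \<in> \<pp> 0"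
        using xR[of 0] by (intro p0(5)) auto
      then show ?case using x[of 0] Suc.IH by auto
    qed simp
    \<comment> \<open>Primality of \<open>\<pp> 0\<close> strips \<open>x 0 ^ a\<close>, as
      \<open>x 0 \<notin> \<pp> 0\<close>. Since \<open>x 0 \<in> \<pp> (Suc 0)\<close>, the element
      \<open>y\<close> lies there too, which is a relation in one element less.\<close>
    have "y + x 0 * z \<in> \<pp> (Suc 0)" using step[OF mem wR] \<pp>(2)[of 0] by auto
    moreover have "z * x 0 \<in> \<pp> (Suc 0)" using x[of 0] zR by (intro p1(4)) auto
    then have "(- 1) * (z * x 0) \<in> \<pp> (Suc 0)"
      using subring_uminus[OF R(1) subringD(2)[OF R(1)]] p1(4)[of "- 1" "z * x 0"] by blast
    ultimately have "(y + x 0 * z) + (- 1) * (z * x 0) \<in> \<pp> (Suc 0)" by (rule p1(3))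
    then have y1: "y \<in> \<pp> (Suc 0)" by (simp add: mult.commute)
    have inj: "inj_on tl E0"
    proof (rule inj_onI)
      fix \<alpha> \<beta> assume "\<alpha> \<in> E0" "\<beta> \<in> E0" "tl \<alpha> = tl \<beta>"
      moreover from this have "length \<alpha> = Suc l" "length \<beta> = Suc l" "hd \<alpha> = hd \<beta>" using E(3) by (auto simp: E0_def)
      ultimately show "\<alpha> = \<beta>" by (metis list.exhaust_sel length_0_conv nat.distinct(1))
    qed
    have cons: "a # tl \<alpha> = \<alpha>" if "\<alpha> \<in> E0" for \<alpha>
      using that E(3)[of \<alpha>] by (cases \<alpha>) (auto simp: E0_def)
    have "y = (\<Sum>\<beta>\<in>tl ` E0. kscale (c (a # \<beta>)) (\<Prod>i<l. x (Suc i) ^ (\<beta> ! i)))"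
      unfolding y_def sum.reindex[OF inj] o_def T_def by (intro sum.cong) (simp_all add: cons)
    moreover have "\<dots> \<notin> \<pp> (Suc 0)"
    proof (rule Suc.IH[of "\<lambda>i. \<pp> (Suc i)"])
      show "length \<beta> = l \<and> c (a # \<beta>) \<noteq> 0" if "\<beta> \<in> tl ` E0" for \<beta>
        using that cons E(3) E0(3) by auto
    qed (use \<pp> x E0 in auto)
    ultimately show False using y1 by simp
  qed
qed

lemma linear_dependence_family:
  fixes f :: "'b \<Rightarrow> ('i, 'k::field) polyz"
  assumes T: "finite T" and I: "finite I" "card T < card I" and f: "\<And>i. i \<in> I \<Longrightarrow> f i \<in> kmon T"
  shows "\<exists>c. (\<exists>i\<in>I. c i \<noteq> 0) \<and> (\<Sum>i\<in>I. kscale (c i) (f i)) = 0"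
proof (cases "inj_on f I")
  case False
  then obtain i j where ij: "i \<in> I" "j \<in> I" "i \<noteq> j" "f i = f j" by (auto simp: inj_on_def)
  define c :: "'b \<Rightarrow> 'k" where "c l = (if l = i then 1 else if l = j then - 1 else 0)" for l
  have "(\<Sum>l\<in>I. kscale (c l) (f l)) = (\<Sum>l\<in>{i, j}. kscale (c l) (f l))"
    using ij I(1) by (intro sum.mono_neutral_right) (auto simp: c_def)
  also have "\<dots> = 0" using ij by (simp add: c_def)
  finally have "(\<Sum>l\<in>I. kscale (c l) (f l)) = 0" .
  moreover have "c i \<noteq> 0" by (simp add: c_def)
  ultimately show ?thesis using ij(1) by blast
next
  case True
  have "ks.dependent (f ` I)"
  proof (rule ccontr)
    assume "\<not> ks.dependent (f ` I)"
    moreover have "f ` I \<subseteq> kspan (mon ` T)" unfolding kspan_mon using f by blast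
    ultimately have "card (f ` I) \<le> card (mon ` T :: ('i, 'k) polyz set)"
      using ks.independent_span_bound[of "mon ` T" "f ` I"] T by simp
    also have "\<dots> \<le> card T" by (rule card_image_le[OF T])
    finally show False using I(2) card_image[OF True] by simp
  qed
  then obtain u where u: "\<exists>v\<in>f ` I. u v \<noteq> 0" "(\<Sum>v\<in>f ` I. kscale (u v) v) = 0"
    using ks.dependent_finite[of "f ` I"] I(1) by auto
  then show ?thesis using sum.reindex[OF True, of "\<lambda>v. kscale (u v) v"] by (intro exI[of _ "u \<circ> f"]) auto
qed

text \<open>Dimension count: there are \<open>(N + 1) ^ Suc l\<close> monomials in the
  \<open>x i\<close> with exponents up to \<open>N\<close>, while the exponents in \<open>S\<close>
  of the degrees that they reach grow only like \<open>N ^ l\<close>.\<close>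

lemma algebraic_dependence:
  fixes x :: "nat \<Rightarrow> ('i::linorder, 'k::field) polyz"
  assumes S: "add_closed S" and fin: "\<And>D. finite {s \<in> S. snd s \<le> D}"
    and bound: "\<And>D. card {s \<in> S. snd s \<le> D} \<le> C * (D + 1) ^ l"
    and x: "\<And>i. i < Suc l \<Longrightarrow> x i \<in> kmon S"
  shows "\<exists>E c. finite E \<and> E \<noteq> {} \<and> (\<forall>\<alpha>\<in>E. length \<alpha> = Suc l \<and> c \<alpha> \<noteq> 0) \<and>
    (\<Sum>\<alpha>\<in>E. kscale (c \<alpha>) (\<Prod>i<Suc l. x i ^ (\<alpha> ! i))) = 0"
proof -
  define e where "e = (\<Sum>i<Suc l. degree (x i))"
  \<comment> \<open>Chosen so that the bound \<open>C * (N * e + 1) ^ l\<close> becomes at most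
    \<open>N * (N + 1) ^ l\<close>, which is less than \<open>(N + 1) ^ Suc l\<close>.\<close>
  define N where "N = C * (e + 1) ^ l"
  define I where "I = {\<alpha>. set \<alpha> \<subseteq> {..N} \<and> length \<alpha> = Suc l}"
  have I: "finite I" "card I = (N + 1) ^ Suc l"
    unfolding I_def using finite_lists_length_eq[of "{..N}" "Suc l"] card_lists_length_eq[of "{..N}" "Suc l"] by simp_all
  define T where "T = {s \<in> S. snd s \<le> N * e}"
  have finT: "finite T" unfolding T_def by (rule fin)
  have "card T \<le> C * (N * e + 1) ^ l" unfolding T_def by (rule bound)
  also have "\<dots> \<le> C * ((N + 1) * (e + 1)) ^ l" by (intro mult_left_mono power_mono) auto
  also have "\<dots> = C * (e + 1) ^ l * (N + 1) ^ l" by (simp only: power_mult_distrib mult_ac)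
  also have "\<dots> = N * (N + 1) ^ l" unfolding N_def ..
  also have "\<dots> < (N + 1) ^ Suc l" by simp
  finally have card: "card T < card I" using I(2) by simp
  have mem: "(\<Prod>i<Suc l. x i ^ (\<alpha> ! i)) \<in> kmon T" if "\<alpha> \<in> I" for \<alpha>
  proof -
    let ?f = "\<Prod>i<Suc l. x i ^ (\<alpha> ! i)"
    have "?f \<in> kmon S" using x by (intro kmon_prod kmon_power S) auto
    moreover have "degree ?f \<le> N * e"
    proof -
      have "degree ?f \<le> (\<Sum>i<Suc l. degree (x i ^ (\<alpha> ! i)))"
        by (rule degree_prod_sum_le[unfolded o_def]) simp
      also have "\<dots> \<le> (\<Sum>i<Suc l. N * degree (x i))"
      proof (rule sum_mono)
        fix i assume "i \<in> {..<Suc l}"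
        then have "\<alpha> ! i \<in> set \<alpha>" using that by (auto simp: I_def)
        then have "\<alpha> ! i \<le> N" using that by (auto simp: I_def)
        have "degree (x i ^ (\<alpha> ! i)) \<le> degree (x i) * (\<alpha> ! i)" by (rule degree_power_le)
        also have "\<dots> \<le> N * degree (x i)" using \<open>\<alpha> ! i \<le> N\<close> by (simp add: mult.commute)
        finally show "degree (x i ^ (\<alpha> ! i)) \<le> N * degree (x i)" .
      qed
      also have "\<dots> = N * e" unfolding e_def sum_distrib_left ..
      finally show ?thesis .
    qed
    ultimately show ?thesis using snd_le_degree[of _ ?f] unfolding kmon_iff T_def by fastforce
  qed
  have "\<exists>c. (\<exists>\<alpha>\<in>I. c \<alpha> \<noteq> 0) \<and> (\<Sum>\<alpha>\<in>I. kscale (c \<alpha>) (\<Prod>i<Suc l. x i ^ (\<alpha> ! i))) = 0"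
    by (rule linear_dependence_family[OF finT I(1) card mem])
  then obtain c where c: "\<exists>\<alpha>\<in>I. c \<alpha> \<noteq> 0" "(\<Sum>\<alpha>\<in>I. kscale (c \<alpha>) (\<Prod>i<Suc l. x i ^ (\<alpha> ! i))) = 0"
    by (elim exE conjE)
  have "(\<Sum>\<alpha> | \<alpha> \<in> I \<and> c \<alpha> \<noteq> 0. kscale (c \<alpha>) (\<Prod>i<Suc l. x i ^ (\<alpha> ! i))) = 0"
    unfolding c(2)[symmetric] using I(1) by (intro sum.mono_neutral_left) auto
  moreover have "finite {\<alpha>. \<alpha> \<in> I \<and> c \<alpha> \<noteq> 0}" using I(1) by simp
  moreover have "\<forall>\<alpha>\<in>{\<alpha>. \<alpha> \<in> I \<and> c \<alpha> \<noteq> 0}. length \<alpha> = Suc l \<and> c \<alpha> \<noteq> 0" by (simp add: I_def)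
  moreover have "{\<alpha>. \<alpha> \<in> I \<and> c \<alpha> \<noteq> 0} \<noteq> {}" using c(1) by blast
  ultimately show ?thesis by (intro exI[of _ "{\<alpha>. \<alpha> \<in> I \<and> c \<alpha> \<noteq> 0}"] exI[of _ c] conjI)
qed

text \<open>A longer chain would provide \<open>l + 1\<close> elements, one from each step. Their
  algebraic relation has value 0, which lies in the first prime, against
  \<open>prime_chain_monomials\<close>.\<close>

lemma prime_chain_bound:
  fixes \<pp> :: "nat \<Rightarrow> ('i::linorder, 'k::field) polyz set"
  assumes S: "add_closed S" and fin: "\<And>D. finite {s \<in> S. snd s \<le> D}"
    and bound: "\<And>D. card {s \<in> S. snd s \<le> D} \<le> C * (D + 1) ^ l"
    and \<pp>: "\<And>i. i \<le> n \<Longrightarrow> primeideal (\<pp> i) (ring_of (kmon S))" "\<And>i. i < n \<Longrightarrow> \<pp> i \<subset> \<pp> (Suc i)"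
  shows "n \<le> l"
proof (rule ccontr)
  assume "\<not> n \<le> l"
  then have n: "Suc l \<le> n" by simp
  have "\<forall>i\<in>{..<Suc l}. \<exists>y. y \<in> \<pp> (Suc i) - \<pp> i"
  proof
    fix i assume "i \<in> {..<Suc l}"
    then have "\<pp> i \<subset> \<pp> (Suc i)" using n by (intro \<pp>(2)) simp
    then show "\<exists>y. y \<in> \<pp> (Suc i) - \<pp> i" by blast
  qed
  from bchoice[OF this] obtain x where x: "\<forall>i\<in>{..<Suc l}. x i \<in> \<pp> (Suc i) - \<pp> i" ..
  have "x i \<in> kmon S" if "i < Suc l" for i
    using x that n primeideal_ring_ofD(1)[OF \<pp>(1)[of "Suc i"]] by auto
  then have "\<exists>E c. finite E \<and> E \<noteq> {} \<and> (\<forall>\<alpha>\<in>E. length \<alpha> = Suc l \<and> c \<alpha> \<noteq> 0) \<and>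
      (\<Sum>\<alpha>\<in>E. kscale (c \<alpha>) (\<Prod>i<Suc l. x i ^ (\<alpha> ! i))) = 0"
    by (rule algebraic_dependence[OF S fin bound])
  then obtain E c where Ec: "finite E \<and> E \<noteq> {} \<and> (\<forall>\<alpha>\<in>E. length \<alpha> = Suc l \<and> c \<alpha> \<noteq> 0) \<and>
      (\<Sum>\<alpha>\<in>E. kscale (c \<alpha>) (\<Prod>i<Suc l. x i ^ (\<alpha> ! i))) = 0"
    by (elim exE)
  then have E: "finite E" "E \<noteq> {}" "\<forall>\<alpha>\<in>E. length \<alpha> = Suc l \<and> c \<alpha> \<noteq> 0"
    and zero: "(\<Sum>\<alpha>\<in>E. kscale (c \<alpha>) (\<Prod>i<Suc l. x i ^ (\<alpha> ! i))) = 0" by blast+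
  have "(\<Sum>\<alpha>\<in>E. kscale (c \<alpha>) (\<Prod>i<Suc l. x i ^ (\<alpha> ! i))) \<notin> \<pp> 0"
  proof (rule prime_chain_monomials[of "kmon S"])
    show "\<pp> i \<subseteq> \<pp> (Suc i)" if "i < Suc l" for i using \<pp>(2)[of i] that n by auto
  qed (use x E \<pp>(1) n subring_kmon[OF S] kmon_kconst[OF S] in auto)
  then show False unfolding zero using primeideal_ring_ofD(2)[OF \<pp>(1)[of 0]] by simp
qed

section \<open>Primes from faces\<close>

text \<open>Modulo \<open>kmon (S - \<Phi>)\<close> only the terms with exponents in
  \<open>\<Phi>\<close> survive, and they form the domain \<open>kmon \<Phi>\<close>. A product of
  two such parts has its support both in \<open>\<Phi>\<close> and, if it lies in the ideal,
  outside, so one factor is 0.\<close>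

lemma kmon_prime:
  fixes S \<Phi> :: "'i::linorder expo set"
  assumes S: "add_closed S" and \<Phi>: "\<Phi> \<subseteq> S" "0 \<in> \<Phi>" and face: "\<And>s t. s \<in> S \<Longrightarrow> t \<in> S \<Longrightarrow> s + t \<in> \<Phi> \<longleftrightarrow> s \<in> \<Phi> \<and> t \<in> \<Phi>"
  shows "primeideal (kmon (S - \<Phi>) :: ('i, 'k::field) polyz set) (ring_of (kmon S))"
proof (rule primeideal_ring_ofI[OF subring_kmon[OF S]])
  show "kmon (S - \<Phi>) \<subseteq> (kmon S :: ('i, 'k) polyz set)" by (rule kmon_mono) blast
  have mult: "f * g \<in> kmon (S - \<Phi>)" if "f \<in> kmon S" "g \<in> kmon (S - \<Phi>)" for f g :: "('i, 'k) polyz"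
    unfolding kmon_iff
  proof
    fix r assume "r \<in> msupp (f * g)"
    then obtain s t where "r = s + t" "s \<in> msupp f" "t \<in> msupp g" using msupp_mult[of f g] by blast
    then have "s \<in> S" "t \<in> S" "t \<notin> \<Phi>" "r = s + t" using that unfolding kmon_iff by blast+
    then show "r \<in> S - \<Phi>" using face[of s t] add_closedD[OF S, of s t] by simp
  qed
  then show "f * g \<in> kmon (S - \<Phi>)" if "f \<in> kmon S" "g \<in> kmon (S - \<Phi>)" for f g :: "('i, 'k) polyz"
    using that by blast
  show "(1 :: ('i, 'k) polyz) \<notin> kmon (S - \<Phi>)" using \<Phi>(2) unfolding mon_0[symmetric] by simp
  have split: "\<exists>f1. f1 \<in> kmon \<Phi> \<and> f - f1 \<in> kmon (S - \<Phi>)" if "f \<in> kmon S" for f :: "('i, 'k) polyz"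
  proof (intro exI conjI)
    let ?h = "\<lambda>X. \<Sum>s\<in>X. kscale (mcoeff f s) (mon s)"
    show "?h (msupp f \<inter> \<Phi>) \<in> kmon \<Phi>" by (intro kmon_sum kmon_kscale) auto
    have "?h (msupp f) = ?h (msupp f \<inter> \<Phi>) + ?h (msupp f - \<Phi>)"
      by (subst sum.Int_Diff[of _ _ \<Phi>]) auto
    from trans[OF polyz_expand this] have "f - ?h (msupp f \<inter> \<Phi>) = ?h (msupp f - \<Phi>)"
      by (metis (no_types) add_diff_cancel_left')
    moreover have "?h (msupp f - \<Phi>) \<in> kmon (S - \<Phi>)"
      using that unfolding kmon_iff[of f] by (intro kmon_sum kmon_kscale) auto
    ultimately show "f - ?h (msupp f \<inter> \<Phi>) \<in> kmon (S - \<Phi>)" by simp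
  qed
  show "f \<in> kmon (S - \<Phi>) \<or> g \<in> kmon (S - \<Phi>)"
    if f: "f \<in> kmon S" and g: "g \<in> kmon S" and fg: "f * g \<in> kmon (S - \<Phi>)" for f g :: "('i, 'k) polyz"
  proof -
    obtain f1 where f1: "f1 \<in> kmon \<Phi>" "f - f1 \<in> kmon (S - \<Phi>)" using split[OF f] by blast
    obtain g1 where g1: "g1 \<in> kmon \<Phi>" "g - g1 \<in> kmon (S - \<Phi>)" using split[OF g] by blast
    have "f1 * g1 = f * g - g * (f - f1) - f1 * (g - g1)" by (simp add: algebra_simps)
    also have "\<dots> \<in> kmon (S - \<Phi>)"
      using fg mult[OF g f1(2)] mult[OF subsetD[OF kmon_mono[OF \<Phi>(1)] f1(1)] g1(2)] by (intro kmon_diff)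
    finally have 1: "msupp (f1 * g1) \<subseteq> S - \<Phi>" unfolding kmon_iff .
    have "add_closed \<Phi>" unfolding add_closed_def using \<Phi> face by blast
    then have "msupp (f1 * g1) \<subseteq> \<Phi>" using kmon_mult[OF _ f1(1) g1(1)] unfolding kmon_iff by blast
    with 1 have "msupp (f1 * g1) = {}" by blast
    then have "f1 = 0 \<or> g1 = 0" by simp
    then show ?thesis using f1(2) g1(2) by auto
  qed
qed (auto intro: kmon_add)

text \<open>Pass to a facet repeatedly. The empty face, of dimension -1, counts as the bottom, so a
  polytope of dimension \<open>n - 1\<close> has a chain of \<open>n + 1\<close> faces.\<close>

lemma polytope_face_chain:
  fixes p :: "'a::euclidean_space set"
  assumes "polytope p" "aff_dim p = int n - 1"
  shows "\<exists>F. (\<forall>i\<le>n. F i face_of p) \<and> (\<forall>i<n. F i \<subset> F (Suc i))"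
  using assms
proof (induction n arbitrary: p)
  case 0
  then have "p = {}" by (simp add: aff_dim_empty)
  then show ?case by (intro exI[of _ "\<lambda>_. {}"]) simp
next
  case (Suc n)
  have convex: "convex p" using Suc.prems(1) by (rule polytope_imp_convex)
  have "\<exists>f. f face_of p \<and> polytope f \<and> aff_dim f = int n - 1"
  proof (cases "n = 0")
    case True
    moreover have "polytope ({} :: 'a set)" unfolding polytope_def by (intro exI[of _ "{}"]) simp
    ultimately show ?thesis by (intro exI[of _ "{}"]) simp
  next
    case False
    then obtain f where "f facet_of p" using polytope_facet_exists[OF Suc.prems(1)] Suc.prems(2) by auto
    then show ?thesis using face_of_polytope_polytope[OF Suc.prems(1)] Suc.prems(2)
      by (intro exI[of _ f]) (auto simp: facet_of_def)
  qed
  then obtain f where f: "f face_of p" "polytope f" "aff_dim f = int n - 1" by blast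
  obtain F where F: "\<forall>i\<le>n. F i face_of f" "\<forall>i<n. F i \<subset> F (Suc i)" using Suc.IH[OF f(2,3)] by blast
  have fp: "f \<subset> p" using face_of_imp_subset[OF f(1)] f(3) Suc.prems(2) by auto
  show ?case
  proof (intro exI[of _ "F(Suc n := p)"] conjI allI impI)
    show "(F(Suc n := p)) i face_of p" if "i \<le> Suc n" for i
      using that F(1) face_of_trans[OF _ f(1)] face_of_refl[OF convex] by (auto simp: le_Suc_eq)
    show "(F(Suc n := p)) i \<subset> (F(Suc n := p)) (Suc i)" if "i < Suc n" for i
      using that F face_of_imp_subset[of "F n" f] fp by (auto simp: less_Suc_eq)
  qed
qed

context weighted_polytope
begin

text \<open>The exponents in the cone over \<open>F\<close>. Degree 0 is listed separately, so that
  the empty face gives \<open>{0}\<close> instead of the empty set.\<close>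

definition \<Phi> :: "(real ^ 'p) set \<Rightarrow> 'p expo set" where
  "\<Phi> F = {s \<in> S. snd s = 0 \<or> rvec (fst s) \<in> dilation (snd s) F}"

lemma S_degree_0: "s \<in> S \<Longrightarrow> snd s = 0 \<Longrightarrow> s = 0"
  using S_in_dilation_Q[of s] by (intro expo_eqI) (auto simp: dilation_def)

text \<open>Divided by the degrees, the sum becomes a point strictly between the points of the two
  summands, and a face contains such a point only together with both ends. Summands of degree 0 are
  0.\<close>

lemma \<Phi>_plus_iff:
  assumes F: "F face_of Q" and s: "s \<in> S" and t: "t \<in> S"
  shows "s + t \<in> \<Phi> F \<longleftrightarrow> s \<in> \<Phi> F \<and> t \<in> \<Phi> F"
proof (cases "snd s = 0 \<or> snd t = 0")
  case True
  moreover have "0 \<in> \<Phi> F" using add_closed_S by (auto simp: \<Phi>_def add_closed_def)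
  ultimately show ?thesis using S_degree_0[OF s] S_degree_0[OF t] by auto
next
  case False
  define a where "a = real (snd s)"
  define b where "b = real (snd t)"
  have ab: "a > 0" "b > 0" using False by (simp_all add: a_def b_def)
  obtain x where x: "x \<in> Q" "rvec (fst s) = a *\<^sub>R x" using S_in_dilation_Q[OF s] unfolding dilation_def a_def by blast
  obtain y where y: "y \<in> Q" "rvec (fst t) = b *\<^sub>R y" using S_in_dilation_Q[OF t] unfolding dilation_def b_def by blast
  define z where "z = (a / (a + b)) *\<^sub>R x + (b / (a + b)) *\<^sub>R y"
  have z: "rvec (fst (s + t)) = (a + b) *\<^sub>R z"
    using ab by (simp add: rvec_add x y z_def scaleR_add_right)
  have dil: "r *\<^sub>R w \<in> dilation n F \<longleftrightarrow> w \<in> F" if "r = real n" "r > 0" for r w n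
    using that by (auto simp: dilation_def)
  have s_iff: "s \<in> \<Phi> F \<longleftrightarrow> x \<in> F" using s False dil[of a "snd s" x] ab by (simp add: \<Phi>_def x a_def)
  have t_iff: "t \<in> \<Phi> F \<longleftrightarrow> y \<in> F" using t False dil[of b "snd t" y] ab by (simp add: \<Phi>_def y b_def)
  have st_iff: "s + t \<in> \<Phi> F \<longleftrightarrow> z \<in> F"
    using add_closedD[OF add_closed_S s t] False dil[of "a + b" "snd (s + t)" z] ab
    unfolding \<Phi>_def mem_Collect_eq z by (simp add: a_def b_def)
  have uv: "a / (a + b) + b / (a + b) = 1" using ab by (simp flip: add_divide_distrib)
  show ?thesis unfolding s_iff t_iff st_iff
  proof
    assume "x \<in> F \<and> y \<in> F"
    moreover have "convex F" using F face_of_imp_convex by blast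
    ultimately show "z \<in> F" unfolding z_def using ab uv by (intro convexD) auto
  next
    assume zF: "z \<in> F"
    show "x \<in> F \<and> y \<in> F"
    proof (cases "x = y")
      case True
      then have "z = x" unfolding z_def using uv by (metis scaleR_add_left scaleR_one)
      then show ?thesis using zF True by simp
    next
      case False
      have "z \<in> open_segment x y"
        unfolding in_segment z_def using False ab uv
        by (intro conjI exI[of _ "b / (a + b)"]) (auto simp: field_simps)
      then show ?thesis using F x(1) y(1) zF unfolding face_of_def by blast
    qed
  qed
qed

text \<open>A face is the hull of some of the points \<open>W (v i)\<close>. If it is not inside
  \<open>F\<close>, one of these points is not in \<open>F\<close>, and its \<open>u i\<close>
  separates the two ideals.\<close>

lemma \<Phi>_strict_mono:
  assumes "F face_of Q" "F' face_of Q" "F \<subset> F'"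
  shows "kmon (S - \<Phi> F') \<subset> (kmon (S - \<Phi> F) :: ('p, 'k::field) polyz set)"
proof -
  obtain S' where S': "S' \<subseteq> W ` v ` {1..m}" "F' = convex hull S'"
    using face_of_convex_hull_subset[of "W ` v ` {1..m}" F'] assms(2) unfolding Q_def by (auto simp: finite_imp_compact)
  have "\<not> S' \<subseteq> F"
  proof
    assume "S' \<subseteq> F"
    then have "F' \<subseteq> F" unfolding S'(2) using face_of_imp_convex[OF assms(1)] by (rule hull_minimal)
    then show False using assms(3) by blast
  qed
  then obtain i where i: "i \<in> {1..m}" "W (v i) \<in> F'" "W (v i) \<notin> F"
    using S' hull_inc[of _ S' convex] by blast
  have u: "rvec (fst (u i)) = W (v i)" "snd (u i) = 1" using i(1) v W_natural[of "v i"] by (auto simp: u_def)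
  have "u i \<in> \<Phi> F'" "u i \<notin> \<Phi> F"
    using u_in_S[OF i(1)] i(2,3) unfolding \<Phi>_def mem_Collect_eq u by (simp_all add: dilation_def)
  then have "mon (u i) \<in> (kmon (S - \<Phi> F) :: ('p, 'k) polyz set)" "mon (u i) \<notin> (kmon (S - \<Phi> F') :: ('p, 'k) polyz set)"
    using u_in_S[OF i(1)] by auto
  moreover have "\<Phi> F \<subseteq> \<Phi> F'" using assms(3) unfolding \<Phi>_def dilation_def by auto
  then have "kmon (S - \<Phi> F') \<subseteq> (kmon (S - \<Phi> F) :: ('p, 'k) polyz set)" by (intro kmon_mono) blast
  ultimately show ?thesis by blast
qed

end

lemma krull_dim_weighted:
  fixes v :: "nat \<Rightarrow> real ^ 's" and W :: "real ^ 's \<Rightarrow> (real, 'p::{finite,linorder}) Finite_Cartesian_Product.vec"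
  assumes "weighted_polytope v m W"
  shows "krull_dim (kmon (weighted_polytope.S v m W) :: ('p, 'k::field) polyz set) =
    enat (nat (aff_dim (weighted_polytope.Q v m W)) + 1)"
proof -
  interpret weighted_polytope v m W by fact
  let ?A = "kmon S :: ('p, 'k) polyz set"
  let ?d = "nat (aff_dim Q) + 1"
  define X where "X = {enat n | n. \<exists>\<pp>. (\<forall>i\<le>n. primeideal (\<pp> i) (ring_of ?A)) \<and> (\<forall>i<n. \<pp> i \<subset> \<pp> (Suc i))}"
  have "enat ?d \<in> X"
  proof -
    have "aff_dim Q \<ge> 0" using Q_nonempty aff_dim_geq[of Q] aff_dim_empty[of Q] by linarith
    then have "aff_dim Q = int ?d - 1" by simp
    moreover have "polytope Q" unfolding Q_def by (intro polytope_convex_hull) simp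
    ultimately have "\<exists>F. (\<forall>i\<le>?d. F i face_of Q) \<and> (\<forall>i<?d. F i \<subset> F (Suc i))"
      by (intro polytope_face_chain)
    then obtain F where F: "\<forall>i\<le>?d. F i face_of Q" "\<forall>i<?d. F i \<subset> F (Suc i)"
      by (elim exE conjE)
    \<comment> \<open>Larger faces give smaller ideals, so the chain of faces is read
      backwards.\<close>
    define \<pp> where "\<pp> i = (kmon (S - \<Phi> (F (?d - i))) :: ('p, 'k) polyz set)" for i
    have "primeideal (\<pp> i) (ring_of ?A)" for i
      unfolding \<pp>_def
    proof (rule kmon_prime[OF add_closed_S])
      show "0 \<in> \<Phi> (F (?d - i))" using add_closed_S by (auto simp: \<Phi>_def add_closed_def)
      show "s + t \<in> \<Phi> (F (?d - i)) \<longleftrightarrow> s \<in> \<Phi> (F (?d - i)) \<and> t \<in> \<Phi> (F (?d - i))" if "s \<in> S" "t \<in> S" for s t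
        using that by (intro \<Phi>_plus_iff F(1)[rule_format]) auto
    qed (auto simp: \<Phi>_def)
    moreover have "\<pp> i \<subset> \<pp> (Suc i)" if "i < ?d" for i
    proof -
      have "F (?d - Suc i) \<subset> F (Suc (?d - Suc i))" using that by (intro F(2)[rule_format]) auto
      moreover have "Suc (?d - Suc i) = ?d - i" using that by simp
      ultimately show ?thesis unfolding \<pp>_def by (intro \<Phi>_strict_mono F(1)[rule_format]) auto
    qed
    ultimately have chain: "(\<forall>i\<le>?d. primeideal (\<pp> i) (ring_of ?A)) \<and> (\<forall>i<?d. \<pp> i \<subset> \<pp> (Suc i))"
      by blast
    show ?thesis unfolding X_def mem_Collect_eq
      by (rule exI[of _ ?d], rule conjI[OF refl], rule exI[of _ \<pp>], rule chain)
  qed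
  moreover have "x \<le> enat ?d" if "x \<in> X" for x
  proof -
    from that obtain n where n0: "x = enat n \<and> (\<exists>\<pp>. (\<forall>i\<le>n. primeideal (\<pp> i) (ring_of ?A)) \<and> (\<forall>i<n. \<pp> i \<subset> \<pp> (Suc i)))"
      unfolding X_def mem_Collect_eq ..
    from conjunct2[OF n0] obtain \<pp> where pp: "(\<forall>i\<le>n. primeideal (\<pp> i) (ring_of ?A)) \<and> (\<forall>i<n. \<pp> i \<subset> \<pp> (Suc i))" ..
    note n = conjunct1[OF n0] conjunct1[OF pp] conjunct2[OF pp]
    obtain B where B: "\<And>n. card {s \<in> S. snd s = n} \<le> (B * n + 1) ^ nat (aff_dim Q)" using card_slice_upper by blast
    \<comment> \<open>Summation over the degrees up to \<open>D\<close> contributes one more factor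
      \<open>D + 1\<close>, which raises the exponent from \<open>dim Q\<close> to
      \<open>?d\<close>.\<close>
    have bound: "card {s \<in> S. snd s \<le> D} \<le> (B + 1) ^ nat (aff_dim Q) * (D + 1) ^ ?d" for D
    proof -
      have "{s \<in> S. snd s \<le> D} = (\<Union>n\<le>D. {s \<in> S. snd s = n})" by auto
      then have "card {s \<in> S. snd s \<le> D} \<le> (\<Sum>n\<le>D. card {s \<in> S. snd s = n})"
        by (simp add: card_UN_le)
      also have "\<dots> \<le> (\<Sum>n\<le>D. ((B + 1) * (D + 1)) ^ nat (aff_dim Q))"
      proof (rule sum_mono)
        fix n assume "n \<in> {..D}"
        then have "B * n \<le> B * D" by (intro mult_le_mono2) simp
        moreover have "(B + 1) * (D + 1) = B * D + B + D + 1" by simp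
        ultimately have "B * n + 1 \<le> (B + 1) * (D + 1)" by linarith
        then show "card {s \<in> S. snd s = n} \<le> ((B + 1) * (D + 1)) ^ nat (aff_dim Q)"
          using B[of n] power_mono[of "B * n + 1" "(B + 1) * (D + 1)" "nat (aff_dim Q)"] by linarith
      qed
      also have "\<dots> = (B + 1) ^ nat (aff_dim Q) * (D + 1) ^ ?d"
        by (simp only: sum_constant card_atMost of_nat_id power_mult_distrib power_add power_one_right Suc_eq_plus1 mult_ac)
      finally show ?thesis .
    qed
    have "n \<le> ?d"
      by (rule prime_chain_bound[where \<pp> = \<pp>, OF add_closed_S finite_S_le bound]) (use n in simp_all)
    then show ?thesis by (simp add: n(1))
  qed
  ultimately have "Sup X = enat ?d" by (intro Sup_eqI) auto
  then show ?thesis unfolding krull_dim_def X_def .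
qed

section \<open>Integral closures\<close>

lemma ehrhart_S_iff:
  assumes "weighted_polytope v m (\<lambda>x. x)"
  shows "s \<in> weighted_polytope.S v m (\<lambda>x. x) \<longleftrightarrow> rvec (fst s) \<in> dilation (snd s) (weighted_polytope.P v m)"
proof -
  interpret weighted_polytope v m "\<lambda>x. x" by fact
  show ?thesis
  proof
    assume "s \<in> S"
    then obtain a n where s: "s = (exponent a, n)" "a \<in> lattice_points (dilation n P)" unfolding S_def by blast
    then have "rvec (exponent a) = a" using lattice_points_natural by (intro rvec_exponent) blast
    then show "rvec (fst s) \<in> dilation (snd s) P" using s by (simp add: lattice_points_def)
  next
    assume "rvec (fst s) \<in> dilation (snd s) P"
    then have "rvec (fst s) \<in> lattice_points (dilation (snd s) P)" by (simp add: lattice_points_def)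
    moreover have "s = (exponent (rvec (fst s)), snd s)" by simp
    ultimately show "s \<in> S" unfolding S_def by blast
  qed
qed

text \<open>Let \<open>b\<close> be the difference of \<open>s\<close> and \<open>t\<close>, of
  degree \<open>e\<close>, and \<open>k\<close> the degree of \<open>x\<close>. The points
  \<open>(x + n b) / (k + n e)\<close> lie in the closed set \<open>P\<close> and converge to
  \<open>b / e\<close>. For \<open>e = 0\<close>, boundedness forces \<open>b = 0\<close>.\<close>

lemma ehrhart_closed:
  assumes wp: "weighted_polytope v m (\<lambda>x. x)"
    and r: "\<And>n. \<exists>r\<in>weighted_polytope.S v m (\<lambda>x. x). x + nmult n s = nmult n t + r"
  shows "\<exists>d\<in>weighted_polytope.S v m (\<lambda>x. x). s = t + d"
proof -
  interpret weighted_polytope v m "\<lambda>x. x" by fact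
  note S_iff = ehrhart_S_iff[OF wp]
  define b where "b = rvec (fst s) - rvec (fst t)"
  define k where "k = snd x"
  obtain \<rho> where \<rho>: "\<And>n. \<rho> n \<in> S" "\<And>n. x + nmult n s = nmult n t + \<rho> n"
    using r by metis
  have snd_\<rho>: "k + n * snd s = n * snd t + snd (\<rho> n)" for n
    using arg_cong[OF \<rho>(2)[of n], of snd] by (simp add: snd_nmult k_def)
  have rvec_\<rho>: "rvec (fst (\<rho> n)) = rvec (fst x) + real n *\<^sub>R b" for n
    using arg_cong[OF \<rho>(2)[of n], of "\<lambda>s. rvec (fst s)"]
    by (simp add: rvec_add fst_nmult rvec_nmult b_def scaleR_diff_right algebra_simps)
  have le: "snd t \<le> snd s"
  proof (rule ccontr)
    assume "\<not> snd t \<le> snd s"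
    \<comment> \<open>If \<open>s\<close> had smaller degree than \<open>t\<close>, then
      \<open>k + 1\<close> steps would use up the degree \<open>k\<close> of
      \<open>x\<close>.\<close>
    then have "Suc k * Suc (snd s) \<le> Suc k * snd t" by (intro mult_le_mono2) simp
    then show False using snd_\<rho>[of "Suc k"] by simp
  qed
  define e where "e = snd s - snd t"
  have snd_\<rho>': "snd (\<rho> n) = k + n * e" for n
    using snd_\<rho>[of n] le by (simp add: e_def diff_mult_distrib2)
  have mem: "rvec (fst x) + real n *\<^sub>R b \<in> dilation (k + n * e) P" for n
    using \<rho>(1)[of n] unfolding S_iff rvec_\<rho> snd_\<rho>' .
  have "b \<in> dilation e P"
  proof (cases "e = 0")
    case True
    obtain M where M: "\<And>y. y \<in> dilation k P \<Longrightarrow> norm y \<le> M"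
      using bounded_dilation[OF bounded_P, of k] unfolding bounded_iff by blast
    have "b = 0"
    proof (rule ccontr)
      assume "b \<noteq> 0"
      obtain n :: nat where n: "(M + norm (rvec (fst x))) / norm b < real n" using reals_Archimedean2 by blast
      have "real n * norm b = norm (real n *\<^sub>R b)" by simp
      also have "\<dots> \<le> norm (rvec (fst x) + real n *\<^sub>R b) + norm (rvec (fst x))"
        using norm_triangle_ineq4[of "rvec (fst x) + real n *\<^sub>R b" "rvec (fst x)"] by simp
      also have "\<dots> \<le> M + norm (rvec (fst x))" using M[of "rvec (fst x) + real n *\<^sub>R b"] mem[of n] True by simp
      finally show False using n \<open>b \<noteq> 0\<close> by (simp add: field_simps)
    qed
    moreover have "0 \<in> dilation 0 P" unfolding dilation_P by (intro exI[of _ "\<lambda>_. 0"]) simp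
    ultimately show ?thesis using True by simp
  next
    case False
    have e: "real e > 0" using False by simp
    \<comment> \<open>\<open>Suc n\<close> keeps the denominators positive even for
      \<open>k = 0\<close>.\<close>
    define y where "y n = (1 / (real k + real (Suc n) * real e)) *\<^sub>R (rvec (fst x) + real (Suc n) *\<^sub>R b)" for n
    have "y n \<in> P" for n
    proof -
      obtain q where q: "q \<in> P" "rvec (fst x) + real (Suc n) *\<^sub>R b = real (k + Suc n * e) *\<^sub>R q"
        using mem[of "Suc n"] unfolding dilation_def by blast
      have "real (k + Suc n * e) = real k + real (Suc n) * real e" by (simp add: algebra_simps)
      moreover have "real k + real (Suc n) * real e \<noteq> 0" using e by (smt (verit) mult_pos_pos of_nat_0_le_iff of_nat_0_less_iff zero_less_Suc)
      ultimately have "y n = q" unfolding y_def q(2) by simp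
      then show ?thesis using q(1) by simp
    qed
    moreover have "y \<longlonglongrightarrow> (1 / real e) *\<^sub>R b"
    proof -
      have "(\<lambda>n. 1 / (real k + real (Suc n) * real e)) \<longlonglongrightarrow> 0" using e by real_asymp
      moreover have "(\<lambda>n. real (Suc n) / (real k + real (Suc n) * real e)) \<longlonglongrightarrow> inverse (real e)" using e by real_asymp
      ultimately have "(\<lambda>n. (1 / (real k + real (Suc n) * real e)) *\<^sub>R rvec (fst x) +
          (real (Suc n) / (real k + real (Suc n) * real e)) *\<^sub>R b) \<longlonglongrightarrow> 0 *\<^sub>R rvec (fst x) + inverse (real e) *\<^sub>R b"
        by (intro tendsto_add tendsto_scaleR tendsto_const)
      then show ?thesis unfolding y_def by (simp add: scaleR_add_right inverse_eq_divide)
    qed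
    moreover have "closed P" unfolding P_def by (intro compact_imp_closed finite_imp_compact_convex_hull) simp
    ultimately have "(1 / real e) *\<^sub>R b \<in> P" using closed_sequentially by blast
    moreover have "b = real e *\<^sub>R ((1 / real e) *\<^sub>R b)" using e by simp
    ultimately show ?thesis unfolding dilation_def by blast
  qed
  moreover have "b $ j \<in> \<int>" for j unfolding b_def by simp
  ultimately have "b \<in> lattice_points (dilation e P)" by (simp add: lattice_points_def)
  then have "(exponent b, e) \<in> S" "b \<in> natural_vectors" using lattice_points_natural unfolding S_def by auto
  moreover from this(2) have "s = t + (exponent b, e)"
    using le by (intro expo_eqI) (simp_all add: rvec_add, simp_all add: b_def e_def)
  ultimately show ?thesis by blast
qed

lemma subset_fraction_field: "A \<subseteq> B \<Longrightarrow> fraction_field_of A \<subseteq> fraction_field_of B"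
  unfolding fraction_field_of_def by blast

lemma integral_closure_mono: "A \<subseteq> B \<Longrightarrow> integral_closure A \<subseteq> integral_closure B"
  unfolding integral_closure_def
  using subset_fraction_field[of A B] integral_over_mono[of "to_frac ` A" _ "to_frac ` B"] by blast

locale weighted_polytope_lin = weighted_polytope v m W
  for v :: "nat \<Rightarrow> real ^ 's" and m :: nat and W :: "real ^ 's \<Rightarrow> (real, 'p::{finite,linorder}) Finite_Cartesian_Product.vec"
begin

lemma weighted_polytope_image: "weighted_polytope (\<lambda>i. W (v i)) m (\<lambda>x. x)"
  using m v W_natural by unfold_locales (auto simp: linear_iff)

text \<open>The exponents of \<open>A(w(P))\<close>. Its submonoid generated in degree 1 by the
  points is again \<open>G\<close>, so \<open>E.finite_extension_kmon\<close> makes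
  \<open>A(w(P))\<close> finite over \<open>L\<close>.\<close>

sublocale E: weighted_polytope "\<lambda>i. W (v i)" m "\<lambda>x. x"
  by (rule weighted_polytope_image)

lemma E_P: "E.P = Q"
  unfolding E.P_def Q_def image_image ..

lemma E_S_iff: "s \<in> E.S \<longleftrightarrow> rvec (fst s) \<in> dilation (snd s) Q"
  unfolding ehrhart_S_iff[OF weighted_polytope_image] E_P ..

lemma E_u: "E.u = u"
  by (rule ext) (simp add: E.u_def u_def)

lemma E_G: "E.G = G"
  unfolding E.G_def G_def E_u ..

lemma S_subset_E: "S \<subseteq> E.S"
  using S_in_dilation_Q by (auto simp: E_S_iff)

text \<open>A fraction that is integral over \<open>kmon S\<close> is almost integral over the
  larger ring \<open>kmon E.S\<close>, with the same multiplier, and \<open>normal_kmon\<close>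
  carries out the division there.\<close>

lemma integral_closure_subset_ehrhart:
  "integral_closure (kmon S :: ('p, 'k::field) polyz set) \<subseteq> to_frac ` kmon E.S"
proof
  fix x assume x: "x \<in> integral_closure (kmon S :: ('p, 'k) polyz set)"
  then obtain f g where fg: "x = Fraction_Field.Fract f g" "f \<in> kmon S" "g \<in> kmon S" "g \<noteq> 0"
    and int: "integral_over (to_frac ` kmon S) x"
    unfolding integral_closure_def fraction_field_of_def by blast
  obtain c where c: "c \<noteq> 0" "\<And>n. \<exists>r\<in>kmon S. c * f ^ n = g ^ n * r"
    using integral_over_almost_integral[OF subring_kmon[OF add_closed_S] int[unfolded fg(1)] fg(2-4)] by blast
  have "\<exists>h\<in>kmon E.S. f = g * h"
  proof (rule normal_kmon[OF E.add_closed_S ehrhart_closed[OF weighted_polytope_image] E.finite_S_le fg(4) c(1)])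
    show "\<exists>r\<in>kmon E.S. c * f ^ n = g ^ n * r" for n
      using c(2)[of n] kmon_mono[OF S_subset_E] by blast
  qed
  then obtain h where h: "h \<in> kmon E.S" "f = g * h" by blast
  have "x = to_frac h" using fg(4) unfolding fg(1) h(2) to_frac_def by (simp add: eq_fract mult.commute)
  then show "x \<in> to_frac ` kmon E.S" using h(1) by blast
qed

section \<open>Exponents and the lattice of the columns of \<open>B\<close>\<close>

text \<open>The enumeration is that of the rows of \<open>weight_matrix\<close>, with the z-degree
  in the place of the row of ones.\<close>

definition coord :: "nat \<Rightarrow> 'p expo \<Rightarrow> int" where
  "coord i s = (if i < CARD('p) then int (Poly_Mapping.lookup (fst s) (sorted_list_of_set UNIV ! i)) else int (snd s))"

lemma coord_add: "coord i (s + t) = coord i s + coord i t"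
  by (simp add: coord_def lookup_add)

lemma coord_0: "coord i 0 = 0"
  by (simp add: coord_def)

lemma coord_nmult: "coord i (nmult n s) = int n * coord i s"
  by (induction n) (simp_all add: coord_add coord_0 ring_distribs)

lemma coord_sum: "coord i (sum f X) = (\<Sum>x\<in>X. coord i (f x))"
  by (induction X rule: infinite_finite_induct) (simp_all add: coord_add coord_0)

lemma coord_eqI:
  assumes "\<And>i. i < CARD('p) + 1 \<Longrightarrow> coord i s = coord i t"
  shows "s = t"
proof -
  have "Poly_Mapping.lookup (fst s) j = Poly_Mapping.lookup (fst t) j" for j
  proof -
    have "j \<in> set (sorted_list_of_set (UNIV :: 'p set))" by simp
    then obtain i where i: "i < CARD('p)" "sorted_list_of_set UNIV ! i = j"
      unfolding in_set_conv_nth by auto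
    then show ?thesis using assms[of i] by (simp add: coord_def)
  qed
  then have "fst s = fst t" by (rule poly_mapping_eqI)
  moreover have "snd s = snd t" using assms[of "CARD('p)"] by (simp add: coord_def)
  ultimately show ?thesis by (simp add: prod_eq_iff)
qed

lemma dim_weight_matrix: "dim_row (weight_matrix W v m) = CARD('p) + 1" "dim_col (weight_matrix W v m) = m"
  by (simp_all add: weight_matrix_def)

lemma weight_matrix_coord:
  assumes "i < CARD('p) + 1" "j < m"
  shows "weight_matrix W v m $$ (i, j) = coord i (u (Suc j))"
proof -
  have "W (v (Suc j)) \<in> natural_vectors" using assms(2) by (intro W_natural v) auto
  then show ?thesis using assms
    by (auto simp: weight_matrix_def coord_def u_def lookup_exponent natural_vectors_iff)
qed

lemma sum_shift: "(\<Sum>i\<in>{1..m}. f i) = (\<Sum>j<m. f (Suc j))"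
  by (rule sum.reindex_bij_witness[of _ Suc "\<lambda>i. i - 1"]) auto

lemma coord_G:
  assumes "g \<in> G"
  shows "\<exists>k. \<forall>i<CARD('p) + 1. coord i g = (\<Sum>j<m. int (k j) * weight_matrix W v m $$ (i, j))"
proof -
  obtain k where k: "g = (\<Sum>i\<in>{1..m}. nmult (k i) (u i))"
    using assms unfolding G_def by (subst (asm) monoid_gen_image) auto
  show ?thesis
  proof (intro exI[of _ "\<lambda>j. k (Suc j)"] allI impI)
    show "coord i g = (\<Sum>j<m. int (k (Suc j)) * weight_matrix W v m $$ (i, j))" if "i < CARD('p) + 1" for i
      unfolding k sum_shift coord_sum coord_nmult using that by (intro sum.cong refl) (simp add: weight_matrix_coord)
  qed
qed

lemma real_coord_E:
  assumes "s \<in> E.S"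
  shows "\<exists>\<mu>. \<forall>i<CARD('p) + 1. real_of_int (coord i s) = (\<Sum>j<m. \<mu> j * real_of_int (weight_matrix W v m $$ (i, j)))"
proof -
  obtain c where c: "sum c {1..m} = real (snd s)" "rvec (fst s) = (\<Sum>i\<in>{1..m}. c i *\<^sub>R W (v i))"
    using assms unfolding E_S_iff dilation_Q by blast
  show ?thesis
  proof (intro exI[of _ "\<lambda>j. c (Suc j)"] allI impI)
    fix i assume i: "i < CARD('p) + 1"
    have "real_of_int (coord i s) = (\<Sum>j<m. c (Suc j) * real_of_int (coord i (u (Suc j))))"
    proof (cases "i < CARD('p)")
      case True
      let ?q = "sorted_list_of_set (UNIV :: 'p set) ! i"
      have "real_of_int (coord i s) = rvec (fst s) $ ?q" using True by (simp add: coord_def)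
      also have "\<dots> = (\<Sum>i\<in>{1..m}. c i * W (v i) $ ?q)" unfolding c(2) by simp
      also have "\<dots> = (\<Sum>j<m. c (Suc j) * W (v (Suc j)) $ ?q)" by (rule sum_shift)
      also have "\<dots> = (\<Sum>j<m. c (Suc j) * real_of_int (coord i (u (Suc j))))"
      proof (intro sum.cong refl)
        fix j assume "j \<in> {..<m}"
        then have "rvec (exponent (W (v (Suc j)))) = W (v (Suc j))" by (intro rvec_exponent W_natural v) auto
        from arg_cong[OF this, of "\<lambda>x. x $ ?q"]
        show "c (Suc j) * W (v (Suc j)) $ ?q = c (Suc j) * real_of_int (coord i (u (Suc j)))"
          using True by (simp add: coord_def u_def)
      qed
      finally show ?thesis .
    next
      case False
      then show ?thesis using c(1) unfolding sum_shift by (simp add: coord_def u_def)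
    qed
    also have "\<dots> = (\<Sum>j<m. c (Suc j) * real_of_int (weight_matrix W v m $$ (i, j)))"
      using i by (intro sum.cong refl) (simp add: weight_matrix_coord)
    finally show "real_of_int (coord i s) = (\<Sum>j<m. c (Suc j) * real_of_int (weight_matrix W v m $$ (i, j)))" .
  qed
qed

text \<open>Saturation writes \<open>s\<close> with integral coefficients in the \<open>u i\<close>;
  moving the negative ones to the other side makes \<open>s\<close> a difference of two elements of
  \<open>G\<close>.\<close>

lemma saturated_imp_fraction:
  assumes sat: "saturated (weight_matrix W v m)" and s: "s \<in> E.S"
  shows "\<exists>g\<in>G. s + g \<in> G"
proof -
  obtain \<mu> where "\<forall>i<CARD('p) + 1. real_of_int (coord i s) = (\<Sum>j<m. \<mu> j * real_of_int (weight_matrix W v m $$ (i, j)))"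
    using real_coord_E[OF s] by (elim exE)
  then obtain c :: "nat \<Rightarrow> int" where c: "\<And>i. i < CARD('p) + 1 \<Longrightarrow> coord i s = (\<Sum>j<m. c j * weight_matrix W v m $$ (i, j))"
    using sat[unfolded saturated_def dim_weight_matrix, rule_format, of "\<lambda>i. coord i s" \<mu>] by blast
  define g where "g = (\<Sum>i\<in>{1..m}. nmult (nat (- c (i - 1))) (u i))"
  define h where "h = (\<Sum>i\<in>{1..m}. nmult (nat (c (i - 1))) (u i))"
  have "s + g = h"
  proof (rule coord_eqI)
    fix i assume i: "i < CARD('p) + 1"
    have "coord i g = (\<Sum>j<m. int (nat (- c j)) * weight_matrix W v m $$ (i, j))"
      unfolding g_def sum_shift coord_sum coord_nmult using i by (intro sum.cong refl) (simp add: weight_matrix_coord)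
    moreover have "coord i h = (\<Sum>j<m. int (nat (c j)) * weight_matrix W v m $$ (i, j))"
      unfolding h_def sum_shift coord_sum coord_nmult using i by (intro sum.cong refl) (simp add: weight_matrix_coord)
    moreover have "c j + int (nat (- c j)) = int (nat (c j))" for j by simp
    ultimately show "coord i (s + g) = coord i h"
      unfolding coord_add c[OF i] by (simp flip: sum.distrib distrib_right)
  qed
  moreover have "g \<in> G" "h \<in> G" unfolding g_def h_def G_def by (subst monoid_gen_image; auto)+
  ultimately show ?thesis by blast
qed

text \<open>Adding up the shifts of the finitely many exponents of \<open>f\<close> gives one
  monomial as common denominator, so \<open>f\<close> is a fraction over \<open>kmon G\<close>.
  Integrality holds because \<open>kmon E.S\<close> is finite over \<open>kmon G\<close>.\<close>

lemma saturated_imp_ehrhart_subset: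
  assumes sat: "saturated (weight_matrix W v m)"
  shows "to_frac ` kmon E.S \<subseteq> integral_closure (kmon G :: ('p, 'k::field) polyz set)"
proof
  fix y assume "y \<in> to_frac ` (kmon E.S :: ('p, 'k) polyz set)"
  then obtain f :: "('p, 'k) polyz" where f: "f \<in> kmon E.S" "y = to_frac f" by blast
  have addG: "add_closed G" unfolding G_def by (rule add_closed_monoid_gen)
  have "\<exists>g\<in>G. \<forall>s\<in>X. s + g \<in> G" if "finite X" "X \<subseteq> E.S" for X
    using that
  proof (induction X)
    case empty
    have "0 \<in> G" using addG by (simp add: add_closed_def)
    then show ?case by blast
  next
    case (insert x X)
    then obtain g where g: "g \<in> G" "\<forall>s\<in>X. s + g \<in> G" by blast
    obtain h where h: "h \<in> G" "x + h \<in> G" using saturated_imp_fraction[OF sat, of x] insert.prems by blast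
    have "x + (g + h) \<in> G" using add_closedD[OF addG h(2) g(1)] by (simp add: ac_simps)
    moreover have "s + (g + h) \<in> G" if "s \<in> X" for s
      using add_closedD[OF addG bspec[OF g(2) that] h(1)] by (simp add: ac_simps)
    ultimately show ?case using add_closedD[OF addG g(1) h(1)] by blast
  qed
  from this[OF finite_msupp, of f] f(1) obtain g where g: "g \<in> G" "\<forall>s\<in>msupp f. s + g \<in> G"
    unfolding kmon_iff by blast
  have "msupp (mon g * f) \<subseteq> G" unfolding msupp_mon_mult using g(2) by (auto simp: add.commute)
  then have "mon g * f \<in> kmon G" by (simp add: kmon_iff)
  moreover have "y = Fraction_Field.Fract (mon g * f) (mon g)"
    unfolding f(2) to_frac_def by (simp add: eq_fract mult.commute)
  moreover have "mon g \<in> (kmon G :: ('p, 'k) polyz set)" using g(1) by simp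
  ultimately have "y \<in> fraction_field_of (kmon G :: ('p, 'k) polyz set)"
    unfolding fraction_field_of_def mem_Collect_eq by (intro exI[of _ "mon g * f"] exI[of _ "mon g"]) simp
  moreover have "integral_over (kmon G) f"
    using E.finite_extension_kmon[where ?'k = 'k, unfolded E_G] f(1)
    by (intro integral_over_finite_extension[OF subring_kmon[OF addG] subring_kmon[OF E.add_closed_S]])
  then have "integral_over (to_frac ` kmon G) y" unfolding f(2) by (rule integral_over_to_frac)
  ultimately show "y \<in> integral_closure (kmon G :: ('p, 'k) polyz set)" by (simp add: integral_closure_def)
qed

text \<open>Adding a large multiple of the sum of all columns to \<open>x\<close> makes the weights
  nonnegative, so the result is an exponent in \<open>E.S\<close>. If its monomial is a fraction of
  elements of \<open>kmon G\<close>, this exponent is a difference of two elements of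
  \<open>G\<close>.\<close>

lemma ehrhart_subset_imp_saturated:
  assumes sub: "to_frac ` (kmon E.S :: ('p, 'k::field) polyz set) \<subseteq> fraction_field_of (kmon G)"
  shows "saturated (weight_matrix W v m)"
  unfolding saturated_def dim_weight_matrix
proof (intro allI impI)
  let ?B = "weight_matrix W v m"
  fix x :: "nat \<Rightarrow> int" and \<mu> :: "nat \<Rightarrow> real"
  assume x: "\<forall>i<CARD('p) + 1. real_of_int (x i) = (\<Sum>j<m. \<mu> j * real_of_int (?B $$ (i, j)))"
  define M where "M = (\<Sum>j<m. nat \<lceil>\<bar>\<mu> j\<bar>\<rceil>)"
  have M: "\<mu> j + real M \<ge> 0" if "j < m" for j
  proof -
    have "nat \<lceil>\<bar>\<mu> j\<bar>\<rceil> \<le> M" unfolding M_def using that by (intro member_le_sum) auto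
    then have "\<bar>\<mu> j\<bar> \<le> real M" by linarith
    then show ?thesis by linarith
  qed
  define z where "z i = x i + int M * (\<Sum>j<m. ?B $$ (i, j))" for i
  have z: "real_of_int (z i) = (\<Sum>j<m. (\<mu> j + real M) * real_of_int (coord i (u (Suc j))))" if i: "i < CARD('p) + 1" for i
  proof -
    have "real_of_int (z i) = (\<Sum>j<m. (\<mu> j + real M) * real_of_int (?B $$ (i, j)))"
      unfolding z_def using x i by (simp add: ring_distribs sum.distrib sum_distrib_left)
    then show ?thesis using i by (simp add: weight_matrix_coord)
  qed
  have z0: "z i \<ge> 0" if "i < CARD('p) + 1" for i
  proof -
    have "real_of_int (z i) \<ge> 0" unfolding z[OF that]
      using M by (intro sum_nonneg mult_nonneg_nonneg) (auto simp: coord_def)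
    then show ?thesis by simp
  qed
  define y where "y = (\<Sum>i\<in>{1..m}. (\<mu> (i - 1) + real M) *\<^sub>R W (v i))"
  define n where "n = nat (z CARD('p))"
  have yq: "y $ (sorted_list_of_set UNIV ! i) = real_of_int (z i)" if i: "i < CARD('p)" for i
  proof -
    let ?q = "sorted_list_of_set (UNIV :: 'p set) ! i"
    have "y $ ?q = (\<Sum>j<m. (\<mu> j + real M) * W (v (Suc j)) $ ?q)"
      unfolding y_def sum_shift by simp
    also have "\<dots> = (\<Sum>j<m. (\<mu> j + real M) * real_of_int (coord i (u (Suc j))))"
    proof (intro sum.cong refl)
      fix j assume "j \<in> {..<m}"
      then have "rvec (exponent (W (v (Suc j)))) = W (v (Suc j))" by (intro rvec_exponent W_natural v) auto
      from arg_cong[OF this, of "\<lambda>x. x $ ?q"]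
      show "(\<mu> j + real M) * W (v (Suc j)) $ ?q = (\<mu> j + real M) * real_of_int (coord i (u (Suc j)))"
        using i by (simp add: coord_def u_def)
    qed
    finally show ?thesis using z[of i] i by simp
  qed
  have y_nat: "y \<in> natural_vectors"
    unfolding natural_vectors_iff
  proof
    fix q
    have "q \<in> set (sorted_list_of_set (UNIV :: 'p set))" by simp
    then obtain i where i: "i < CARD('p)" "sorted_list_of_set UNIV ! i = q"
      unfolding in_set_conv_nth by auto
    then have "y $ q = real_of_int (z i)" using yq by blast
    then show "y $ q \<in> \<int> \<and> 0 \<le> y $ q" using z0[of i] i by simp
  qed
  have zn: "real n = (\<Sum>j<m. \<mu> j + real M)"
    using z[of "CARD('p)"] z0[of "CARD('p)"] by (simp add: n_def coord_def u_def)
  have "y \<in> dilation n Q"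
    unfolding dilation_Q
  proof (intro exI[of _ "\<lambda>i. \<mu> (i - 1) + real M"] conjI ballI)
    show "(\<Sum>i\<in>{1..m}. \<mu> (i - 1) + real M) = real n" unfolding zn sum_shift by simp
    show "0 \<le> \<mu> (i - 1) + real M" if "i \<in> {1..m}" for i using M[of "i - 1"] that by auto
  qed (rule y_def)
  then have s: "(exponent y, n) \<in> E.S" using y_nat by (simp add: E_S_iff)
  have coord_s: "coord i (exponent y, n) = z i" if "i < CARD('p) + 1" for i
  proof (cases "i < CARD('p)")
    case True
    then show ?thesis using yq[OF True] z0[OF that] by (simp add: coord_def lookup_exponent)
  next
    case False
    then have "i = CARD('p)" using that by simp
    then show ?thesis using z0[OF that] by (simp add: coord_def n_def)
  qed
  have "to_frac (mon (exponent y, n)) \<in> fraction_field_of (kmon G :: ('p, 'k) polyz set)" using sub s by auto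
  then obtain a b :: "('p, 'k) polyz" where ab: "to_frac (mon (exponent y, n)) = Fraction_Field.Fract a b" "a \<in> kmon G" "b \<in> kmon G" "b \<noteq> 0"
    unfolding fraction_field_of_def by blast
  have eq: "mon (exponent y, n) * b = a" using ab(1,4) by (simp add: to_frac_def eq_fract)
  \<comment> \<open>Multiplication by a monomial shifts the support without cancellation, so any
    exponent of the denominator and its shift are the two elements of \<open>G\<close> looked
    for.\<close>
  obtain t where t: "t \<in> msupp b" using ab(4) msupp_eq_empty_iff[of b] by blast
  have "(exponent y, n) + t \<in> msupp a" unfolding eq[symmetric] msupp_mon_mult using t by blast
  then have stG: "(exponent y, n) + t \<in> G" using ab(2) unfolding kmon_iff by blast
  obtain k2 where k2: "\<forall>i<CARD('p) + 1. coord i ((exponent y, n) + t) = (\<Sum>j<m. int (k2 j) * ?B $$ (i, j))"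
    using coord_G[OF stG] by (elim exE)
  have tG: "t \<in> G" using t ab(3) unfolding kmon_iff by blast
  obtain k1 where k1: "\<forall>i<CARD('p) + 1. coord i t = (\<Sum>j<m. int (k1 j) * ?B $$ (i, j))"
    using coord_G[OF tG] by (elim exE)
  have "x i = (\<Sum>j<m. (int (k2 j) - int (k1 j) - int M) * ?B $$ (i, j))" if i: "i < CARD('p) + 1" for i
    using k1[rule_format, OF i] k2[rule_format, OF i] coord_s[OF i] unfolding coord_add z_def
    by (simp add: left_diff_distrib sum_subtractf sum_distrib_left)
  then show "\<exists>c. \<forall>i<CARD('p) + 1. x i = (\<Sum>j<m. c j * ?B $$ (i, j))"
    by (intro exI[of _ "\<lambda>j. int (k2 j) - int (k1 j) - int M"] allI impI)
qed

lemma integral_closures_eq_iff: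
  "(integral_closure (kmon G :: ('p, 'k::field) polyz set) = integral_closure (kmon S) \<and>
      integral_closure (kmon S :: ('p, 'k) polyz set) = to_frac ` kmon E.S) \<longleftrightarrow>
    Gcd (minors (int_mat_rank (weight_matrix W v m)) (weight_matrix W v m) - {0}) = 1"
  unfolding Gcd_minors_eq_1_iff
proof
  assume "integral_closure (kmon G :: ('p, 'k) polyz set) = integral_closure (kmon S) \<and>
      integral_closure (kmon S :: ('p, 'k) polyz set) = to_frac ` kmon E.S"
  then have "to_frac ` (kmon E.S :: ('p, 'k) polyz set) \<subseteq> fraction_field_of (kmon G)"
    unfolding integral_closure_def by blast
  then show "saturated (weight_matrix W v m)" by (rule ehrhart_subset_imp_saturated)
next
  assume "saturated (weight_matrix W v m)"
  then have "to_frac ` (kmon E.S :: ('p, 'k) polyz set) \<subseteq> integral_closure (kmon G)"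
    by (rule saturated_imp_ehrhart_subset)
  moreover have "integral_closure (kmon G :: ('p, 'k) polyz set) \<subseteq> integral_closure (kmon S)"
    by (intro integral_closure_mono kmon_mono G_subset_S)
  ultimately show "integral_closure (kmon G :: ('p, 'k) polyz set) = integral_closure (kmon S) \<and>
      integral_closure (kmon S :: ('p, 'k) polyz set) = to_frac ` kmon E.S"
    using integral_closure_subset_ehrhart[where ?'k = 'k] by blast
qed

end

section \<open>The theorem in terms of exponent monoids\<close>

lemma xz_monom_eq: "xz_monom a n = mon (exponent a, n)"
  by (simp add: xz_monom_def mon_def)

theorem theorem4p1:
  fixes v :: "nat \<Rightarrow> real ^ 's"
    and m :: nat
    and w :: "'p::{finite,linorder} \<Rightarrow> real ^ 's \<Rightarrow> real"
  assumes "m \<ge> 1"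
    and "\<forall>i\<in>{1..m}. v i \<in> natural_vectors"
    and "\<forall>i. linear (w i)"
    and "\<forall>i j. w i (axis j 1) \<in> \<nat>"
  defines "P \<equiv> convex hull (v ` {1..m})"
    and "W \<equiv> (\<lambda>x. \<chi> i. w i x)"
  defines "wP \<equiv> convex hull (W ` v ` {1..m})"
    and "B \<equiv> weight_matrix W v m"
    and "A \<equiv> (ehrhart_ring P :: ('s, 'k::field) polyz set)"
    and "Aw \<equiv> (weighted_ehrhart_ring W P :: ('p, 'k) polyz set)"
    and "Awn \<equiv> (weighted_ehrhart_component W P :: nat \<Rightarrow> ('p, 'k) polyz set)"
    and "L \<equiv> (kalgebra {xz_monom (W (v i)) 1 | i. i \<in> {1..m}} :: ('p, 'k) polyz set)"
  shows
    "graded_kalgebra Aw Awn \<and>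
     (\<forall>n. hilbert_function Awn n = card (W ` lattice_points (dilation n P))) \<and>
     (\<exists>(r::nat) c d.
        (\<forall>i\<in>{1..r}. c i \<in> natural_vectors \<and> xz_monom (c i) (d i) \<in> A) \<and>
        A = kalgebra {xz_monom (c i) (d i) | i. i \<in> {1..r}} \<and>
        Aw = kalgebra {xz_monom (W (c i)) (d i) | i. i \<in> {1..r}}) \<and>
     (finite_extension L Aw \<and> integral_extension L Aw) \<and>
     (integral_closure L \<subseteq> integral_closure Aw \<and>
        integral_closure Aw \<subseteq> to_frac ` ehrhart_ring wP \<and>
        ((integral_closure L = integral_closure Aw \<and>
          integral_closure Aw = to_frac ` ehrhart_ring wP)
         \<longleftrightarrow> Gcd (minors (int_mat_rank B) B - {0}) = 1)) \<and>
     (\<exists>d\<ge>1. krull_dim Aw = enat d \<and>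
        polynomial_function_of_degree (hilbert_function Awn) (d - 1) \<and>
        (\<exists>h :: int poly. poly h 1 \<noteq> 0 \<and>
          Abs_fps (\<lambda>n. of_nat (hilbert_function Awn n)) =
            fps_of_poly (map_poly rat_of_int h) / (1 - fps_X) ^ d))"
proof -
  have W_linear: "linear W"
    unfolding W_def using assms(3) by (auto simp: linear_iff Finite_Cartesian_Product.vec_eq_iff)
  have W_natural: "W x \<in> natural_vectors" if x: "x \<in> natural_vectors" for x
    unfolding natural_vectors_def
  proof (intro CollectI allI)
    fix i
    have "w i x = w i (\<Sum>j\<in>UNIV. x $ j *\<^sub>R axis j 1)" by (simp add: basis_expansion[of x, unfolded scalar_mult_eq_scaleR])
    also have "\<dots> = (\<Sum>j\<in>UNIV. x $ j * w i (axis j 1))"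
      using assms(3) by (simp add: linear_sum linear_scale)
    finally have wix: "w i x = (\<Sum>j\<in>UNIV. x $ j * w i (axis j 1))" .
    show "W x $ i \<in> \<nat>"
    proof -
      have "(\<Sum>j\<in>X. x $ j * w i (axis j 1)) \<in> \<nat>" for X
        using x assms(4) by (induction X rule: infinite_finite_induct) (auto simp: natural_vectors_def)
      then show ?thesis unfolding W_def using wix by simp
    qed
  qed
  interpret wp: weighted_polytope_lin v m W
    using assms(1,2) W_natural by unfold_locales (auto simp: linear_add[OF W_linear] linear_scale[OF W_linear])
  interpret pp: weighted_polytope v m "\<lambda>x. x"
    using assms(1,2) by unfold_locales (auto simp: linear_iff)
  have P: "P = wp.P" by (simp add: P_def wp.P_def)
  have wP: "wP = wp.Q" by (simp add: wP_def wp.Q_def)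
  have Aw: "Aw = kmon wp.S"
  proof -
    have "{xz_monom (W a) n | a n. a \<in> lattice_points (dilation n P)} = (mon ` wp.S :: ('p, 'k) polyz set)"
      unfolding wp.S_def P xz_monom_eq by blast
    then show ?thesis
      unfolding Aw_def weighted_ehrhart_ring_def by (simp add: kalgebra_mon monoid_gen_add_closed[OF wp.add_closed_S])
  qed
  have A: "A = kmon pp.S"
  proof -
    have "{xz_monom a n | a n. a \<in> lattice_points (dilation n P)} = (mon ` pp.S :: ('s, 'k) polyz set)"
      unfolding pp.S_def P xz_monom_eq by blast
    then show ?thesis
      unfolding A_def ehrhart_ring_def by (simp add: kalgebra_mon monoid_gen_add_closed[OF pp.add_closed_S])
  qed
  have EwP: "ehrhart_ring wP = (kmon wp.E.S :: ('p, 'k) polyz set)"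
  proof -
    have "{xz_monom a n | a n. a \<in> lattice_points (dilation n wP)} = (mon ` wp.E.S :: ('p, 'k) polyz set)"
      unfolding wp.E.S_def wp.E_P wP xz_monom_eq by blast
    then show ?thesis
      unfolding ehrhart_ring_def by (simp add: kalgebra_mon monoid_gen_add_closed[OF wp.E.add_closed_S])
  qed
  have L: "L = kmon wp.G"
  proof -
    have "{xz_monom (W (v i)) 1 | i. i \<in> {1..m}} = (mon ` wp.u ` {1..m} :: ('p, 'k) polyz set)"
      unfolding xz_monom_eq wp.u_def by blast
    then show ?thesis unfolding L_def wp.G_def by (simp only: kalgebra_mon)
  qed
  have Awn: "Awn = (\<lambda>n. kmon {s \<in> wp.S. snd s = n})"
  proof
    fix n
    have "{xz_monom (W a) n | a. a \<in> lattice_points (dilation n P)} = (mon ` {s \<in> wp.S. snd s = n} :: ('p, 'k) polyz set)"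
      unfolding wp.S_slice P xz_monom_eq by blast
    then show "Awn n = kmon {s \<in> wp.S. snd s = n}"
      unfolding Awn_def weighted_ehrhart_component_def by (simp only: kspan_mon)
  qed
  have hilb: "hilbert_function Awn = (\<lambda>n. card {s \<in> wp.S. snd s = n})"
    by (rule ext) (simp add: hilbert_function_def Awn kdim_kmon)
  have "graded_kalgebra Aw Awn" unfolding Aw Awn by (rule graded_kmon[OF wp.add_closed_S])
  moreover have "\<forall>n. hilbert_function Awn n = card (W ` lattice_points (dilation n P))"
    unfolding hilb P wp.card_S_slice by simp
  moreover have "\<exists>(r::nat) c d.
        (\<forall>i\<in>{1..r}. c i \<in> natural_vectors \<and> xz_monom (c i) (d i) \<in> A) \<and>
        A = kalgebra {xz_monom (c i) (d i) | i. i \<in> {1..r}} \<and>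
        Aw = kalgebra {xz_monom (W (c i)) (d i) | i. i \<in> {1..r}}"
  proof -
    \<comment> \<open>The common source of \<open>pp.T0\<close> and \<open>wp.T0\<close>; listing it
      once numbers the generators of both rings simultaneously.\<close>
    define Z where "Z = {(a, n). n \<le> m \<and> a \<in> lattice_points (dilation n P)}"
    have "Z = (\<Union>n\<le>m. (\<lambda>a. (a, n)) ` lattice_points (dilation n P))" by (auto simp: Z_def)
    then have "finite Z" using pp.finite_lattice_points by (simp add: P)
    then obtain zs where zs: "set zs = Z" using finite_list by blast
    define c where "c i = fst (zs ! (i - 1))" for i
    define d where "d i = snd (zs ! (i - 1))" for i
    have range: "{f (c i) (d i) | i. i \<in> {1..length zs}} = {f a n | a n. (a, n) \<in> Z}" for f :: "real ^ 's \<Rightarrow> nat \<Rightarrow> 'b"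
    proof
      show "{f (c i) (d i) | i. i \<in> {1..length zs}} \<subseteq> {f a n | a n. (a, n) \<in> Z}"
      proof
        fix y assume "y \<in> {f (c i) (d i) | i. i \<in> {1..length zs}}"
        then obtain i where i: "i \<in> {1..length zs}" "y = f (c i) (d i)" by blast
        have "zs ! (i - 1) \<in> Z" unfolding zs[symmetric] using i(1) by (intro nth_mem) auto
        then show "y \<in> {f a n | a n. (a, n) \<in> Z}" unfolding i(2) c_def d_def by (metis (mono_tags, lifting) mem_Collect_eq prod.collapse)
      qed
      show "{f a n | a n. (a, n) \<in> Z} \<subseteq> {f (c i) (d i) | i. i \<in> {1..length zs}}"
      proof
        fix y assume "y \<in> {f a n | a n. (a, n) \<in> Z}"
        then obtain a n where an: "y = f a n" "(a, n) \<in> Z" by blast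
        then obtain j where "j < length zs" "zs ! j = (a, n)" unfolding zs[symmetric] in_set_conv_nth by blast
        then show "y \<in> {f (c i) (d i) | i. i \<in> {1..length zs}}"
          unfolding an(1) by (intro CollectI exI[of _ "Suc j"]) (simp add: c_def d_def)
      qed
    qed
    have "{xz_monom a n | a n. (a, n) \<in> Z} = (mon ` pp.T0 :: ('s, 'k) polyz set)"
      unfolding pp.T0_def Z_def P xz_monom_eq by blast
    then have 1: "A = kalgebra {xz_monom (c i) (d i) | i. i \<in> {1..length zs}}"
      unfolding range[of xz_monom] A by (simp only: kalgebra_mon pp.monoid_gen_T0)
    have "{xz_monom (W a) n | a n. (a, n) \<in> Z} = (mon ` wp.T0 :: ('p, 'k) polyz set)"
      unfolding wp.T0_def Z_def P xz_monom_eq by blast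
    then have 2: "Aw = kalgebra {xz_monom (W (c i)) (d i) | i. i \<in> {1..length zs}}"
      unfolding range[of "\<lambda>a. xz_monom (W a)"] Aw by (simp only: kalgebra_mon wp.monoid_gen_T0)
    have 3: "c i \<in> natural_vectors \<and> xz_monom (c i) (d i) \<in> A" if i: "i \<in> {1..length zs}" for i
    proof -
      have "zs ! (i - 1) \<in> Z" unfolding zs[symmetric] using i by (intro nth_mem) auto
      then have lp: "c i \<in> lattice_points (dilation (d i) wp.P)" unfolding c_def d_def Z_def P by auto
      then have "(exponent (c i), d i) \<in> pp.S" unfolding pp.S_def by blast
      then have "mon (exponent (c i), d i) \<in> A" unfolding A by simp
      then show ?thesis using lp pp.lattice_points_natural by (auto simp: xz_monom_eq)
    qed
    show ?thesis
      by (rule exI[of _ "length zs"], rule exI[of _ c], rule exI[of _ d]) (intro conjI ballI 1 2 3)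
  qed
  moreover have fin: "finite_extension L Aw" unfolding L Aw by (rule wp.finite_extension_kmon)
  moreover have "integral_extension L Aw"
    unfolding integral_extension_def
  proof (intro conjI ballI)
    show "L \<subseteq> Aw" unfolding L Aw by (rule kmon_mono[OF wp.G_subset_S])
    have "add_closed wp.G" unfolding wp.G_def by (rule add_closed_monoid_gen)
    then show "integral_over L x" if "x \<in> Aw" for x
      using that fin unfolding L Aw
      by (intro integral_over_finite_extension[OF subring_kmon subring_kmon[OF wp.add_closed_S]])
  qed
  moreover have "integral_closure L \<subseteq> integral_closure Aw"
    unfolding L Aw by (intro integral_closure_mono kmon_mono wp.G_subset_S)
  moreover have "integral_closure Aw \<subseteq> to_frac ` ehrhart_ring wP"
    unfolding Aw EwP by (rule wp.integral_closure_subset_ehrhart)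
  moreover have "(integral_closure L = integral_closure Aw \<and>
          integral_closure Aw = to_frac ` ehrhart_ring wP)
         \<longleftrightarrow> Gcd (minors (int_mat_rank B) B - {0}) = 1"
    unfolding L Aw EwP B_def by (rule wp.integral_closures_eq_iff)
  moreover have "\<exists>d\<ge>1. krull_dim Aw = enat d \<and>
        polynomial_function_of_degree (hilbert_function Awn) (d - 1) \<and>
        (\<exists>h :: int poly. poly h 1 \<noteq> 0 \<and>
          Abs_fps (\<lambda>n. of_nat (hilbert_function Awn n)) =
            fps_of_poly (map_poly rat_of_int h) / (1 - fps_X) ^ d)"
    \<comment> \<open>The Krull dimension and the order of the pole are both
      \<open>dim w(P) + 1\<close>.\<close>
    unfolding hilb Aw
    using krull_dim_weighted[OF wp.weighted_polytope_axioms, where ?'k = 'k] wp.hilbert_polynomial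
    by (intro exI[of _ "nat (aff_dim wp.Q) + 1"]) simp
  ultimately show ?thesis by (intro conjI)
qed

end
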